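(* Every $2$-rose graph other than $R(3,4)$ and $R(3,5)$ is determined by its Laplacian spectrum. Each of $R(3,4)$ and $R(3,5)$ has exactly one Laplacian cospectral mate (up to isomorphism).
   Context: Graphs are finite, simple and undirected. A $2$-rose graph is a graph consisting of two cycles sharing exactly one vertex; equivalently, a connected graph with one vertex of degree $4$ and all other vertices of degree $2$. For $\ell\ge3$, $R(3,\ell)$ denotes the $2$-rose graph whose two cycles are a triangle and a cycle of length $\ell$. The Laplacian spectrum of a graph is the multiset of eigenvalues of $L=D-A$, where $A$ is the adjacency matrix and $D$ the diagonal degree matrix. A graph is determined by its Laplacian spectrum if every graph with the same Laplacian spectrum is isomorphic to it; a Laplacian cospectral mate of $G$ is a graph not isomorphic to $G$ with the same Laplacian spectrum. *)

theory Defs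
  imports "Jordan_Normal_Form.Char_Poly"
begin

type_synonym 'a ugraph = "'a set \<times> 'a set set"

abbreviation verts :: "'a ugraph \<Rightarrow> 'a set" where
  "verts \<equiv> fst"

abbreviation edges :: "'a ugraph \<Rightarrow> 'a set set" where
  "edges \<equiv> snd"

definition simple_graph :: "'a ugraph \<Rightarrow> bool" where
  "simple_graph G \<longleftrightarrow> finite (verts G) \<and> (\<forall>e\<in>edges G. e \<subseteq> verts G \<and> card e = 2)"

definition graph_iso :: "'a ugraph \<Rightarrow> 'b ugraph \<Rightarrow> bool" where
  "graph_iso G H \<longleftrightarrow> (\<exists>f. bij_betw f (verts G) (verts H) \<and>
     (\<forall>u\<in>verts G. \<forall>v\<in>verts G. {u, v} \<in> edges G \<longleftrightarrow> {f u, f v} \<in> edges H))"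

definition cycle_of :: "'a list \<Rightarrow> 'a ugraph" where
  "cycle_of xs = (set xs, {{xs ! i, xs ! (Suc i mod length xs)} | i. i < length xs})"

definition graph_union :: "'a ugraph \<Rightarrow> 'a ugraph \<Rightarrow> 'a ugraph" where
  "graph_union G H = (verts G \<union> verts H, edges G \<union> edges H)"

definition two_rose :: "'a ugraph \<Rightarrow> bool" where
  "two_rose G \<longleftrightarrow> (\<exists>xs ys v. distinct xs \<and> distinct ys \<and> length xs \<ge> 3 \<and> length ys \<ge> 3 \<and>
     set xs \<inter> set ys = {v} \<and> G = graph_union (cycle_of xs) (cycle_of ys))"

text \<open>A concrete copy of $R(k,l)$, meaningful for $k, l \ge 3$; the shared vertex is 0.\<close>

definition rose :: "nat \<Rightarrow> nat \<Rightarrow> nat ugraph" where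
  "rose k l = graph_union (cycle_of [0..<k]) (cycle_of (0 # [k..<k + l - 1]))"

definition degree_mat :: "'a ugraph \<Rightarrow> 'a list \<Rightarrow> complex mat" where
  "degree_mat G vs = mat (length vs) (length vs)
     (\<lambda>(i, j). if i = j then of_nat (card {e \<in> edges G. vs ! i \<in> e}) else 0)"

definition adjacency_mat :: "'a ugraph \<Rightarrow> 'a list \<Rightarrow> complex mat" where
  "adjacency_mat G vs = mat (length vs) (length vs)
     (\<lambda>(i, j). if {vs ! i, vs ! j} \<in> edges G then 1 else 0)"

definition laplacian_mat :: "'a ugraph \<Rightarrow> 'a list \<Rightarrow> complex mat" where
  "laplacian_mat G vs = degree_mat G vs - adjacency_mat G vs"

text \<open>The eigenvalues are counted with multiplicity as roots of the characteristic polynomial.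
  The choice of vertex enumeration is immaterial, see \<open>laplacian_spectrum_eq\<close> below.\<close>

definition laplacian_spectrum :: "'a ugraph \<Rightarrow> complex multiset" where
  "laplacian_spectrum G =
     proots (char_poly (laplacian_mat G (SOME vs. distinct vs \<and> set vs = verts G)))"

text \<open>The extra type argument is the vertex type of the competing graphs, since HOL cannot
  quantify over types inside a formula.\<close>

definition determined_by_laplacian_spectrum :: "'b itself \<Rightarrow> 'a ugraph \<Rightarrow> bool" where
  "determined_by_laplacian_spectrum T G \<longleftrightarrow>
     (\<forall>H :: 'b ugraph. simple_graph H \<and> laplacian_spectrum H = laplacian_spectrum G \<longrightarrow>
        graph_iso H G)"

definition laplacian_cospectral_mate :: "'a ugraph \<Rightarrow> 'b ugraph \<Rightarrow> bool" where
  "laplacian_cospectral_mate G H \<longleftrightarrow>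
     simple_graph H \<and> \<not> graph_iso H G \<and> laplacian_spectrum H = laplacian_spectrum G"

lemma simple_graph_cycle_of:
  assumes "distinct xs" "length xs \<ge> 3"
  shows "simple_graph (cycle_of xs)"
proof -
  have "{xs ! i, xs ! (Suc i mod length xs)} \<subseteq> set xs \<and>
        card {xs ! i, xs ! (Suc i mod length xs)} = 2" if i: "i < length xs" for i
  proof -
    have lt: "Suc i mod length xs < length xs" using i by (intro mod_less_divisor) linarith
    have "i \<noteq> Suc i mod length xs"
      using i assms(2) by (cases "Suc i = length xs") auto
    then have "xs ! i \<noteq> xs ! (Suc i mod length xs)"
      using assms(1) i lt nth_eq_iff_index_eq by blast
    then show ?thesis using i lt by simp
  qed
  then show ?thesis by (auto simp: simple_graph_def cycle_of_def)
qed

lemma two_rose_simple_graph: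
  assumes "two_rose G"
  shows "simple_graph G"
proof -
  obtain xs ys where "simple_graph (cycle_of xs)" "simple_graph (cycle_of ys)"
    "G = graph_union (cycle_of xs) (cycle_of ys)"
    using assms simple_graph_cycle_of unfolding two_rose_def by blast
  then show ?thesis
    by (auto simp: graph_union_def simple_graph_def)
qed

lemma two_rose_rose:
  assumes "k \<ge> 3" "l \<ge> 3"
  shows "two_rose (rose k l)"
  unfolding two_rose_def rose_def
  by (rule exI[of _ "[0..<k]"], rule exI[of _ "0 # [k..<k + l - 1]"], rule exI[of _ 0])
     (use assms in auto)

lemma laplacian_spectrum_eq:
  assumes vs: "distinct vs" "set vs = verts G"
  shows "laplacian_spectrum G = proots (char_poly (laplacian_mat G vs))"
proof -
  define ws where "ws = (SOME ws. distinct ws \<and> set ws = verts G)"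
  have ws: "distinct ws" "set ws = verts G"
    using someI[of "\<lambda>ws. distinct ws \<and> set ws = verts G" vs] vs unfolding ws_def by auto
  define n where "n = length vs"
  have n: "length ws = n"
    using vs ws unfolding n_def by (metis distinct_card)
  define P :: "complex mat" where "P = mat n n (\<lambda>(i, j). if ws ! i = vs ! j then 1 else 0)"
  define Q :: "complex mat" where "Q = mat n n (\<lambda>(i, j). if vs ! i = ws ! j then 1 else 0)"
  have ex1: "\<exists>k<n. ws ! i = vs ! k" if "i < n" for i
    using that vs ws n n_def by (metis in_set_conv_nth)
  have ex2: "\<exists>k<n. vs ! i = ws ! k" if "i < n" for i
    using that vs ws n n_def by (metis in_set_conv_nth)
  have eqv: "vs ! i = vs ! j \<longleftrightarrow> i = j" if "i < n" "j < n" for i j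
    using that vs n_def nth_eq_iff_index_eq by blast
  have eqw: "ws ! i = ws ! j \<longleftrightarrow> i = j" if "i < n" "j < n" for i j
    using that ws n nth_eq_iff_index_eq by blast
  have sumP: "(\<Sum>k = 0..<n. (if ws ! i = vs ! k then 1 else 0) * f k) = f k0"
    if "k0 < n" "ws ! i = vs ! k0" for i k0 and f :: "nat \<Rightarrow> complex"
  proof -
    have "(\<Sum>k = 0..<n. (if ws ! i = vs ! k then 1 else 0) * f k) =
          (\<Sum>k = 0..<n. if k = k0 then f k else 0)"
      using that eqv by (intro sum.cong) auto
    then show ?thesis using that by simp
  qed
  have sumQ: "(\<Sum>k = 0..<n. (if vs ! i = ws ! k then 1 else 0) * f k) = f k0"
    if "k0 < n" "vs ! i = ws ! k0" for i k0 and f :: "nat \<Rightarrow> complex"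
  proof -
    have "(\<Sum>k = 0..<n. (if vs ! i = ws ! k then 1 else 0) * f k) =
          (\<Sum>k = 0..<n. if k = k0 then f k else 0)"
      using that eqw by (intro sum.cong) auto
    then show ?thesis using that by simp
  qed
  have carr: "P \<in> carrier_mat n n" "Q \<in> carrier_mat n n"
    by (auto simp: P_def Q_def)
  have carrL: "laplacian_mat G vs \<in> carrier_mat n n" "laplacian_mat G ws \<in> carrier_mat n n"
    by (auto simp: laplacian_mat_def degree_mat_def adjacency_mat_def n n_def[symmetric])
  have PQ: "P * Q = 1\<^sub>m n"
  proof (rule eq_matI)
    fix i j assume "i < dim_row (1\<^sub>m n :: complex mat)" "j < dim_col (1\<^sub>m n :: complex mat)"
    then have ij: "i < n" "j < n" by auto
    obtain k where k: "k < n" "ws ! i = vs ! k" using ex1 ij by blast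
    have "(P * Q) $$ (i, j) = (\<Sum>t = 0..<n. (if ws ! i = vs ! t then 1 else 0) *
            (if vs ! t = ws ! j then 1 else 0))"
      using ij by (simp add: P_def Q_def scalar_prod_def)
    also have "\<dots> = (if vs ! k = ws ! j then 1 else 0)"
      by (rule sumP[OF k])
    also have "\<dots> = 1\<^sub>m n $$ (i, j)"
      using ij eqw[OF ij] by (simp add: k(2)[symmetric])
    finally show "(P * Q) $$ (i, j) = 1\<^sub>m n $$ (i, j)" .
  qed (auto simp: P_def Q_def)
  have QP: "Q * P = 1\<^sub>m n"
  proof (rule eq_matI)
    fix i j assume "i < dim_row (1\<^sub>m n :: complex mat)" "j < dim_col (1\<^sub>m n :: complex mat)"
    then have ij: "i < n" "j < n" by auto
    obtain k where k: "k < n" "vs ! i = ws ! k" using ex2 ij by blast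
    have "(Q * P) $$ (i, j) = (\<Sum>t = 0..<n. (if vs ! i = ws ! t then 1 else 0) *
            (if ws ! t = vs ! j then 1 else 0))"
      using ij by (simp add: P_def Q_def scalar_prod_def)
    also have "\<dots> = (if ws ! k = vs ! j then 1 else 0)"
      by (rule sumQ[OF k])
    also have "\<dots> = 1\<^sub>m n $$ (i, j)"
      using ij eqv[OF ij] by (simp add: k(2)[symmetric])
    finally show "(Q * P) $$ (i, j) = 1\<^sub>m n $$ (i, j)" .
  qed (auto simp: P_def Q_def)
  have "laplacian_mat G ws * P = P * laplacian_mat G vs"
  proof (rule eq_matI)
    fix i j assume "i < dim_row (P * laplacian_mat G vs)" "j < dim_col (P * laplacian_mat G vs)"
    then have ij: "i < n" "j < n" using carr carrL by auto
    obtain k where k: "k < n" "ws ! i = vs ! k" using ex1 ij by blast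
    obtain m where m: "m < n" "vs ! j = ws ! m" using ex2 ij by blast
    have "(laplacian_mat G ws * P) $$ (i, j) =
          (\<Sum>t = 0..<n. laplacian_mat G ws $$ (i, t) * (if ws ! t = vs ! j then 1 else 0))"
      using ij carrL(2) by (simp add: P_def scalar_prod_def)
    also have "\<dots> = (\<Sum>t = 0..<n. (if vs ! j = ws ! t then 1 else 0) * laplacian_mat G ws $$ (i, t))"
      by (intro sum.cong) auto
    also have "\<dots> = laplacian_mat G ws $$ (i, m)"
      using sumQ[OF m] .
    also have "\<dots> = laplacian_mat G vs $$ (k, j)"
    proof -
      have "i = m \<longleftrightarrow> k = j"
        using eqv[OF k(1) ij(2)] eqw[OF ij(1) m(1)] k(2) m(2) by argo
      then show ?thesis
        using ij k(1) m(1)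
        by (simp add: laplacian_mat_def degree_mat_def adjacency_mat_def n n_def[symmetric]
            k(2) m(2)[symmetric])
    qed
    also have "\<dots> = (P * laplacian_mat G vs) $$ (i, j)"
      using ij carrL(1) sumP[OF k, of "\<lambda>t. laplacian_mat G vs $$ (t, j)"]
      by (simp add: P_def scalar_prod_def)
    finally show "(laplacian_mat G ws * P) $$ (i, j) = (P * laplacian_mat G vs) $$ (i, j)" .
  qed (use carr carrL in auto)
  then have "P * laplacian_mat G vs * Q = laplacian_mat G ws * P * Q"
    by simp
  also have "\<dots> = laplacian_mat G ws * (P * Q)"
    by (rule assoc_mult_mat[OF carrL(2) carr])
  also have "\<dots> = laplacian_mat G ws"
    unfolding PQ by (rule right_mult_one_mat[OF carrL(2)])
  finally have sim: "laplacian_mat G ws = P * laplacian_mat G vs * Q"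
    by (rule sym)
  have "similar_mat (laplacian_mat G ws) (laplacian_mat G vs)"
    by (rule similar_matI[OF _ PQ QP sim]) (simp add: carr carrL)
  then show ?thesis
    unfolding laplacian_spectrum_def ws_def[symmetric] by (simp only: char_poly_similar)
qed

end

theory Submission
  imports Defs "Jordan_Normal_Form.Schur_Decomposition"
begin

text \<open>
  Let \<open>H\<close> be cospectral to \<open>R(k, l)\<close>. Two kinds of spectral invariants are used: the traces of
  \<open>L, L\<^sup>2, L\<^sup>3, L\<^sup>4\<close>, and the determinant \<open>\<tau>\<close> of \<open>L\<close> with one vertex deleted, which up to the factor
  \<open>\<plusminus>n\<close> is the linear coefficient of the characteristic polynomial. For \<open>R(k, l)\<close> one has \<open>\<tau> = k l\<close>;
  as this is nonzero, \<open>H\<close> is connected. The first two traces say that the deviations \<open>d - 2\<close> of the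
  degrees of \<open>H\<close> have sum 2 and square sum 4. So either one degree is 4 and the others are 2, in
  which case \<open>H\<close> is a two-rose \<open>R(k', l')\<close> with \<open>k' + l' = k + l\<close> and \<open>k' l' = k l\<close>, or the degrees are
  \<open>3, 3, 3, 1, 2, \<dots>, 2\<close>.

  In the second case the third trace shows that \<open>H\<close> has one triangle less than \<open>R(k, l)\<close>, so \<open>k = 3\<close>,
  and for \<open>l \<ge> 4\<close> the graph \<open>H\<close> is triangle-free. The fourth trace then gives
  \<open>c(H) = c(R(3, l)) + (5 - s) / 2\<close>, where \<open>c\<close> counts 4-cycles and \<open>s \<le> 2\<close> is the number of edges
  between vertices of degree 3 minus the number of edges from the vertex of degree 1 to those. So
  \<open>H\<close> has two 4-cycles. If they are disjoint, the only edges that carry a flow of a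
  harmonic function modulo 3 lie on them, and since 4 is invertible modulo 3 such a function is
  constant; this contradicts \<open>\<tau> = 3 l\<close>. If they meet, their union is \<open>K\<^sub>2\<^sub>,\<^sub>3\<close> or a ladder with two
  squares, and parity of \<open>s\<close> forces the pendant vertex to sit directly on it, so that \<open>l = 4\<close> or
  \<open>l = 5\<close>.
\<close>

section \<open>Graphs and isomorphisms\<close>

text \<open>By the matrix-tree theorem \<open>\<tau>\<close> is the number of spanning trees. This
  explains the value \<open>k l\<close> for a rose and the choice of the prime 3: a connected graph
  with one more edge than vertices and two disjoint 4-cycles has 4 * 4 = 16 spanning trees, not a
  multiple of 3. The proof stays with determinants instead: if 3 divides \<open>\<tau>\<close>, the
  reduced Laplacian is singular over the field with three elements, and a kernel vector is a
  potential whose flow can live only on the cycles. The obstacle is that degrees and triangles alone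
  cannot separate R(3, l) from graphs with degrees 3, 3, 3, 1, 2, ..., 2. The fourth trace is where
  4-cycles enter, coupled to the adjacencies among the four exceptional vertices; the parity used at
  the end is the integrality of (5 - s) / 2. The case l = 3 stands apart, because R(3, 3) has two
  triangles and one of them survives in \<open>H\<close>. That the two exceptional graphs really are
  cospectral is certified by integer matrices intertwining the Laplacians.\<close>

definition nbrs :: "'a ugraph \<Rightarrow> 'a \<Rightarrow> 'a set" where
  "nbrs G u = {w. {u, w} \<in> edges G}"

definition deg :: "'a ugraph \<Rightarrow> 'a \<Rightarrow> nat" where
  "deg G u = card (nbrs G u)"

lemma nbrs_sym: "w \<in> nbrs G u \<longleftrightarrow> u \<in> nbrs G w"
  by (simp add: nbrs_def insert_commute)

lemma simple_graph_nbrs: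
  assumes "simple_graph G"
  shows "nbrs G u \<subseteq> verts G" "finite (nbrs G u)" "u \<notin> nbrs G u"
    "w \<in> nbrs G u \<Longrightarrow> u \<in> verts G" "w \<in> nbrs G u \<Longrightarrow> w \<noteq> u"
proof -
  show 1: "nbrs G u \<subseteq> verts G"
    using assms unfolding simple_graph_def nbrs_def by fastforce
  then show "finite (nbrs G u)"
    using assms finite_subset unfolding simple_graph_def by blast
  show 2: "u \<notin> nbrs G u"
    using assms unfolding simple_graph_def nbrs_def by force
  show "w \<in> nbrs G u \<Longrightarrow> u \<in> verts G"
    using assms unfolding simple_graph_def nbrs_def by fastforce
  show "w \<in> nbrs G u \<Longrightarrow> w \<noteq> u" using 2 by blast
qed

lemma simple_graph_edgeE:
  assumes "simple_graph G" "e \<in> edges G"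
  obtains u w where "e = {u, w}" "u \<noteq> w" "u \<in> verts G" "w \<in> verts G" "w \<in> nbrs G u"
proof -
  have "card e = 2" "e \<subseteq> verts G" using assms unfolding simple_graph_def by auto
  then obtain u w where "e = {u, w}" "u \<noteq> w" by (auto simp: card_2_iff)
  then show thesis using that assms \<open>e \<subseteq> verts G\<close> by (auto simp: nbrs_def)
qed

lemma card_incident_edges:
  assumes "simple_graph G"
  shows "card {e \<in> edges G. u \<in> e} = deg G u"
proof -
  have "{e \<in> edges G. u \<in> e} = (\<lambda>w. {u, w}) ` nbrs G u"
  proof (intro equalityI subsetI)
    fix e assume "e \<in> {e \<in> edges G. u \<in> e}"
    then have e: "e \<in> edges G" "u \<in> e" by auto
    obtain x y where "e = {x, y}" using simple_graph_edgeE[OF assms e(1)] by metis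
    then have "e = {u, x} \<or> e = {u, y}" using e(2) by auto
    then show "e \<in> (\<lambda>w. {u, w}) ` nbrs G u" using e(1) by (auto simp: nbrs_def)
  qed (auto simp: nbrs_def)
  moreover have "inj_on (\<lambda>w. {u, w}) (nbrs G u)"
    by (auto simp: inj_on_def doubleton_eq_iff)
  ultimately show ?thesis by (simp add: deg_def card_image)
qed

lemma finite_edges:
  assumes "simple_graph G"
  shows "finite (edges G)"
proof (rule finite_subset)
  show "edges G \<subseteq> Pow (verts G)" "finite (Pow (verts G))"
    using assms by (auto simp: simple_graph_def)
qed

lemma sum_deg:
  assumes "simple_graph G"
  shows "(\<Sum>u\<in>verts G. deg G u) = 2 * card (edges G)"
proof -
  have fin: "finite (verts G)" "finite (edges G)"
    using assms finite_edges[OF assms] by (auto simp: simple_graph_def)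
  have "(\<Sum>u\<in>verts G. deg G u) = (\<Sum>u\<in>verts G. \<Sum>e\<in>edges G. if u \<in> e then 1 else 0)"
    using fin by (simp add: card_incident_edges[OF assms, symmetric] sum.If_cases Collect_conj_eq)
  also have "\<dots> = (\<Sum>e\<in>edges G. \<Sum>u\<in>verts G. if u \<in> e then 1 else 0)"
    by (rule sum.swap)
  also have "\<dots> = (\<Sum>e\<in>edges G. 2)"
  proof (rule sum.cong[OF refl])
    fix e assume e: "e \<in> edges G"
    then have "verts G \<inter> e = e" "card e = 2" using assms by (auto simp: simple_graph_def)
    then show "(\<Sum>u\<in>verts G. if u \<in> e then 1 else 0) = (2::nat)"
      using fin by (simp add: sum.If_cases)
  qed
  finally show ?thesis by simp
qed

text \<open>This is how the small graphs are reconstructed: once as many neighbours are known as the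
  degree allows, none can be missing.\<close>

lemma nbrs_eqI:
  assumes "simple_graph G" "S \<subseteq> nbrs G u" "deg G u \<le> card S" 
  shows "nbrs G u = S"
  using assms card_seteq[of "nbrs G u" S] simple_graph_nbrs(2)[of G u] by (simp add: deg_def)

lemma graph_iso_sym:
  assumes "graph_iso G H"
  shows "graph_iso H G"
proof -
  obtain f where f: "bij_betw f (verts G) (verts H)"
    and e: "\<And>u v. u \<in> verts G \<Longrightarrow> v \<in> verts G \<Longrightarrow> {u, v} \<in> edges G \<longleftrightarrow> {f u, f v} \<in> edges H"
    using assms unfolding graph_iso_def by blast
  let ?g = "inv_into (verts G) f"
  have g: "bij_betw ?g (verts H) (verts G)" using f by (rule bij_betw_inv_into)
  have "{u, v} \<in> edges H \<longleftrightarrow> {?g u, ?g v} \<in> edges G" if "u \<in> verts H" "v \<in> verts H" for u v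
  proof -
    have "?g u \<in> verts G" "?g v \<in> verts G" using g that by (auto simp: bij_betw_def)
    then show ?thesis using e[of "?g u" "?g v"] f that by (simp add: bij_betw_inv_into_right)
  qed
  then show ?thesis using g unfolding graph_iso_def by blast
qed

lemma graph_iso_trans:
  assumes "graph_iso G H" "graph_iso H K"
  shows "graph_iso G K"
proof -
  obtain f where f: "bij_betw f (verts G) (verts H)"
    and e: "\<And>u v. u \<in> verts G \<Longrightarrow> v \<in> verts G \<Longrightarrow> {u, v} \<in> edges G \<longleftrightarrow> {f u, f v} \<in> edges H"
    using assms unfolding graph_iso_def by blast
  obtain g where g: "bij_betw g (verts H) (verts K)"
    and e': "\<And>u v. u \<in> verts H \<Longrightarrow> v \<in> verts H \<Longrightarrow> {u, v} \<in> edges H \<longleftrightarrow> {g u, g v} \<in> edges K"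
    using assms unfolding graph_iso_def by blast
  have "bij_betw (g \<circ> f) (verts G) (verts K)" using f g by (rule bij_betw_trans)
  moreover have "{u, v} \<in> edges G \<longleftrightarrow> {(g \<circ> f) u, (g \<circ> f) v} \<in> edges K"
    if "u \<in> verts G" "v \<in> verts G" for u v
  proof -
    have "f u \<in> verts H" "f v \<in> verts H" using f that by (auto simp: bij_betw_def)
    then show ?thesis using e[OF that] e'[of "f u" "f v"] by simp
  qed
  ultimately show ?thesis unfolding graph_iso_def by blast
qed

lemma graph_iso_degE:
  assumes "graph_iso G H" and G: "simple_graph G" and H: "simple_graph H"
  obtains f where "bij_betw f (verts G) (verts H)"
    "\<forall>u\<in>verts G. \<forall>v\<in>verts G. {u, v} \<in> edges G \<longleftrightarrow> {f u, f v} \<in> edges H"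
    "\<forall>u\<in>verts G. deg H (f u) = deg G u"
proof -
  obtain f where f: "bij_betw f (verts G) (verts H)"
    and e: "\<And>u v. u \<in> verts G \<Longrightarrow> v \<in> verts G \<Longrightarrow> {u, v} \<in> edges G \<longleftrightarrow> {f u, f v} \<in> edges H"
    using assms unfolding graph_iso_def by blast
  have nb: "nbrs H (f u) = f ` nbrs G u" if u: "u \<in> verts G" for u
  proof (intro equalityI subsetI)
    fix w assume w: "w \<in> nbrs H (f u)"
    then have "w \<in> verts H" using simple_graph_nbrs(1)[OF H] by blast
    then obtain z where "z \<in> verts G" "w = f z" using f by (auto simp: bij_betw_def)
    then show "w \<in> f ` nbrs G u" using w e[OF u, of z] by (auto simp: nbrs_def)
  next
    fix w assume "w \<in> f ` nbrs G u"
    then obtain z where z: "z \<in> nbrs G u" "w = f z" by blast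
    then have "z \<in> verts G" using simple_graph_nbrs(1)[OF G] by blast
    then show "w \<in> nbrs H (f u)" using z e[OF u, of z] by (simp add: nbrs_def)
  qed
  have dg: "deg H (f u) = deg G u" if "u \<in> verts G" for u
  proof -
    have "inj_on f (nbrs G u)"
      using f simple_graph_nbrs(1)[OF G] by (auto simp: bij_betw_def intro: inj_on_subset)
    then show ?thesis using nb[OF that] by (simp add: deg_def card_image)
  qed
  show thesis by (rule that[OF f]) (use e dg in auto)
qed

lemma graph_iso_laplacian_spectrum:
  assumes "graph_iso G H" and G: "simple_graph G" and H: "simple_graph H"
  shows "laplacian_spectrum G = laplacian_spectrum H"
proof -
  obtain f where f: "bij_betw f (verts G) (verts H)"
    and e: "\<forall>u\<in>verts G. \<forall>v\<in>verts G. {u, v} \<in> edges G \<longleftrightarrow> {f u, f v} \<in> edges H"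
    and dg: "\<forall>u\<in>verts G. deg H (f u) = deg G u"
    using graph_iso_degE[OF assms] .
  obtain vs where vs: "distinct vs" "set vs = verts G"
    using finite_distinct_list[of "verts G"] G by (auto simp: simple_graph_def)
  have ws: "distinct (map f vs)" "set (map f vs) = verts H"
    using vs f by (auto simp: distinct_map bij_betw_def)
  \<comment> \<open>Listing the vertices of \<open>H\<close> as the images of those of
    \<open>G\<close> makes the two matrices agree entry by entry.\<close>
  have "laplacian_mat G vs = laplacian_mat H (map f vs)"
  proof (rule eq_matI)
    fix i j assume "i < dim_row (laplacian_mat H (map f vs))" "j < dim_col (laplacian_mat H (map f vs))"
    then have ij: "i < length vs" "j < length vs"
      by (auto simp: laplacian_mat_def degree_mat_def adjacency_mat_def)
    then have "vs ! i \<in> verts G" "vs ! j \<in> verts G" by (simp_all add: vs(2)[symmetric])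
    then show "laplacian_mat G vs $$ (i, j) = laplacian_mat H (map f vs) $$ (i, j)"
      using ij e dg
      by (simp add: laplacian_mat_def degree_mat_def adjacency_mat_def
          card_incident_edges[OF G] card_incident_edges[OF H])
  qed (auto simp: laplacian_mat_def degree_mat_def adjacency_mat_def)
  then show ?thesis using laplacian_spectrum_eq[OF vs] laplacian_spectrum_eq[OF ws] by simp
qed

section \<open>Traces of powers of the Laplacian matrix\<close>

definition mtrace :: "'a :: comm_ring_1 mat \<Rightarrow> 'a" where
  "mtrace A = (\<Sum>i<dim_row A. A $$ (i, i))"

lemma mtrace_mult_comm:
  assumes "A \<in> carrier_mat n m" "B \<in> carrier_mat m n"
  shows "mtrace (A * B) = mtrace (B * A)"
proof -
  have "mtrace (A * B) = (\<Sum>i<n. \<Sum>j<m. A $$ (i, j) * B $$ (j, i))"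
    using assms by (auto simp: mtrace_def scalar_prod_def lessThan_atLeast0 intro!: sum.cong)
  also have "\<dots> = (\<Sum>j<m. \<Sum>i<n. A $$ (i, j) * B $$ (j, i))"
    by (rule sum.swap)
  also have "\<dots> = mtrace (B * A)"
    using assms by (auto simp: mtrace_def scalar_prod_def lessThan_atLeast0 mult.commute intro!: sum.cong)
  finally show ?thesis .
qed

lemma mtrace_similar:
  assumes "similar_mat_wit A B P Q"
  shows "mtrace A = mtrace B"
proof -
  define n where "n = dim_row A"
  note w = similar_mat_witD[OF n_def assms]
  have "mtrace A = mtrace (P * (B * Q))"
    using w assoc_mult_mat[of P n n B n Q n] by simp
  also have "\<dots> = mtrace (B * Q * P)"
    using w by (intro mtrace_mult_comm[of _ n n]) auto
  also have "B * Q * P = B"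
    using w assoc_mult_mat[of B n n Q n P n] by simp
  finally show ?thesis .
qed

lemma upper_triangular_mult:
  fixes A B :: "'a :: comm_ring_1 mat"
  assumes A: "A \<in> carrier_mat n n" "upper_triangular A"
    and B: "B \<in> carrier_mat n n" "upper_triangular B"
  shows "upper_triangular (A * B)"
    and "i < n \<Longrightarrow> (A * B) $$ (i, i) = A $$ (i, i) * B $$ (i, i)"
proof -
  have entry: "(A * B) $$ (i, j) = (\<Sum>t\<in>{0..<n}. A $$ (i, t) * B $$ (t, j))"
    if "i < n" "j < n" for i j
    using that A B by (simp add: scalar_prod_def)
  have zero: "A $$ (i, t) * B $$ (t, j) = 0" if "i < n" "j < n" "t < n" "t < i \<or> j < t" for i j t
    using that A B by (auto simp: upper_triangular_def)
  show "upper_triangular (A * B)"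
  proof (rule upper_triangularI)
    fix i j assume ij: "j < i" "i < dim_row (A * B)"
    then have "i < n" "j < n" using A by auto
    then show "(A * B) $$ (i, j) = 0"
      unfolding entry[OF \<open>i < n\<close> \<open>j < n\<close>]
    proof (intro sum.neutral ballI)
      fix t assume "t \<in> {0..<n}"
      moreover have "t < i \<or> j < t" using ij(1) by linarith
      ultimately show "A $$ (i, t) * B $$ (t, j) = 0" using zero[OF \<open>i < n\<close> \<open>j < n\<close>, of t] by simp
    qed
  qed
  assume i: "i < n"
  have "(A * B) $$ (i, i) = (\<Sum>t\<in>{i}. A $$ (i, t) * B $$ (t, i))"
    unfolding entry[OF i i] using i zero[OF i i] by (intro sum.mono_neutral_right) force+
  then show "(A * B) $$ (i, i) = A $$ (i, i) * B $$ (i, i)" by simp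
qed

lemma upper_triangular_pow:
  fixes A :: "'a :: comm_ring_1 mat"
  assumes A: "A \<in> carrier_mat n n" "upper_triangular A"
  shows "upper_triangular (A ^\<^sub>m k) \<and> (\<forall>i<n. (A ^\<^sub>m k) $$ (i, i) = A $$ (i, i) ^ k)"
proof (induction k)
  case 0
  show ?case using A by (auto simp: upper_triangular_def)
next
  case (Suc k)
  then show ?case
    using upper_triangular_mult[of "A ^\<^sub>m k" n A] A by (simp add: mult.commute)
qed

text \<open>Schur triangularisation puts the eigenvalues on the diagonal of an upper triangular
  matrix, and there the diagonal of a power is the power of the diagonal. This covers every complex
  matrix, diagonalisable or not.\<close>

lemma mtrace_pow_eq_power_sum:
  fixes A :: "complex mat"
  assumes A: "A \<in> carrier_mat n n" and es: "char_poly A = (\<Prod>e\<leftarrow>es. [:- e, 1:])"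
  shows "mtrace (A ^\<^sub>m k) = (\<Sum>e\<leftarrow>es. e ^ k)"
proof -
  obtain B P Q where "schur_decomposition A es = (B, P, Q)" by (cases "schur_decomposition A es")
  from schur_decomposition[OF A es this]
  have sim: "similar_mat_wit A B P Q" and ut: "upper_triangular B" and d: "diag_mat B = es" by auto
  have B: "B \<in> carrier_mat n n" using similar_mat_witD2[OF A sim] by simp
  have "mtrace (A ^\<^sub>m k) = mtrace (B ^\<^sub>m k)"
    by (rule mtrace_similar[OF similar_mat_wit_pow[OF sim]])
  also have "\<dots> = (\<Sum>i<n. B $$ (i, i) ^ k)"
    using upper_triangular_pow[OF B ut, of k] B by (simp add: mtrace_def)
  also have "\<dots> = (\<Sum>e\<leftarrow>es. e ^ k)"
    using B unfolding d[symmetric] diag_mat_def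
    by (simp add: interv_sum_list_conv_sum_set_nat lessThan_atLeast0 comp_def)
  finally show ?thesis .
qed

lemma mtrace_pow_cong:
  fixes A B :: "complex mat"
  assumes "A \<in> carrier_mat n n" "B \<in> carrier_mat n n" "char_poly A = char_poly B"
  shows "mtrace (A ^\<^sub>m k) = mtrace (B ^\<^sub>m k)"
proof -
  obtain es where "char_poly A = (\<Prod>e\<leftarrow>es. [:- e, 1:])"
    using char_poly_factorized[OF assms(1)] by blast
  then show ?thesis using assms mtrace_pow_eq_power_sum by metis
qed

definition lap :: "'a ugraph \<Rightarrow> 'a \<Rightarrow> 'a \<Rightarrow> int" where
  "lap G u w = (if u = w then int (deg G u) else 0) - (if w \<in> nbrs G u then 1 else 0)"

definition lap2 :: "'a ugraph \<Rightarrow> 'a \<Rightarrow> 'a \<Rightarrow> int" where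
  "lap2 G u w = (\<Sum>z\<in>verts G. lap G u z * lap G z w)"

text \<open>The entries are integers but the ring is left open: the same Laplacian is read over
  \<open>complex\<close> for the spectrum, \<open>int\<close> for the reduced determinant,
  \<open>rat\<close> for its LU factorisation and \<open>gf3\<close> for reduction modulo 3.\<close>

definition mat_on :: "'a list \<Rightarrow> ('a \<Rightarrow> 'a \<Rightarrow> int) \<Rightarrow> 'r :: comm_ring_1 mat" where
  "mat_on vs f = mat (length vs) (length vs) (\<lambda>(i, j). of_int (f (vs ! i) (vs ! j)))"

lemma mat_on_carrier [simp]: "mat_on vs f \<in> carrier_mat (length vs) (length vs)"
  "dim_row (mat_on vs f) = length vs" "dim_col (mat_on vs f) = length vs"
  by (auto simp: mat_on_def)

lemma sum_nth_distinct:
  assumes "distinct vs"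
  shows "(\<Sum>i<length vs. f (vs ! i)) = (\<Sum>v\<in>set vs. f v)"
  using assms sum.distinct_set_conv_list[of vs f]
  by (simp add: sum_list_sum_nth lessThan_atLeast0)

lemma mat_on_mult:
  assumes "distinct vs"
  shows "mat_on vs f * mat_on vs g = mat_on vs (\<lambda>u w. \<Sum>z\<in>set vs. f u z * g z w)"
  by (rule eq_matI)
    (auto simp: mat_on_def scalar_prod_def lessThan_atLeast0[symmetric]
      sum_nth_distinct[OF assms, symmetric])

lemma mtrace_mat_on:
  assumes "distinct vs"
  shows "mtrace (mat_on vs f) = of_int (\<Sum>u\<in>set vs. f u u)"
  by (simp add: mtrace_def mat_on_def sum_nth_distinct[OF assms, symmetric])

lemma laplacian_mat_eq_mat_on:
  assumes "simple_graph G" "distinct vs"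
  shows "laplacian_mat G vs = mat_on vs (lap G)"
  using assms(2) card_incident_edges[OF assms(1)]
  by (intro eq_matI)
    (auto simp: laplacian_mat_def degree_mat_def adjacency_mat_def mat_on_def lap_def nbrs_def
      nth_eq_iff_index_eq)

text \<open>A complex characteristic polynomial is monic and splits, hence it is the product of
  \<open>X - e\<close> over its roots. The sizes \<open>n\<close> and \<open>m\<close> are kept
  apart because their equality is only read off afterwards, from the degree.\<close>

lemma proots_eq_imp_char_poly_eq:
  fixes A B :: "complex mat"
  assumes A: "A \<in> carrier_mat n n" and B: "B \<in> carrier_mat m m"
    and eq: "proots (char_poly A) = proots (char_poly B)"
  shows "char_poly A = char_poly B"
proof -
  have *: "char_poly M = prod_mset (image_mset (\<lambda>e. [:- e, 1:]) (proots (char_poly M)))"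
    if M: "M \<in> carrier_mat k k" for M :: "complex mat" and k
  proof -
    obtain es where es: "char_poly M = (\<Prod>e\<leftarrow>es. [:- e, 1:])"
      using char_poly_factorized[OF M] by blast
    have "proots (\<Prod>e\<leftarrow>es. [:- e, 1:]) = mset es"
    proof (induction es)
      case (Cons e es)
      have "(\<Prod>e\<leftarrow>es. [:- e, 1:]) \<noteq> 0" by (auto simp: prod_list_zero_iff)
      then show ?case
        using Cons proots_mult[of "[:- e, 1:]" "\<Prod>e\<leftarrow>es. [:- e, 1:]"] by (simp del: mult_pCons_left)
    qed simp
    then show ?thesis unfolding es by (simp add: prod_mset_prod_list[symmetric] del: prod_mset_prod_list)
  qed
  show ?thesis using *[OF A] *[OF B] eq by simp
qed

lemma cospectral_char_poly_eq:
  assumes G: "simple_graph G" and H: "simple_graph H"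
    and eq: "laplacian_spectrum G = laplacian_spectrum H"
    and vs: "distinct vs" "set vs = verts G" and ws: "distinct ws" "set ws = verts H"
  shows "char_poly (mat_on vs (lap G) :: complex mat) = char_poly (mat_on ws (lap H))"
    and "length vs = length ws"
proof -
  let ?A = "mat_on vs (lap G) :: complex mat" and ?B = "mat_on ws (lap H) :: complex mat"
  have "proots (char_poly ?A) = proots (char_poly ?B)"
    using eq laplacian_spectrum_eq[OF vs] laplacian_spectrum_eq[OF ws]
      laplacian_mat_eq_mat_on[OF G vs(1)] laplacian_mat_eq_mat_on[OF H ws(1)] by simp
  then show 1: "char_poly ?A = char_poly ?B"
    by (rule proots_eq_imp_char_poly_eq[of _ "length vs" _ "length ws", rotated 2]) auto
  show "length vs = length ws"
    using degree_monic_char_poly[of ?A "length vs"] degree_monic_char_poly[of ?B "length ws"] 1 by simp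
qed

lemma cospectral_traces:
  assumes G: "simple_graph G" and H: "simple_graph H"
    and eq: "laplacian_spectrum G = laplacian_spectrum H"
  shows "card (verts G) = card (verts H)"
    and "(\<Sum>u\<in>verts G. lap G u u) = (\<Sum>u\<in>verts H. lap H u u)"
    and "(\<Sum>u\<in>verts G. lap2 G u u) = (\<Sum>u\<in>verts H. lap2 H u u)"
    and "(\<Sum>u\<in>verts G. \<Sum>w\<in>verts G. lap G u w * lap2 G w u) =
         (\<Sum>u\<in>verts H. \<Sum>w\<in>verts H. lap H u w * lap2 H w u)"
    and "(\<Sum>u\<in>verts G. \<Sum>w\<in>verts G. lap2 G u w * lap2 G w u) =
         (\<Sum>u\<in>verts H. \<Sum>w\<in>verts H. lap2 H u w * lap2 H w u)"
proof -
  obtain vs where vs: "distinct vs" "set vs = verts G"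
    using finite_distinct_list[of "verts G"] G by (auto simp: simple_graph_def)
  obtain ws where ws: "distinct ws" "set ws = verts H"
    using finite_distinct_list[of "verts H"] H by (auto simp: simple_graph_def)
  define A :: "complex mat" where "A = mat_on vs (lap G)"
  define B :: "complex mat" where "B = mat_on ws (lap H)"
  note cp = cospectral_char_poly_eq[OF assms vs ws, folded A_def B_def]
  define n where "n = length vs"
  have A: "A \<in> carrier_mat n n" and B: "B \<in> carrier_mat n n"
    using cp(2) unfolding A_def B_def n_def by (auto simp: carrier_matI)
  note tr = mtrace_pow_cong[OF A B cp(1)]
  show "card (verts G) = card (verts H)"
    using cp(2) vs ws by (metis distinct_card)
  \<comment> \<open>With this bracketing and that of \<open>p3\<close>, both traces become double
    sums over entries of the Laplacian and of its square.\<close>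
  have p4: "M ^\<^sub>m 4 = (M * M) * (M * M)" if "M \<in> carrier_mat n n" for M :: "complex mat"
    using that assoc_mult_mat[of "M * M" n n M n M n] by (simp add: numeral_eq_Suc)
  have p3: "M ^\<^sub>m 3 = M * (M * M)" if "M \<in> carrier_mat n n" for M :: "complex mat"
    using that assoc_mult_mat[of M n n M n M n] by (simp add: numeral_eq_Suc)
  have p2: "M ^\<^sub>m 2 = M * M" if "M \<in> carrier_mat n n" for M :: "complex mat"
    using that by (simp add: numeral_eq_Suc)
  have p1: "M ^\<^sub>m 1 = M" if "M \<in> carrier_mat n n" for M :: "complex mat"
    using that by simp
  note m = mat_on_mult[OF vs(1)] mat_on_mult[OF ws(1)] mtrace_mat_on[OF vs(1)] mtrace_mat_on[OF ws(1)]
    of_int_eq_iff vs(2) ws(2) lap2_def[symmetric]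
  show "(\<Sum>u\<in>verts G. lap G u u) = (\<Sum>u\<in>verts H. lap H u u)"
    using tr[of 1] unfolding p1[OF A] p1[OF B] unfolding A_def B_def m .
  show "(\<Sum>u\<in>verts G. lap2 G u u) = (\<Sum>u\<in>verts H. lap2 H u u)"
    using tr[of 2] unfolding p2[OF A] p2[OF B] unfolding A_def B_def m .
  show "(\<Sum>u\<in>verts G. \<Sum>w\<in>verts G. lap G u w * lap2 G w u) =
        (\<Sum>u\<in>verts H. \<Sum>w\<in>verts H. lap H u w * lap2 H w u)"
    using tr[of 3] unfolding p3[OF A] p3[OF B] unfolding A_def B_def m .
  show "(\<Sum>u\<in>verts G. \<Sum>w\<in>verts G. lap2 G u w * lap2 G w u) =
        (\<Sum>u\<in>verts H. \<Sum>w\<in>verts H. lap2 H u w * lap2 H w u)"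
    using tr[of 4] unfolding p4[OF A] p4[OF B] unfolding A_def B_def m .
qed

text \<open>Ordered tuples: each triangle is counted 6 times and each 4-cycle 8 times.\<close>

definition triangles :: "'a ugraph \<Rightarrow> ('a \<times> 'a \<times> 'a) set" where
  "triangles G = {(u, w, z). w \<in> nbrs G u \<and> z \<in> nbrs G u \<and> z \<in> nbrs G w}"

definition four_cycles :: "'a ugraph \<Rightarrow> ('a \<times> 'a \<times> 'a \<times> 'a) set" where
  "four_cycles G = {(u, x, w, y). u \<noteq> w \<and> x \<noteq> y \<and>
     x \<in> nbrs G u \<and> x \<in> nbrs G w \<and> y \<in> nbrs G u \<and> y \<in> nbrs G w}"

section \<open>Traces in terms of degrees, triangles and 4-cycles\<close>

lemma lap2_diag:
  assumes G: "simple_graph G" and u: "u \<in> verts G"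
  shows "lap2 G u u = int (deg G u) ^ 2 + int (deg G u)"
proof -
  note nb = simple_graph_nbrs[OF G]
  have fin: "finite (verts G)" using G by (simp add: simple_graph_def)
  have "lap G u z * lap G z u = (if z = u then int (deg G u) ^ 2 else 0) + (if z \<in> nbrs G u then 1 else 0)" for z
    using nb(3)[of u] nbrs_sym[of z G u] by (auto simp: lap_def power2_eq_square)
  then have "lap2 G u u = (\<Sum>z\<in>verts G. if z = u then int (deg G u) ^ 2 else 0) + (\<Sum>z\<in>verts G. if z \<in> nbrs G u then 1 else 0)"
    unfolding lap2_def by (simp add: sum.distrib)
  also have "(\<Sum>z\<in>verts G. if z \<in> nbrs G u then 1 else 0) = int (deg G u)"
    using fin nb(1)[of u] by (simp add: sum.If_cases deg_def Int_absorb1)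
  finally show ?thesis using u fin by simp
qed

text \<open>In the sum over \<open>z\<close>, a common neighbour contributes (-1)(-1), while
  \<open>z = u\<close> and \<open>z = w\<close> each pair a diagonal entry with the edge between
  \<open>u\<close> and \<open>w\<close>.\<close>

lemma lap2_offdiag:
  assumes G: "simple_graph G" and u: "u \<in> verts G" and w: "w \<in> verts G" and ne: "u \<noteq> w"
  shows "lap2 G u w = int (card (nbrs G u \<inter> nbrs G w))
    - (if w \<in> nbrs G u then int (deg G u) + int (deg G w) else 0)"
proof -
  note nb = simple_graph_nbrs[OF G]
  have fin: "finite (verts G)" using G by (simp add: simple_graph_def)
  have "lap G u z * lap G z w = (if z \<in> nbrs G u \<inter> nbrs G w then 1 else 0)
     - (if z = u then (if w \<in> nbrs G u then int (deg G u) else 0) else 0)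
     - (if z = w then (if w \<in> nbrs G u then int (deg G w) else 0) else 0)" for z
    using nb(3)[of u] nb(3)[of w] nbrs_sym[of z G u] nbrs_sym[of z G w] nbrs_sym[of u G w] ne
    by (auto simp: lap_def)
  then have "lap2 G u w = (\<Sum>z\<in>verts G. if z \<in> nbrs G u \<inter> nbrs G w then 1 else 0)
     - (\<Sum>z\<in>verts G. if z = u then (if w \<in> nbrs G u then int (deg G u) else 0) else 0)
     - (\<Sum>z\<in>verts G. if z = w then (if w \<in> nbrs G u then int (deg G w) else 0) else 0)"
    unfolding lap2_def by (simp only: sum_subtractf)
  also have "(\<Sum>z\<in>verts G. if z \<in> nbrs G u \<inter> nbrs G w then 1 else 0) = int (card (nbrs G u \<inter> nbrs G w))"
  proof -
    have "verts G \<inter> (nbrs G u \<inter> nbrs G w) = nbrs G u \<inter> nbrs G w" using nb(1) by blast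
    then show ?thesis using fin sum.If_cases[OF fin, of "\<lambda>z. z \<in> nbrs G u \<inter> nbrs G w" "\<lambda>_. 1::int" "\<lambda>_. 0"]
      by (simp add: Collect_mem_eq Collect_conj_eq)
  qed
  finally show ?thesis using u w fin by simp
qed

lemma sum_nbrs:
  assumes "simple_graph G"
  shows "(\<Sum>w\<in>verts G. if w \<in> nbrs G u then f w else 0) = (\<Sum>w\<in>nbrs G u. f w :: int)"
proof -
  have fin: "finite (verts G)" using assms by (simp add: simple_graph_def)
  show ?thesis
    using fin simple_graph_nbrs(1)[OF assms, of u] by (simp add: sum.If_cases Int_absorb1)
qed

lemma sum_nbrs_swap:
  assumes "simple_graph G"
  shows "(\<Sum>u\<in>verts G. \<Sum>w\<in>nbrs G u. f w :: int) = (\<Sum>w\<in>verts G. int (deg G w) * f w)"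
proof -
  have "(\<Sum>u\<in>verts G. \<Sum>w\<in>nbrs G u. f w) = (\<Sum>u\<in>verts G. \<Sum>w\<in>verts G. if w \<in> nbrs G u then f w else 0)"
    by (simp add: sum_nbrs[OF assms])
  also have "\<dots> = (\<Sum>w\<in>verts G. \<Sum>u\<in>verts G. if u \<in> nbrs G w then f w else 0)"
    by (subst sum.swap) (simp add: nbrs_sym)
  also have "\<dots> = (\<Sum>w\<in>verts G. int (deg G w) * f w)"
    by (simp add: sum_nbrs[OF assms] deg_def)
  finally show ?thesis .
qed

lemma finite_triangles:
  assumes "simple_graph G"
  shows "finite (triangles G)"
proof (rule finite_subset)
  show "triangles G \<subseteq> verts G \<times> verts G \<times> verts G"
    using simple_graph_nbrs[OF assms] by (force simp: triangles_def)
  show "finite (verts G \<times> verts G \<times> verts G)" using assms by (simp add: simple_graph_def)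
qed

lemma finite_four_cycles:
  assumes "simple_graph G"
  shows "finite (four_cycles G)"
proof (rule finite_subset)
  show "four_cycles G \<subseteq> verts G \<times> verts G \<times> verts G \<times> verts G"
    using simple_graph_nbrs[OF assms] by (force simp: four_cycles_def)
  show "finite (verts G \<times> verts G \<times> verts G \<times> verts G)" using assms by (simp add: simple_graph_def)
qed

text \<open>The weight \<open>f\<close> makes one count serve twice: the third trace needs the
  constant 1, the fourth the degree sum of the first two vertices.\<close>

lemma sum_triangles:
  assumes G: "simple_graph G"
  shows "(\<Sum>u\<in>verts G. \<Sum>w\<in>nbrs G u. int (card (nbrs G u \<inter> nbrs G w)) * f u w)
    = (\<Sum>(u, w, z)\<in>triangles G. f u w)"
proof -
  note nb = simple_graph_nbrs[OF G]
  have fin: "finite (verts G)" using G by (simp add: simple_graph_def)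
  have "triangles G = Sigma (verts G) (\<lambda>u. Sigma (nbrs G u) (\<lambda>w. nbrs G u \<inter> nbrs G w))"
    using nb(4) by (auto simp: triangles_def)
  then have "(\<Sum>(u, w, z)\<in>triangles G. f u w)
     = (\<Sum>u\<in>verts G. \<Sum>w\<in>nbrs G u. \<Sum>z\<in>nbrs G u \<inter> nbrs G w. f u w)"
  proof -
    have "(\<Sum>(u, w, z)\<in>triangles G. f u w)
      = (\<Sum>u\<in>verts G. \<Sum>(w, z)\<in>Sigma (nbrs G u) (\<lambda>w. nbrs G u \<inter> nbrs G w). f u w)"
      using fin nb(2) \<open>triangles G = _\<close> by (subst sum.Sigma) auto
    also have "\<dots> = (\<Sum>u\<in>verts G. \<Sum>w\<in>nbrs G u. \<Sum>z\<in>nbrs G u \<inter> nbrs G w. f u w)"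
      using nb(2) by (intro sum.cong[OF refl] sum.Sigma[symmetric]) auto
    finally show ?thesis .
  qed
  then show ?thesis by simp
qed

text \<open>A 4-cycle tuple amounts to an ordered pair of opposite corners \<open>u\<close>,
  \<open>w\<close> together with an ordered pair of distinct common neighbours.\<close>

lemma card_four_cycles:
  assumes G: "simple_graph G"
  shows "int (card (four_cycles G)) = (\<Sum>u\<in>verts G. \<Sum>w\<in>verts G - {u}.
      int (card (nbrs G u \<inter> nbrs G w)) * (int (card (nbrs G u \<inter> nbrs G w)) - 1))"
proof -
  note nb = simple_graph_nbrs[OF G]
  have fin: "finite (verts G)" using G by (simp add: simple_graph_def)
  define D where "D u w = Sigma (nbrs G u \<inter> nbrs G w) (\<lambda>x. nbrs G u \<inter> nbrs G w - {x})" for u w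
  have cD: "int (card (D u w)) = int (card (nbrs G u \<inter> nbrs G w)) * (int (card (nbrs G u \<inter> nbrs G w)) - 1)" for u w
  proof -
    let ?N = "nbrs G u \<inter> nbrs G w"
    have fN: "finite ?N" using nb(2) by blast
    have "int (card (D u w)) = (\<Sum>x\<in>?N. int (card (?N - {x})))"
      unfolding D_def using fN by simp
    also have "\<dots> = (\<Sum>x\<in>?N. int (card ?N) - 1)"
    proof (rule sum.cong[OF refl])
      fix x assume x: "x \<in> ?N"
      then have "card ?N > 0" using fN card_gt_0_iff by blast
      then show "int (card (?N - {x})) = int (card ?N) - 1" using x fN by (simp add: card_Diff_singleton of_nat_diff)
    qed
    finally show ?thesis by simp
  qed
  have fD: "finite (D u w)" for u w unfolding D_def using nb(2) by blast
  define S where "S = Sigma (verts G) (\<lambda>u. Sigma (verts G - {u}) (\<lambda>w. D u w))"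
  have "bij_betw (\<lambda>(u, x, w, y). (u, w, x, y)) (four_cycles G) S"
    by (rule bij_betwI[where g = "\<lambda>(u, w, x, y). (u, x, w, y)"])
      (use nb(4) in \<open>auto simp: four_cycles_def S_def D_def\<close>)
  then have "card (four_cycles G) = card S" by (rule bij_betw_same_card)
  also have "card S = (\<Sum>u\<in>verts G. \<Sum>w\<in>verts G - {u}. card (D u w))"
    unfolding S_def using fin fD by (simp add: card_SigmaI)
  finally show ?thesis by (simp add: cD)
qed

text \<open>Both sides count paths of length two with distinct ends, on the left by their ends and
  on the right by the middle vertex.\<close>

lemma sum_codegrees:
  assumes G: "simple_graph G"
  shows "(\<Sum>u\<in>verts G. \<Sum>w\<in>verts G - {u}. int (card (nbrs G u \<inter> nbrs G w)))
    = (\<Sum>u\<in>verts G. int (deg G u) * (int (deg G u) - 1))"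
proof -
  note nb = simple_graph_nbrs[OF G]
  have fin: "finite (verts G)" using G by (simp add: simple_graph_def)
  have "(\<Sum>u\<in>verts G. \<Sum>w\<in>verts G. int (card (nbrs G u \<inter> nbrs G w)))
     = (\<Sum>u\<in>verts G. \<Sum>z\<in>nbrs G u. int (deg G z))"
  proof (rule sum.cong[OF refl])
    fix u
    have "int (card (nbrs G u \<inter> nbrs G w)) = (\<Sum>z\<in>nbrs G u. if w \<in> nbrs G z then 1 else 0)" for w
      using nb(2)[of u] by (simp add: sum.If_cases Int_def nbrs_sym)
    then have "(\<Sum>w\<in>verts G. int (card (nbrs G u \<inter> nbrs G w)))
      = (\<Sum>w\<in>verts G. \<Sum>z\<in>nbrs G u. if w \<in> nbrs G z then 1 else 0)" by simp
    also have "\<dots> = (\<Sum>z\<in>nbrs G u. \<Sum>w\<in>verts G. if w \<in> nbrs G z then 1 else 0)" by (rule sum.swap)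
    finally show "(\<Sum>w\<in>verts G. int (card (nbrs G u \<inter> nbrs G w))) = (\<Sum>z\<in>nbrs G u. int (deg G z))"
      by (simp add: sum_nbrs[OF G] deg_def)
  qed
  also have "\<dots> = (\<Sum>u\<in>verts G. int (deg G u) * int (deg G u))"
    by (rule sum_nbrs_swap[OF G])
  finally have "(\<Sum>u\<in>verts G. (\<Sum>w\<in>verts G. int (card (nbrs G u \<inter> nbrs G w))) - int (deg G u))
     = (\<Sum>u\<in>verts G. int (deg G u) * (int (deg G u) - 1))"
    by (simp add: sum_subtractf algebra_simps)
  then show ?thesis using fin by (simp add: sum_diff1 deg_def)
qed

lemma trace_lap:
  assumes G: "simple_graph G"
  shows "(\<Sum>u\<in>verts G. lap G u u) = (\<Sum>u\<in>verts G. int (deg G u))"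
  using simple_graph_nbrs(3)[OF G] by (simp add: lap_def)

lemma trace_lap_square:
  assumes G: "simple_graph G"
  shows "(\<Sum>u\<in>verts G. lap2 G u u) = (\<Sum>u\<in>verts G. int (deg G u) ^ 2 + int (deg G u))"
  using lap2_diag[OF G] by simp

lemma trace_lap_cube:
  assumes G: "simple_graph G"
  shows "(\<Sum>u\<in>verts G. \<Sum>w\<in>verts G. lap G u w * lap2 G w u) =
    (\<Sum>u\<in>verts G. int (deg G u) ^ 3 + 3 * int (deg G u) ^ 2) - int (card (triangles G))"
proof -
  note nb = simple_graph_nbrs[OF G]
  have fin: "finite (verts G)" using G by (simp add: simple_graph_def)
  let ?d = "\<lambda>u. int (deg G u)"
  have "(\<Sum>w\<in>verts G. lap G u w * lap2 G w u) = ?d u * (?d u ^ 2 + ?d u)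
     - (\<Sum>w\<in>nbrs G u. int (card (nbrs G u \<inter> nbrs G w))) + ?d u * ?d u + (\<Sum>w\<in>nbrs G u. ?d w)"
    if u: "u \<in> verts G" for u
  proof -
    have "lap G u w * lap2 G w u = (if w = u then ?d u * (?d u ^ 2 + ?d u) else 0)
      + (if w \<in> nbrs G u then - int (card (nbrs G u \<inter> nbrs G w)) + ?d u + ?d w else 0)"
      if w: "w \<in> verts G" for w
      using lap2_diag[OF G u] lap2_offdiag[OF G w u] nb(3)[of u] nbrs_sym[of w G u]
      by (auto simp: lap_def Int_commute)
    then have "(\<Sum>w\<in>verts G. lap G u w * lap2 G w u) = (\<Sum>w\<in>verts G. if w = u then ?d u * (?d u ^ 2 + ?d u) else 0)
      + (\<Sum>w\<in>verts G. if w \<in> nbrs G u then - int (card (nbrs G u \<inter> nbrs G w)) + ?d u + ?d w else 0)"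
      by (simp add: sum.distrib)
    then show ?thesis
      unfolding sum_nbrs[OF G] using u fin by (simp add: sum.distrib sum_subtractf deg_def)
  qed
  then have "(\<Sum>u\<in>verts G. \<Sum>w\<in>verts G. lap G u w * lap2 G w u) =
     (\<Sum>u\<in>verts G. ?d u * (?d u ^ 2 + ?d u) + ?d u * ?d u)
     - (\<Sum>u\<in>verts G. \<Sum>w\<in>nbrs G u. int (card (nbrs G u \<inter> nbrs G w)) * 1)
     + (\<Sum>u\<in>verts G. \<Sum>w\<in>nbrs G u. ?d w)"
    by (simp add: sum.distrib sum_subtractf)
  also have "\<dots> = (\<Sum>u\<in>verts G. ?d u ^ 3 + 3 * ?d u ^ 2) - int (card (triangles G))"
    unfolding sum_triangles[OF G] sum_nbrs_swap[OF G]
    by (simp add: sum.distrib sum_distrib_left[symmetric] power2_eq_square power3_eq_cube algebra_simps case_prod_beta)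
  finally show ?thesis .
qed

text \<open>The Laplacian is symmetric, so this trace is the sum of the squared entries of
  \<open>lap2\<close>. Off the diagonal the square of a codegree \<open>c\<close> is split as
  \<open>c (c - 1) + c\<close>, counting 4-cycles and paths of length two; the mixed term for
  adjacent vertices counts triangles weighted by degrees.\<close>

lemma trace_lap_fourth:
  assumes G: "simple_graph G"
  shows "(\<Sum>u\<in>verts G. \<Sum>w\<in>verts G. lap2 G u w * lap2 G w u) =
    (\<Sum>u\<in>verts G. (int (deg G u) ^ 2 + int (deg G u)) ^ 2 + int (deg G u) * (int (deg G u) - 1))
    + int (card (four_cycles G))
    - 2 * (\<Sum>(u, w, z)\<in>triangles G. int (deg G u) + int (deg G w))
    + (\<Sum>u\<in>verts G. \<Sum>w\<in>nbrs G u. (int (deg G u) + int (deg G w)) ^ 2)"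
proof -
  note nb = simple_graph_nbrs[OF G]
  have fin: "finite (verts G)" using G by (simp add: simple_graph_def)
  let ?d = "\<lambda>u. int (deg G u)" and ?c = "\<lambda>u w. int (card (nbrs G u \<inter> nbrs G w))"
  have "(\<Sum>w\<in>verts G. lap2 G u w * lap2 G w u) = (?d u ^ 2 + ?d u) ^ 2
     + (\<Sum>w\<in>verts G - {u}. ?c u w * (?c u w - 1)) + (\<Sum>w\<in>verts G - {u}. ?c u w)
     - 2 * (\<Sum>w\<in>nbrs G u. ?c u w * (?d u + ?d w)) + (\<Sum>w\<in>nbrs G u. (?d u + ?d w) ^ 2)"
    if u: "u \<in> verts G" for u
  proof -
    have "(\<Sum>w\<in>verts G. lap2 G u w * lap2 G w u)
       = lap2 G u u * lap2 G u u + (\<Sum>w\<in>verts G - {u}. lap2 G u w * lap2 G w u)"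
      using fin u by (rule sum.remove)
    also have "(\<Sum>w\<in>verts G - {u}. lap2 G u w * lap2 G w u) = (\<Sum>w\<in>verts G - {u}. ?c u w * (?c u w - 1) + ?c u w
       + (if w \<in> nbrs G u then - 2 * (?c u w * (?d u + ?d w)) + (?d u + ?d w) ^ 2 else 0))"
    proof (rule sum.cong[OF refl])
      fix w assume "w \<in> verts G - {u}"
      then have w: "w \<in> verts G" "u \<noteq> w" by auto
      show "lap2 G u w * lap2 G w u = ?c u w * (?c u w - 1) + ?c u w
       + (if w \<in> nbrs G u then - 2 * (?c u w * (?d u + ?d w)) + (?d u + ?d w) ^ 2 else 0)"
      proof -
        have "lap2 G u w = ?c u w - (if w \<in> nbrs G u then ?d u + ?d w else 0)"
          by (rule lap2_offdiag[OF G u w])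
        moreover have "lap2 G w u = ?c u w - (if w \<in> nbrs G u then ?d u + ?d w else 0)"
          using lap2_offdiag[OF G w(1) u w(2)[symmetric]] nbrs_sym[of w G u] by (simp add: Int_commute)
        ultimately have "lap2 G u w * lap2 G w u = (?c u w - (if w \<in> nbrs G u then ?d u + ?d w else 0)) ^ 2"
          unfolding power2_eq_square by (simp only:)
        then show ?thesis by (cases "w \<in> nbrs G u") (simp_all add: power2_eq_square algebra_simps)
      qed
    qed
    also have "\<dots> = (\<Sum>w\<in>verts G - {u}. ?c u w * (?c u w - 1)) + (\<Sum>w\<in>verts G - {u}. ?c u w)
       + (\<Sum>w\<in>verts G - {u}. if w \<in> nbrs G u then - 2 * (?c u w * (?d u + ?d w)) + (?d u + ?d w) ^ 2 else 0)"
      by (simp only: sum.distrib)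
    also have "(\<Sum>w\<in>verts G - {u}. if w \<in> nbrs G u then - 2 * (?c u w * (?d u + ?d w)) + (?d u + ?d w) ^ 2 else 0)
       = (\<Sum>w\<in>verts G. if w \<in> nbrs G u then - 2 * (?c u w * (?d u + ?d w)) + (?d u + ?d w) ^ 2 else 0)"
      using fin nb(3)[of u] by (intro sum.mono_neutral_left) auto
    also have "\<dots> = - 2 * (\<Sum>w\<in>nbrs G u. ?c u w * (?d u + ?d w)) + (\<Sum>w\<in>nbrs G u. (?d u + ?d w) ^ 2)"
      unfolding sum_nbrs[OF G] sum.distrib sum_distrib_left ..
    finally show ?thesis using lap2_diag[OF G u] by (simp add: power2_eq_square)
  qed
  then have "(\<Sum>u\<in>verts G. \<Sum>w\<in>verts G. lap2 G u w * lap2 G w u) = (\<Sum>u\<in>verts G. (?d u ^ 2 + ?d u) ^ 2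
     + (\<Sum>w\<in>verts G - {u}. ?c u w * (?c u w - 1)) + (\<Sum>w\<in>verts G - {u}. ?c u w)
     - 2 * (\<Sum>w\<in>nbrs G u. ?c u w * (?d u + ?d w)) + (\<Sum>w\<in>nbrs G u. (?d u + ?d w) ^ 2))"
    by (rule sum.cong[OF refl])
  then show ?thesis
    unfolding sum.distrib sum_subtractf sum_distrib_left[symmetric] sum_triangles[OF G]
      card_four_cycles[OF G, symmetric] sum_codegrees[OF G] by linarith
qed

section \<open>The reduced Laplacian determinant\<close>

text \<open>Adding all rows to row 0 splits off a factor \<open>X\<close>; at \<open>X = 0\<close>, adding all columns to column 0 then
  leaves \<open>n\<close> as the only nonzero entry of that column.\<close>

lemma coeff_1_char_poly_zero_sums:
  fixes A :: "'a :: idom mat"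
  assumes A: "A \<in> carrier_mat (Suc m) (Suc m)"
    and row: "\<And>i. i \<le> m \<Longrightarrow> (\<Sum>j\<le>m. A $$ (i, j)) = 0"
    and col: "\<And>j. j \<le> m \<Longrightarrow> (\<Sum>i\<le>m. A $$ (i, j)) = 0"
  shows "coeff (char_poly A) 1 = of_nat (Suc m) * (- 1) ^ m * det (mat_delete A 0 0)"
proof -
  let ?n = "Suc m" and ?X = "[:0, 1:] :: 'a poly"
  define CP where "CP = char_poly_matrix A"
  have CP: "CP \<in> carrier_mat ?n ?n" using A by (simp add: CP_def)
  have CPe: "CP $$ (i, j) = (if i = j then ?X else 0) + [:- A $$ (i, j):]" if "i \<le> m" "j \<le> m" for i j
    using that A by (auto simp: CP_def char_poly_matrix_def)
  define R :: "'a poly mat" where "R = mat ?n ?n (\<lambda>(i, j). if i = 0 \<or> i = j then 1 else 0)"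
  define D :: "'a poly mat" where "D = mat ?n ?n (\<lambda>(i, j). if i = j then if i = 0 then ?X else 1 else 0)"
  define M where "M = mat ?n ?n (\<lambda>(i, j). if i = 0 then 1 else CP $$ (i, j))"
  have car: "R \<in> carrier_mat ?n ?n" "D \<in> carrier_mat ?n ?n" "M \<in> carrier_mat ?n ?n"
    by (auto simp: R_def D_def M_def)
  have "R * CP = D * M"
  proof (rule eq_matI)
    fix i j assume "i < dim_row (D * M)" "j < dim_col (D * M)"
    then have ij: "i \<le> m" "j \<le> m" using car by auto
    have "(R * CP) $$ (i, j) = (\<Sum>t\<le>m. (if i = 0 \<or> i = t then 1 else 0) * CP $$ (t, j))"
      using ij car CP by (simp add: R_def scalar_prod_def lessThan_Suc_atMost[symmetric] lessThan_atLeast0)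
    also have "\<dots> = (if i = 0 then ?X else CP $$ (i, j))"
    proof (cases "i = 0")
      case True
      have "(\<Sum>t\<le>m. CP $$ (t, j)) = (\<Sum>t\<le>m. (if t = j then ?X else 0) + [:- A $$ (t, j):])"
        using CPe ij by (intro sum.cong) auto
      also have "\<dots> = ?X + (\<Sum>t\<le>m. [:- A $$ (t, j):])" using ij by (simp add: sum.distrib)
      also have "(\<Sum>t\<le>m. [:- A $$ (t, j):]) = [:- (\<Sum>t\<le>m. A $$ (t, j)):]"
        by (rule poly_eqI) (auto simp: coeff_sum coeff_pCons sum_negf split: nat.split)
      finally show ?thesis using True col[OF ij(2)] by simp
    next
      case False
      have "(\<Sum>t\<le>m. (if i = 0 \<or> i = t then 1 else 0) * CP $$ (t, j)) = (\<Sum>t\<le>m. if i = t then CP $$ (t, j) else 0)"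
        using False by (intro sum.cong) auto
      then show ?thesis using False ij by simp
    qed
    also have "\<dots> = (\<Sum>t\<le>m. if i = t then (if i = 0 then ?X else 1) * M $$ (t, j) else 0)"
      using ij by (simp add: M_def)
    also have "\<dots> = (\<Sum>t\<le>m. (if i = t then if i = 0 then ?X else 1 else 0) * M $$ (t, j))"
      by (intro sum.cong) auto
    also have "\<dots> = (D * M) $$ (i, j)"
      using ij car by (simp add: D_def scalar_prod_def lessThan_Suc_atMost[symmetric] lessThan_atLeast0 del: sum.op_ivl_Suc)
    finally show "(R * CP) $$ (i, j) = (D * M) $$ (i, j)" .
  qed (use car CP in auto)
  then have "det R * det CP = det D * det M"
    using det_mult[OF car(1) CP] det_mult[OF car(2,3)] by simp
  moreover have "det R = 1"
    using det_upper_triangular[of R ?n] car(1)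
    by (auto simp: upper_triangular_def R_def diag_mat_def intro!: prod_list_neutral simp del: upt_Suc)
  moreover have "det D = ?X"
  proof -
    have "diag_mat D = ?X # map (\<lambda>_. 1) [1..<?n]"
      unfolding diag_mat_def using car(2) by (auto simp: D_def upt_conv_Cons simp del: upt_Suc)
    then show ?thesis using det_upper_triangular[of D ?n] car(2)
      by (auto simp: upper_triangular_def D_def map_replicate_const)
  qed
  ultimately have "char_poly A = ?X * det M" by (simp add: char_poly_def CP_def)
  \<comment> \<open>The factor \<open>X\<close> shifts the coefficients by one, and the determinant
    can be evaluated at 0 entry by entry.\<close>
  then have "coeff (char_poly A) 1 = poly (det M) 0"
    by (simp add: poly_0_coeff_0)
  also have "\<dots> = det (mat ?n ?n (\<lambda>(i, j). if i = 0 then 1 else - A $$ (i, j)))"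
    using CPe by (intro poly_det_cong[of _ ?n] car) (auto simp: M_def)
  also have "\<dots> = of_nat ?n * (- 1) ^ m * det (mat_delete A 0 0)"
  proof -
    define M0 where "M0 = mat ?n ?n (\<lambda>(i, j). if i = 0 then 1 else - A $$ (i, j))"
    define C :: "'a mat" where "C = mat ?n ?n (\<lambda>(i, j). if j = 0 \<or> i = j then 1 else 0)"
    define M1 where "M1 = mat ?n ?n (\<lambda>(i, j). if j = 0 then if i = 0 then of_nat ?n else 0 else M0 $$ (i, j))"
    have car0: "M0 \<in> carrier_mat ?n ?n" "C \<in> carrier_mat ?n ?n" "M1 \<in> carrier_mat ?n ?n"
      by (auto simp: M0_def C_def M1_def)
    have "M0 * C = M1"
    proof (rule eq_matI)
      fix i j assume "i < dim_row M1" "j < dim_col M1"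
      then have ij: "i \<le> m" "j \<le> m" using car0 by auto
      have "(M0 * C) $$ (i, j) = (\<Sum>t\<le>m. M0 $$ (i, t) * (if j = 0 \<or> t = j then 1 else 0))"
        using ij car0 by (simp add: C_def scalar_prod_def lessThan_Suc_atMost[symmetric] lessThan_atLeast0)
      also have "\<dots> = M1 $$ (i, j)"
      proof (cases "j = 0")
        case True
        have "(\<Sum>t\<le>m. M0 $$ (i, t)) = (if i = 0 then of_nat ?n else - (\<Sum>t\<le>m. A $$ (i, t)))"
          using ij by (auto simp: M0_def sum_negf)
        then show ?thesis using True row[OF ij(1)] ij by (simp add: M1_def)
      next
        case False
        have "(\<Sum>t\<le>m. M0 $$ (i, t) * (if j = 0 \<or> t = j then 1 else 0)) = (\<Sum>t\<le>m. if t = j then M0 $$ (i, t) else 0)"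
          using False by (intro sum.cong) auto
        then show ?thesis using False ij by (simp add: M1_def)
      qed
      finally show "(M0 * C) $$ (i, j) = M1 $$ (i, j)" .
    qed (use car0 in auto)
    then have "det M0 * det C = det M1" using det_mult[OF car0(1,2)] by simp
    moreover have "det C = 1"
      using det_lower_triangular[of ?n C] car0(2)
      by (auto simp: C_def diag_mat_def intro!: prod_list_neutral simp del: upt_Suc)
    moreover have "det M1 = of_nat ?n * cofactor M1 0 0"
    proof -
      have "det M1 = (\<Sum>i<?n. M1 $$ (i, 0) * cofactor M1 i 0)"
        using laplace_expansion_column[OF car0(3), of 0] by simp
      also have "\<dots> = (\<Sum>i\<in>{0}. M1 $$ (i, 0) * cofactor M1 i 0)"
        by (rule sum.mono_neutral_right) (auto simp: M1_def)
      finally show ?thesis by (simp add: M1_def)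
    qed
    moreover have "mat_delete M1 0 0 = - 1 \<cdot>\<^sub>m mat_delete A 0 0"
      using A by (intro eq_matI) (auto simp: mat_delete_def M1_def M0_def)
    ultimately show ?thesis
      unfolding M0_def[symmetric] using A by (simp add: cofactor_def mat_delete_def)
  qed
  finally show ?thesis .
qed

lemma sum_lap:
  assumes "simple_graph G" "u \<in> verts G"
  shows "(\<Sum>w\<in>verts G. lap G u w) = 0" "(\<Sum>w\<in>verts G. lap G w u) = 0"
proof -
  have fin: "finite (verts G)" using assms by (simp add: simple_graph_def)
  have "(\<Sum>w\<in>verts G. lap G u w) =
    (\<Sum>w\<in>verts G. if u = w then int (deg G u) else 0) - (\<Sum>w\<in>verts G. if w \<in> nbrs G u then 1 else 0)"
    by (simp add: lap_def sum_subtractf)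
  also have "\<dots> = 0"
    using fin assms simple_graph_nbrs(1)[OF assms(1), of u] by (simp add: sum.If_cases deg_def Int_absorb1)
  finally show "(\<Sum>w\<in>verts G. lap G u w) = 0" .
  moreover have "lap G w u = lap G u w" for w by (auto simp: lap_def nbrs_sym)
  ultimately show "(\<Sum>w\<in>verts G. lap G w u) = 0" by simp
qed

lemma det_mat_on_of_int: "det (mat_on us f :: 'r :: comm_ring_1 mat) = of_int (det (mat_on us f :: int mat))"
proof -
  have "mat_on us f = map_mat (of_int :: int \<Rightarrow> 'r) (mat_on us f)"
    by (intro eq_matI) (auto simp: mat_on_def)
  then show ?thesis by (metis of_int_hom.hom_det)
qed

lemma coeff_1_char_poly_lap:
  assumes G: "simple_graph G" and vs: "distinct (v # us)" "set (v # us) = verts G"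
  shows "coeff (char_poly (mat_on (v # us) (lap G) :: complex mat)) 1
    = of_nat (Suc (length us)) * (- 1) ^ length us * of_int (det (mat_on us (lap G) :: int mat))"
proof -
  let ?A = "mat_on (v # us) (lap G) :: complex mat" and ?m = "length us"
  have "mat_delete ?A 0 0 = mat_on us (lap G)"
    by (intro eq_matI) (auto simp: mat_delete_def mat_on_def)
  moreover have "(\<Sum>j\<le>?m. ?A $$ (i, j)) = 0" if "i \<le> ?m" for i
  proof -
    have "(v # us) ! i \<in> verts G" using that vs(2) by (metis le_imp_less_Suc length_Cons nth_mem)
    then have "(\<Sum>j<length (v # us). lap G ((v # us) ! i) ((v # us) ! j)) = 0"
      using sum_nth_distinct[OF vs(1)] sum_lap(1)[OF G] vs(2) by metis
    then show ?thesis using that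
      by (simp add: mat_on_def lessThan_Suc_atMost del: of_int_sum add: of_int_sum[symmetric])
  qed
  moreover have "(\<Sum>i\<le>?m. ?A $$ (i, j)) = 0" if "j \<le> ?m" for j
  proof -
    have "(v # us) ! j \<in> verts G" using that vs(2) by (metis le_imp_less_Suc length_Cons nth_mem)
    then have "(\<Sum>i<length (v # us). lap G ((v # us) ! i) ((v # us) ! j)) = 0"
      using sum_nth_distinct[OF vs(1), of "\<lambda>x. lap G x ((v # us) ! j)"] sum_lap(2)[OF G] vs(2) by metis
    then show ?thesis using that
      by (simp add: mat_on_def lessThan_Suc_atMost del: of_int_sum add: of_int_sum[symmetric])
  qed
  ultimately show ?thesis
    using coeff_1_char_poly_zero_sums[of ?A ?m] det_mat_on_of_int[of us "lap G", where ?'r = complex]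
      mat_on_carrier(1)[of "v # us" "lap G"] by simp
qed

text \<open>The vertices deleted in the two graphs are arbitrary. In both cases the coefficient of
  \<open>X\<close> carries the same nonzero factor, which depends only on the number of
  vertices.\<close>

lemma cospectral_reduced_det:
  assumes "simple_graph G" "simple_graph H" "laplacian_spectrum G = laplacian_spectrum H"
    and "distinct (v # us)" "set (v # us) = verts G"
    and "distinct (w # ws)" "set (w # ws) = verts H"
  shows "det (mat_on us (lap G) :: int mat) = det (mat_on ws (lap H))"
  using cospectral_char_poly_eq[OF assms] coeff_1_char_poly_lap[OF assms(1,4,5)]
    coeff_1_char_poly_lap[OF assms(2,6,7)] by (simp del: of_nat_Suc)

section \<open>Rose graphs\<close>

lemma edges_cycle_of:
  assumes "xs \<noteq> []"
  shows "edges (cycle_of xs) = {{xs ! i, xs ! Suc i} | i. Suc i < length xs} \<union> {{xs ! (length xs - 1), xs ! 0}}"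
proof (intro equalityI subsetI)
  fix e assume "e \<in> edges (cycle_of xs)"
  then obtain i where i: "i < length xs" "e = {xs ! i, xs ! (Suc i mod length xs)}"
    by (auto simp: cycle_of_def)
  show "e \<in> {{xs ! i, xs ! Suc i} | i. Suc i < length xs} \<union> {{xs ! (length xs - 1), xs ! 0}}"
  proof (cases "Suc i < length xs")
    case True
    then show ?thesis using i by auto
  next
    case False
    then have "length xs = Suc i" using i by simp
    then show ?thesis using i by simp
  qed
next
  fix e assume "e \<in> {{xs ! i, xs ! Suc i} | i. Suc i < length xs} \<union> {{xs ! (length xs - 1), xs ! 0}}"
  then consider i where "Suc i < length xs" "e = {xs ! i, xs ! Suc i}"
    | "e = {xs ! (length xs - 1), xs ! 0}" by auto
  then show "e \<in> edges (cycle_of xs)"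
  proof cases
    case (1 i)
    then show ?thesis by (auto simp: cycle_of_def intro!: exI[of _ i])
  next
    case 2
    then show ?thesis using assms by (auto simp: cycle_of_def intro!: exI[of _ "length xs - 1"])
  qed
qed

lemma verts_rose:
  assumes "k \<ge> 3" "l \<ge> 3"
  shows "verts (rose k l) = {0..<k + l - 1}"
  using assms by (auto simp: rose_def graph_union_def cycle_of_def)

lemma simple_graph_rose:
  assumes "k \<ge> 3" "l \<ge> 3"
  shows "simple_graph (rose k l)"
  using two_rose_simple_graph[OF two_rose_rose[OF assms]] .

text \<open>Consecutive numbers are adjacent, except \<open>k - 1\<close> and \<open>k\<close>,
  where the numbering passes from one cycle to the other; this is why the value \<open>k\<close> is
  excluded. The remaining edges join the centre 0 to \<open>k - 1\<close>, \<open>k\<close> and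
  \<open>k + l - 2\<close>. In this form adjacency is linear arithmetic.\<close>

lemma nbrs_rose:
  assumes "k \<ge> 3" "l \<ge> 3"
  shows "j \<in> nbrs (rose k l) i \<longleftrightarrow> Suc i < k + l \<and> Suc j < k + l \<and>
    (j = Suc i \<and> j \<noteq> k \<or> i = Suc j \<and> i \<noteq> k \<or>
     i = 0 \<and> (Suc j = k \<or> j = k \<or> j + 2 = k + l) \<or> j = 0 \<and> (Suc i = k \<or> i = k \<or> i + 2 = k + l))"
proof -
  let ?ys = "0 # [k..<k + l - 1]"
  have e1: "edges (cycle_of [0..<k]) = {{i, Suc i} | i. Suc i < k} \<union> {{k - 1, 0}}"
  proof -
    have "{{[0..<k] ! i, [0..<k] ! Suc i} | i. Suc i < k} = {{i, Suc i} | i. Suc i < k}"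
      unfolding setcompr_eq_image by (rule image_cong) auto
    then show ?thesis using assms by (subst edges_cycle_of) auto
  qed
  have e2: "edges (cycle_of ?ys) = {{0, k}} \<union> {{i, Suc i} | i. k \<le> i \<and> Suc i < k + l - 1} \<union> {{k + l - 2, 0}}"
  proof -
    have "{{?ys ! i, ?ys ! Suc i} | i. Suc i < length ?ys} = {{0, k}} \<union> {{i, Suc i} | i. k \<le> i \<and> Suc i < k + l - 1}"
    proof (intro equalityI subsetI)
      fix e assume "e \<in> {{?ys ! i, ?ys ! Suc i} | i. Suc i < length ?ys}"
      then obtain i where i: "Suc i < length ?ys" "e = {?ys ! i, ?ys ! Suc i}" by auto
      then show "e \<in> {{0, k}} \<union> {{i, Suc i} | i. k \<le> i \<and> Suc i < k + l - 1}"
        by (cases i) (auto intro!: exI[of _ "k + (i - 1)"])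
    next
      fix e assume "e \<in> {{0, k}} \<union> {{i, Suc i} | i. k \<le> i \<and> Suc i < k + l - 1}"
      then consider "e = {0, k}" | i where "k \<le> i" "Suc i < k + l - 1" "e = {i, Suc i}" by auto
      then show "e \<in> {{?ys ! i, ?ys ! Suc i} | i. Suc i < length ?ys}"
      proof cases
        case 1
        then show ?thesis using assms by (auto intro!: exI[of _ 0])
      next
        case (2 i)
        then show ?thesis using assms by (auto intro!: exI[of _ "Suc (i - k)"])
      qed
    qed
    moreover have "?ys ! (length ?ys - 1) = k + l - 2" using assms by (simp add: nth_Cons')
    ultimately show ?thesis by (subst edges_cycle_of) auto
  qed
  have "j \<in> nbrs (rose k l) i \<longleftrightarrow> {i, j} \<in> edges (cycle_of [0..<k]) \<or> {i, j} \<in> edges (cycle_of ?ys)"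
    by (simp add: nbrs_def rose_def graph_union_def)
  also have "\<dots> \<longleftrightarrow> (j = Suc i \<and> j < k \<or> i = Suc j \<and> i < k \<or> i = k - 1 \<and> j = 0 \<or> j = k - 1 \<and> i = 0) \<or>
     (i = 0 \<and> j = k \<or> i = k \<and> j = 0 \<or> k \<le> i \<and> j = Suc i \<and> j < k + l - 1 \<or>
      k \<le> j \<and> i = Suc j \<and> i < k + l - 1 \<or> i = k + l - 2 \<and> j = 0 \<or> j = k + l - 2 \<and> i = 0)"
    unfolding e1 e2 by (auto simp: doubleton_eq_iff)
  also have "\<dots> \<longleftrightarrow> Suc i < k + l \<and> Suc j < k + l \<and>
    (j = Suc i \<and> j \<noteq> k \<or> i = Suc j \<and> i \<noteq> k \<or>
     i = 0 \<and> (Suc j = k \<or> j = k \<or> j + 2 = k + l) \<or> j = 0 \<and> (Suc i = k \<or> i = k \<or> i + 2 = k + l))"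
    supply [[smt_nat_as_int]] using assms by (smt (z3))
  finally show ?thesis .
qed

lemma deg_rose:
  assumes kl: "k \<ge> 3" "l \<ge> 3"
  shows "deg (rose k l) 0 = 4"
    and "0 < i \<Longrightarrow> i < k + l - 1 \<Longrightarrow> deg (rose k l) i = 2"
proof -
  have "nbrs (rose k l) 0 = {1, k - 1, k, k + l - 2}"
    using kl by (auto simp: nbrs_rose[OF kl])
  moreover have "1 \<noteq> k - 1" "1 \<noteq> k" "1 \<noteq> k + l - 2" "k - 1 \<noteq> k" "k - 1 \<noteq> k + l - 2" "k \<noteq> k + l - 2"
    using kl by linarith+
  ultimately show "deg (rose k l) 0 = 4" by (simp add: deg_def)
  assume i: "0 < i" "i < k + l - 1"
  have "nbrs (rose k l) i = {if i = k then 0 else i - 1, if i = k - 1 \<or> i = k + l - 2 then 0 else i + 1}"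
    using kl i by (auto simp: nbrs_rose[OF kl])
  moreover have "(if i = k then 0 else i - 1) \<noteq> (if i = k - 1 \<or> i = k + l - 2 then 0 else i + 1)"
    using kl i by auto
  ultimately show "deg (rose k l) i = 2" by (simp add: deg_def card_insert_if)
qed

lemma sum_deg_rose:
  assumes kl: "k \<ge> 3" "l \<ge> 3"
  shows "(\<Sum>u\<in>verts (rose k l). f (int (deg (rose k l) u)) :: int) = f 4 + (int k + int l - 2) * f 2"
proof -
  have "(\<Sum>u\<in>verts (rose k l). f (int (deg (rose k l) u))) = f 4 + (\<Sum>u\<in>{1..<k + l - 1}. f (int (deg (rose k l) u)))"
    using kl deg_rose(1)[OF kl] by (simp add: verts_rose sum.atLeast_Suc_lessThan)
  also have "(\<Sum>u\<in>{1..<k + l - 1}. f (int (deg (rose k l) u))) = (\<Sum>u\<in>{1..<k + l - 1}. f 2)"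
    using deg_rose(2)[OF kl] by (intro sum.cong) auto
  finally show ?thesis using kl by (simp add: of_nat_diff)
qed

lemma triangles_rose_nonempty:
  assumes "3 \<le> k" "k \<le> l" "triangles (rose k l) \<noteq> {}"
  shows "k = 3"
proof -
  have kl: "k \<ge> 3" "l \<ge> 3" using assms by auto
  obtain u w z where "w \<in> nbrs (rose k l) u" "z \<in> nbrs (rose k l) u" "z \<in> nbrs (rose k l) w"
    using assms(3) by (auto simp: triangles_def)
  then show ?thesis
    supply [[smt_nat_as_int]] unfolding nbrs_rose[OF kl] using assms(1,2) by (smt (z3))
qed

lemma triangles_rose_3:
  assumes "l \<ge> 4"
  shows "triangles (rose 3 l) = {(0,1,2), (0,2,1), (1,0,2), (1,2,0), (2,0,1), (2,1,0)}"
proof -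
  have kl: "l \<ge> 3" using assms by simp
  have "(w \<in> nbrs (rose 3 l) u \<and> z \<in> nbrs (rose 3 l) u \<and> z \<in> nbrs (rose 3 l) w) \<longleftrightarrow>
    (u, w, z) \<in> {(0,1,2), (0,2,1), (1,0,2), (1,2,0), (2,0,1), (2,1,0)}" for u w z
    supply [[smt_nat_as_int]] unfolding nbrs_rose[OF order_refl kl] insert_iff empty_iff prod.inject
    using assms by (smt (z3))
  then show ?thesis
    by (simp only: triangles_def set_eq_iff split_paired_All mem_Collect_eq case_prod_conv simp_thms)
qed

lemma triangles_rose_3_3: "card (triangles (rose 3 3)) = 12"
proof -
  have kl: "3 \<le> (3::nat)" by simp
  have "(w \<in> nbrs (rose 3 3) u \<and> z \<in> nbrs (rose 3 3) u \<and> z \<in> nbrs (rose 3 3) w) \<longleftrightarrow>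
    (u, w, z) \<in> {(0,1,2), (0,2,1), (1,0,2), (1,2,0), (2,0,1), (2,1,0),
      (0,3,4), (0,4,3), (3,0,4), (3,4,0), (4,0,3), (4,3,0)}" for u w z
    supply [[smt_nat_as_int]] unfolding nbrs_rose[OF order_refl kl] insert_iff empty_iff prod.inject
    by (smt (z3))
  then have "triangles (rose 3 3) = {(0,1,2), (0,2,1), (1,0,2), (1,2,0), (2,0,1), (2,1,0),
      (0,3,4), (0,4,3), (3,0,4), (3,4,0), (4,0,3), (4,3,0)}"
    by (simp only: triangles_def set_eq_iff split_paired_All mem_Collect_eq case_prod_conv simp_thms)
  then show ?thesis by simp
qed

definition rose_pivot :: "nat \<Rightarrow> nat \<Rightarrow> rat" where
  "rose_pivot a i = (if i < a then (of_nat i + 2) / (of_nat i + 1)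
     else (of_nat (i - a) + 2) / (of_nat (i - a) + 1))"

text \<open>Within each block the product telescopes and leaves the last numerator,
  \<open>a + 1\<close> or \<open>b + 1\<close>.\<close>

lemma prod_rose_pivot: "(\<Prod>i<a + b. rose_pivot a i) = of_nat ((a + 1) * (b + 1))"
proof (induction b)
  case 0
  have "(\<Prod>i<c. (of_nat i + 2) / (of_nat i + 1)) = (of_nat (c + 1) :: rat)" for c
    by (induction c) (simp_all add: field_simps)
  then show ?case by (simp add: rose_pivot_def)
next
  case (Suc b)
  have "(of_nat b + 1 :: rat) * ((of_nat b + 2) / (of_nat b + 1)) = of_nat b + 2"
    using of_nat_neq_0[of b, where ?'a = rat] by (simp add: add.commute)
  moreover have "rose_pivot a (a + b) = (of_nat b + 2) / (of_nat b + 1)" by (simp add: rose_pivot_def)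
  moreover have "(\<Prod>i<a + Suc b. rose_pivot a i) = (of_nat a + 1) * ((of_nat b + 1) * rose_pivot a (a + b))"
    using Suc by (simp only: add_Suc_right prod.lessThan_Suc of_nat_mult of_nat_add of_nat_1 mult.assoc)
  ultimately show ?case by (simp add: algebra_simps)
qed

text \<open>This is Gaussian elimination with 2 on the diagonal and -1 beside it: each pivot is 2
  minus the reciprocal of the preceding one, with a fresh start in the first row of either
  block.\<close>

lemma rose_pivot_rec:
  "rose_pivot a 0 = 2" "rose_pivot a a = 2"
  "0 < i \<Longrightarrow> i \<noteq> a \<Longrightarrow> rose_pivot a i + 1 / rose_pivot a (i - 1) = 2"
  "rose_pivot a i > 0"
proof -
  show "rose_pivot a 0 = 2" "rose_pivot a a = 2" by (simp_all add: rose_pivot_def)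
  show "rose_pivot a i > 0" by (auto simp: rose_pivot_def intro!: divide_pos_pos add_nonneg_pos)
  have *: "(of_nat (Suc j) + 2) / (of_nat (Suc j) + 1) + 1 / ((of_nat j + 2) / (of_nat j + 1)) = (2 :: rat)" for j
  proof -
    have "of_nat j + 2 > (0 :: rat)" "of_nat j + 1 > (0 :: rat)" by (simp_all add: add_nonneg_pos)
    then show ?thesis by (simp add: divide_simps add.commute)
  qed
  assume i: "0 < i" "i \<noteq> a"
  show "rose_pivot a i + 1 / rose_pivot a (i - 1) = 2"
  proof (cases "i < a")
    case True
    obtain j where j: "i = Suc j" using i gr0_conv_Suc by auto
    have "rose_pivot a i = (of_nat (Suc j) + 2) / (of_nat (Suc j) + 1)"
      "rose_pivot a (i - 1) = (of_nat j + 2) / (of_nat j + 1)"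
      using True j by (auto simp: rose_pivot_def)
    then show ?thesis using * by (simp only:)
  next
    case False
    obtain j where j: "i = Suc (a + j)" using i False less_iff_Suc_add[of a i] by auto
    have "rose_pivot a i = (of_nat (Suc j) + 2) / (of_nat (Suc j) + 1)"
      "rose_pivot a (i - 1) = (of_nat j + 2) / (of_nat j + 1)"
      using False j by (auto simp: rose_pivot_def)
    then show ?thesis using * by (simp only:)
  qed
qed

text \<open>With the centre deleted, the Laplacian of a rose is tridiagonal with two blocks;
  the pivots of its LU factorisation are the numbers \<open>(i + 2) / (i + 1)\<close>.\<close>

lemma det_lap_rose:
  assumes kl: "k \<ge> 3" "l \<ge> 3"
  shows "det (mat_on [1..<k + l - 1] (lap (rose k l)) :: int mat) = int (k * l)"
proof -
  \<comment> \<open>Row \<open>i\<close> belongs to vertex \<open>i + 1\<close>, so the block of the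
    second cycle, which begins with vertex \<open>k\<close>, starts in row \<open>a\<close>.\<close>
  define a where "a = k - 1"
  define m where "m = k + l - 2"
  define p where "p = rose_pivot a"
  have len: "length [1..<k + l - 1] = m" by (simp add: m_def)
  have p0: "p i \<noteq> 0" for i using rose_pivot_rec(4)[of a i] by (simp add: p_def)
  define A :: "rat mat" where "A = mat_on [1..<k + l - 1] (lap (rose k l))"
  define L where "L = mat m m (\<lambda>(i, t). if i = t then 1 else if i = Suc t \<and> i \<noteq> a then - 1 / p t else 0)"
  define U where "U = mat m m (\<lambda>(t, j). if t = j then p t else if j = Suc t \<and> j \<noteq> a then - 1 else 0)"
  have A: "A $$ (i, j) = (if i = j then 2 else if (i = Suc j \<and> i \<noteq> a) \<or> (j = Suc i \<and> j \<noteq> a) then - 1 else 0)"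
    if ij: "i < m" "j < m" for i j
  proof -
    have n: "[1..<k + l - 1] ! i = Suc i" "[1..<k + l - 1] ! j = Suc j"
      using ij by (auto simp: m_def)
    have "Suc j \<in> nbrs (rose k l) (Suc i) \<longleftrightarrow> (i = Suc j \<and> i \<noteq> a) \<or> (j = Suc i \<and> j \<noteq> a)"
      unfolding nbrs_rose[OF kl] using ij kl by (auto simp: m_def a_def)
    moreover have "deg (rose k l) (Suc i) = 2" using deg_rose(2)[OF kl, of "Suc i"] ij kl by (simp add: m_def)
    ultimately show ?thesis using ij len n by (auto simp: A_def mat_on_def lap_def)
  qed
  have car: "A \<in> carrier_mat m m" "L \<in> carrier_mat m m" "U \<in> carrier_mat m m"
    using len by (auto simp: A_def L_def U_def intro!: carrier_matI)
  have "L * U = A"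
  proof (rule eq_matI)
    fix i j assume "i < dim_row A" "j < dim_col A"
    then have ij: "i < m" "j < m" using car by auto
    have "(L * U) $$ (i, j) = (\<Sum>t<m. L $$ (i, t) * U $$ (t, j))"
      using ij car by (simp add: scalar_prod_def lessThan_atLeast0)
    also have "\<dots> = (\<Sum>t<m. (if t = i then U $$ (t, j) else 0)
        + (if i = Suc t then (if i \<noteq> a then - 1 / p t * U $$ (t, j) else 0) else 0))"
      using ij by (intro sum.cong) (auto simp: L_def)
    also have "\<dots> = U $$ (i, j) + (\<Sum>t<m. if i = Suc t then (if i \<noteq> a then - 1 / p t * U $$ (t, j) else 0) else 0)"
      using ij by (simp add: sum.distrib)
    also have "(\<Sum>t<m. if i = Suc t then (if i \<noteq> a then - 1 / p t * U $$ (t, j) else 0) else 0)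
       = (if 0 < i \<and> i \<noteq> a then - 1 / p (i - 1) * U $$ (i - 1, j) else 0)"
    proof (cases i)
      case (Suc i')
      have "(\<Sum>t<m. if i = Suc t then (if i \<noteq> a then - 1 / p t * U $$ (t, j) else 0) else 0)
        = (\<Sum>t<m. if i' = t then (if i \<noteq> a then - 1 / p t * U $$ (t, j) else 0) else 0)"
        using Suc by simp
      then show ?thesis using Suc ij by simp
    qed simp
    also have "U $$ (i, j) + \<dots> = A $$ (i, j)"
    proof -
      have U: "U $$ (t, j) = (if t = j then p t else if j = Suc t \<and> j \<noteq> a then - 1 else 0)" if "t < m" for t
        using that ij by (simp add: U_def)
      show ?thesis
      proof (cases "i = 0 \<or> i = a")
        case True
        then have "p i = 2" using rose_pivot_rec(1,2)[of a] by (auto simp: p_def)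
        then show ?thesis unfolding A[OF ij] U[OF ij(1)] using True by auto
      next
        case False
        then obtain t where t: "i = Suc t" using not0_implies_Suc by blast
        have pp: "p i + 1 / p t = 2" using rose_pivot_rec(3)[of i a] False t by (simp add: p_def)
        have tm: "t < m" using ij t by simp
        show ?thesis
          unfolding A[OF ij] U[OF ij(1)] using False t pp p0[of t] U[OF tm] by (cases "j = t"; cases "j = i") auto
      qed
    qed
    finally show "(L * U) $$ (i, j) = A $$ (i, j)" .
  qed (use car in auto)
  then have "det A = det L * det U" using det_mult[OF car(2,3)] by simp
  moreover have "det L = 1"
    using det_lower_triangular[of m L] car(2) by (auto simp: L_def diag_mat_def intro!: prod_list_neutral)
  moreover have "det U = (\<Prod>i<m. p i)"
  proof -
    have "diag_mat U = map p [0..<m]" using car(3) by (auto simp: diag_mat_def U_def)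
    moreover have "upper_triangular U" by (auto simp: upper_triangular_def U_def)
    ultimately show ?thesis
      using det_upper_triangular[of U m] car(3)
      by (simp add: prod.distinct_set_conv_list[symmetric] lessThan_atLeast0)
  qed
  moreover have "(\<Prod>i<m. p i) = of_nat (k * l)"
  proof -
    have "m = a + (l - 1)" "k * l = (a + 1) * (l - 1 + 1)" using kl by (simp_all add: a_def m_def)
    then show ?thesis using prod_rose_pivot[of a "l - 1"] by (simp only: p_def)
  qed
  ultimately have "of_int (det (mat_on [1..<k + l - 1] (lap (rose k l)) :: int mat)) = (of_nat (k * l) :: rat)"
    using det_mat_on_of_int[of "[1..<k + l - 1]" "lap (rose k l)", where ?'r = rat] by (simp add: A_def)
  then show ?thesis by (metis of_int_eq_iff of_int_of_nat_eq)
qed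

section \<open>Connectedness\<close>

text \<open>Phrasing connectedness by sets closed under adjacency suits both uses: a proper closed
  set yields a kernel vector of a reduced Laplacian, and a subgraph that no edge leaves is
  recognised as the whole graph.\<close>

definition graph_connected :: "'a ugraph \<Rightarrow> bool" where
  "graph_connected G \<longleftrightarrow> (\<forall>S. S \<subseteq> verts G \<and> S \<noteq> {} \<and> (\<forall>u\<in>S. nbrs G u \<subseteq> S) \<longrightarrow> S = verts G)"

lemma graph_connectedD:
  assumes "graph_connected G" "S \<subseteq> verts G" "S \<noteq> {}" "\<And>u. u \<in> S \<Longrightarrow> nbrs G u \<subseteq> S"
  shows "S = verts G"
  using assms unfolding graph_connected_def by blast

text \<open>The indicator function of \<open>S\<close> is a kernel vector: no edge leaves
  \<open>S\<close>, and as \<open>v\<close> lies outside, deleting its row and column does not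
  disturb the row sums.\<close>

lemma det_lap_eq_0:
  assumes G: "simple_graph G" and vs: "distinct (v # us)" "set (v # us) = verts G"
    and S: "S \<subseteq> verts G" "S \<noteq> {}" "v \<notin> S" "\<And>u. u \<in> S \<Longrightarrow> nbrs G u \<subseteq> S"
  shows "det (mat_on us (lap G) :: int mat) = 0"
proof -
  define x :: "int vec" where "x = vec (length us) (\<lambda>i. if us ! i \<in> S then 1 else 0)"
  have "x \<noteq> 0\<^sub>v (length us)"
  proof -
    obtain s where "s \<in> S" using S by blast
    then have "s \<in> set (v # us)" "s \<noteq> v" using S(1,3) vs(2) by auto
    then have "s \<in> set us" by simp
    then obtain i where "i < length us" "us ! i = s" by (auto simp: in_set_conv_nth)
    then have "x $ i \<noteq> 0\<^sub>v (length us) $ i" using \<open>s \<in> S\<close> by (simp add: x_def)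
    then show ?thesis by metis
  qed
  moreover have "mat_on us (lap G) *\<^sub>v x = 0\<^sub>v (length us)"
  proof (rule eq_vecI)
    fix i assume "i < dim_vec (0\<^sub>v (length us) :: int vec)"
    then have i: "i < length us" by simp
    let ?u = "us ! i"
    have "?u \<in> set (v # us)" using i by simp
    then have u: "?u \<in> verts G" by (simp only: vs(2))
    have fin: "finite (verts G)" using G by (simp add: simple_graph_def)
    have "(mat_on us (lap G) *\<^sub>v x) $ i = (\<Sum>j<length us. lap G ?u (us ! j) * (if us ! j \<in> S then 1 else 0))"
      using i by (simp add: mat_on_def x_def scalar_prod_def lessThan_atLeast0)
    also have "\<dots> = (\<Sum>w\<in>set us. lap G ?u w * (if w \<in> S then 1 else 0))"
      using vs sum_nth_distinct[of us "\<lambda>w. lap G ?u w * (if w \<in> S then 1 else 0)"] by simp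
    also have "\<dots> = (\<Sum>w\<in>verts G. lap G ?u w * (if w \<in> S then 1 else 0))"
      unfolding vs(2)[symmetric] using S(3) by (intro sum.mono_neutral_left) auto
    also have "\<dots> = 0"
    proof (cases "?u \<in> S")
      case True
      then have "lap G ?u w * (if w \<in> S then 1 else 0) = lap G ?u w" for w
        using S(4)[of ?u] by (auto simp: lap_def)
      then show ?thesis using sum_lap(1)[OF G u] by (simp only:)
    next
      case False
      then have "lap G ?u w * (if w \<in> S then 1 else 0) = 0" for w
        using S(4)[of w] nbrs_sym[of w G ?u] by (auto simp: lap_def)
      then show ?thesis by (simp only: sum.neutral_const)
    qed
    finally show "(mat_on us (lap G) *\<^sub>v x) $ i = 0\<^sub>v (length us) $ i" using i by simp
  qed simp
  moreover have "x \<in> carrier_vec (length us)" by (simp add: x_def)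
  ultimately show ?thesis
    using det_0_iff_vec_prod_zero[of "mat_on us (lap G) :: int mat" "length us"] by auto
qed

lemma cospectral_rose_reduced_det:
  assumes kl: "k \<ge> 3" "l \<ge> 3" and H: "simple_graph H"
    and spec: "laplacian_spectrum H = laplacian_spectrum (rose k l)"
    and ws: "distinct (w # ws)" "set (w # ws) = verts H"
  shows "det (mat_on ws (lap H) :: int mat) = int (k * l)"
proof -
  have "distinct (0 # [1..<k + l - 1])" "set (0 # [1..<k + l - 1]) = verts (rose k l)"
    using kl by (auto simp: verts_rose[OF kl])
  from cospectral_reduced_det[OF H simple_graph_rose[OF kl] spec ws this]
  show ?thesis by (simp only: det_lap_rose[OF kl])
qed

lemma cospectral_rose_connected:
  assumes kl: "k \<ge> 3" "l \<ge> 3" and H: "simple_graph H"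
    and spec: "laplacian_spectrum H = laplacian_spectrum (rose k l)"
  shows "graph_connected H"
  unfolding graph_connected_def
proof (intro allI impI, elim conjE)
  fix S assume S: "S \<subseteq> verts H" "S \<noteq> {}" "\<forall>u\<in>S. nbrs H u \<subseteq> S"
  show "S = verts H"
  proof (rule ccontr)
    assume "S \<noteq> verts H"
    then obtain v where v: "v \<in> verts H" "v \<notin> S" using S by blast
    obtain us where us: "distinct us" "set us = verts H - {v}"
      using finite_distinct_list[of "verts H - {v}"] H by (auto simp: simple_graph_def)
    then have vs: "distinct (v # us)" "set (v # us) = verts H" using v by auto
    have "det (mat_on us (lap H) :: int mat) = 0"
      using det_lap_eq_0[OF H vs S(1,2) v(2)] S(3) by blast
    then show False using cospectral_rose_reduced_det[OF kl H spec vs] kl by simp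
  qed
qed

section \<open>Recognising two-roses\<close>

lemma cycle_of_rotate: "cycle_of (rotate m xs) = cycle_of xs"
proof (cases "xs = []")
  case False
  let ?L = "length xs" and ?e = "\<lambda>i. {xs ! i, xs ! (Suc i mod length xs)}"
  have L: "?L > 0" using False by simp
  have "edges (cycle_of (rotate m xs)) = (\<lambda>i. ?e ((m + i) mod ?L)) ` {..<?L}"
    unfolding cycle_of_def snd_conv setcompr_eq_image
  proof (rule image_cong)
    fix i assume "i \<in> {..<?L}"
    then show "{rotate m xs ! i, rotate m xs ! (Suc i mod length (rotate m xs))} = ?e ((m + i) mod ?L)"
      using L by (simp add: nth_rotate mod_simps)
  qed auto
  also have "\<dots> = ?e ` ((\<lambda>i. (m + i) mod ?L) ` {..<?L})" by (simp add: image_image)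
  also have "(\<lambda>i. (m + i) mod ?L) ` {..<?L} = {..<?L}"
  proof (rule endo_inj_surj)
    show "inj_on (\<lambda>i. (m + i) mod ?L) {..<?L}"
    proof (rule linorder_inj_onI')
      fix i j assume ij: "i \<in> {..<?L}" "j \<in> {..<?L}" "i < j"
      show "(m + i) mod ?L \<noteq> (m + j) mod ?L"
      proof
        assume "(m + i) mod ?L = (m + j) mod ?L"
        then have "?L dvd (m + j) - (m + i)" using mod_eq_dvd_iff_nat[of "m + i" "m + j" ?L] ij by simp
        then show False using ij by (auto dest: dvd_imp_le)
      qed
    qed
  qed (use L in auto)
  also have "?e ` {..<?L} = edges (cycle_of xs)"
    by (auto simp: cycle_of_def)
  finally show ?thesis by (simp add: cycle_of_def prod_eq_iff)
qed simp

text \<open>Rotating the list leaves the cycle unchanged, so any question about one vertex of a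
  cycle reduces to the head of a list.\<close>

lemma cycle_of_hd:
  assumes "v \<in> set xs" "distinct xs"
  obtains ys where "cycle_of ys = cycle_of xs" "distinct ys" "length ys = length xs" "set ys = set xs"
    "ys \<noteq> []" "ys ! 0 = v"
proof -
  obtain i where i: "i < length xs" "xs ! i = v" using assms by (auto simp: in_set_conv_nth)
  then have "xs \<noteq> []" by auto
  then show thesis
    by (intro that[of "rotate i xs"]) (use i assms cycle_of_rotate[of i xs] nth_rotate[of 0 xs i] in auto)
qed

lemma nbrs_cycle_of:
  assumes "distinct xs" "length xs \<ge> 3"
  shows "nbrs (cycle_of xs) (xs ! 0) = {xs ! 1, xs ! (length xs - 1)}"
proof -
  have ne: "xs \<noteq> []" using assms by auto
  have eq: "xs ! i = xs ! j \<longleftrightarrow> i = j" if "i < length xs" "j < length xs" for i j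
    using that assms(1) nth_eq_iff_index_eq by blast
  show ?thesis
  proof (intro equalityI subsetI)
    fix w assume "w \<in> nbrs (cycle_of xs) (xs ! 0)"
    then consider i where "Suc i < length xs" "{xs ! 0, w} = {xs ! i, xs ! Suc i}"
      | "{xs ! 0, w} = {xs ! (length xs - 1), xs ! 0}"
      unfolding nbrs_def edges_cycle_of[OF ne] by blast
    then show "w \<in> {xs ! 1, xs ! (length xs - 1)}"
    proof cases
      case (1 i)
      then have "xs ! 0 = xs ! i \<and> w = xs ! Suc i \<or> xs ! 0 = xs ! Suc i \<and> w = xs ! i"
        by (simp add: doubleton_eq_iff)
      moreover have "xs ! 0 \<noteq> xs ! Suc i" using eq[of 0 "Suc i"] 1(1) by linarith
      ultimately have "xs ! 0 = xs ! i" "w = xs ! Suc i" by auto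
      then show ?thesis using eq[of 0 i] 1(1) by force
    next
      case 2
      then show ?thesis by (auto simp: doubleton_eq_iff)
    qed
  next
    fix w assume "w \<in> {xs ! 1, xs ! (length xs - 1)}"
    then show "w \<in> nbrs (cycle_of xs) (xs ! 0)"
      unfolding nbrs_def edges_cycle_of[OF ne] using assms(2) by (auto simp: insert_commute intro!: exI[of _ 0])
  qed
qed

lemma deg_cycle_of:
  assumes "distinct xs" "length xs \<ge> 3" "u \<in> set xs"
  shows "deg (cycle_of xs) u = 2" "nbrs (cycle_of xs) u \<subseteq> set xs" "u \<notin> nbrs (cycle_of xs) u"
proof -
  obtain ys where ys: "cycle_of ys = cycle_of xs" "distinct ys" "length ys = length xs" "set ys = set xs"
    "ys \<noteq> []" "ys ! 0 = u" using cycle_of_hd[OF assms(3,1)] .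
  have "nbrs (cycle_of xs) u = {ys ! 1, ys ! (length ys - 1)}"
    using nbrs_cycle_of[OF ys(2)] ys assms(2) by simp
  moreover have "ys ! 1 \<noteq> ys ! (length ys - 1)" using ys(2,3) assms(2) by (subst nth_eq_iff_index_eq) auto
  ultimately show "deg (cycle_of xs) u = 2" by (simp add: deg_def)
  show "nbrs (cycle_of xs) u \<subseteq> set xs" "u \<notin> nbrs (cycle_of xs) u"
    using simple_graph_nbrs(1,3)[OF simple_graph_cycle_of[OF assms(1,2)], of u] by (auto simp: cycle_of_def)
qed

lemma cycle_of_map: "cycle_of (map f xs) = (f ` set xs, (`) f ` edges (cycle_of xs))"
proof -
  have "edges (cycle_of (map f xs)) = (`) f ` edges (cycle_of xs)"
  proof -
    have "edges (cycle_of xs) = (\<lambda>i. {xs ! i, xs ! (Suc i mod length xs)}) ` {i. i < length xs}"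
      by (auto simp: cycle_of_def)
    moreover have "edges (cycle_of (map f xs)) = (\<lambda>i. f ` {xs ! i, xs ! (Suc i mod length xs)}) ` {i. i < length xs}"
      unfolding cycle_of_def snd_conv setcompr_eq_image
    proof (rule image_cong)
      fix i assume "i \<in> {i. i < length xs}"
      then have "i < length xs" "Suc i mod length xs < length xs" by (auto intro: mod_less_divisor)
      then show "{map f xs ! i, map f xs ! (Suc i mod length (map f xs))} = f ` {xs ! i, xs ! (Suc i mod length xs)}"
        by simp
    qed simp
    ultimately show ?thesis by (simp add: image_image)
  qed
  then show ?thesis by (simp add: prod_eq_iff cycle_of_def)
qed

lemma graph_iso_image:
  assumes "inj_on f (verts G)" "\<And>e. e \<in> edges G \<Longrightarrow> e \<subseteq> verts G"
  shows "graph_iso G (f ` verts G, (`) f ` edges G)"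
  unfolding graph_iso_def
proof (intro exI[of _ f] conjI ballI)
  show "bij_betw f (verts G) (verts (f ` verts G, (`) f ` edges G))"
    using assms(1) by (simp add: bij_betw_def)
  fix u v assume uv: "u \<in> verts G" "v \<in> verts G"
  show "{u, v} \<in> edges G \<longleftrightarrow> {f u, f v} \<in> edges (f ` verts G, (`) f ` edges G)"
  proof
    assume "{f u, f v} \<in> edges (f ` verts G, (`) f ` edges G)"
    then obtain e where e: "e \<in> edges G" "f ` {u, v} = f ` e" by auto
    then have "{u, v} = e" using inj_on_image_eq_iff[OF assms(1), of "{u, v}" e] assms(2)[OF e(1)] uv by auto
    then show "{u, v} \<in> edges G" using e by simp
  qed (auto simp: image_iff intro!: bexI[of _ "{u, v}"])
qed

lemma two_rose_iso_rose:
  assumes "two_rose G"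
  obtains k l where "3 \<le> k" "k \<le> l" "graph_iso G (rose k l)"
proof -
  obtain xs ys v where *: "distinct xs" "distinct ys" "length xs \<ge> 3" "length ys \<ge> 3"
    "set xs \<inter> set ys = {v}" "G = graph_union (cycle_of xs) (cycle_of ys)" "length xs \<le> length ys"
  proof -
    obtain xs ys v where *: "distinct xs" "distinct ys" "length xs \<ge> 3" "length ys \<ge> 3"
      "set xs \<inter> set ys = {v}" "G = graph_union (cycle_of xs) (cycle_of ys)"
      using assms unfolding two_rose_def by blast
    show thesis
    proof (cases "length xs \<le> length ys")
      case True
      then show thesis using that * by blast
    next
      case False
      have "set ys \<inter> set xs = {v}" "G = graph_union (cycle_of ys) (cycle_of xs)"
        using *(5,6) by (auto simp: graph_union_def)
      then show thesis using that[of ys xs v] *(1-4) False by simp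
    qed
  qed
  obtain xs' where xs': "cycle_of xs' = cycle_of xs" "distinct xs'" "length xs' = length xs" "set xs' = set xs"
    "xs' \<noteq> []" "xs' ! 0 = v" using cycle_of_hd[of v xs] * by auto
  obtain ys' where ys': "cycle_of ys' = cycle_of ys" "distinct ys'" "length ys' = length ys" "set ys' = set ys"
    "ys' \<noteq> []" "ys' ! 0 = v" using cycle_of_hd[of v ys] * by auto
  define as where "as = tl xs'"
  define bs where "bs = tl ys'"
  have xs: "xs' = v # as" and ys: "ys' = v # bs"
    using xs'(5,6) ys'(5,6) unfolding as_def bs_def by (metis hd_conv_nth list.collapse)+
  define k where "k = length xs"
  define l where "l = length ys"
  have kl: "k \<ge> 3" "l \<ge> 3" "k \<le> l" using * by (auto simp: k_def l_def)
  have lens: "length as = k - 1" "length bs = l - 1"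
    using xs'(3) ys'(3) xs ys by (auto simp: k_def l_def)
  \<comment> \<open>The vertices are listed in the order used by \<open>rose\<close>: the centre,
    the rest of the shorter cycle, the rest of the longer one. Indexing into this list is the
    isomorphism.\<close>
  define zs where "zs = v # as @ bs"
  define f where "f i = zs ! i" for i
  have dz: "distinct zs"
    using xs'(2,4) ys'(2,4) *(5) xs ys unfolding zs_def by auto
  have lz: "length zs = k + l - 1" using lens kl by (simp add: zs_def)
  have inj: "inj_on f (verts (rose k l))"
    unfolding verts_rose[OF kl(1,2)] f_def using dz lz by (auto simp: inj_on_def nth_eq_iff_index_eq)
  have mx: "map f [0..<k] = xs'"
    using lens kl by (intro nth_equalityI) (auto simp: xs f_def zs_def nth_Cons' nth_append)
  have my: "map f (0 # [k..<k + l - 1]) = ys'"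
  proof (rule nth_equalityI)
    show "length (map f (0 # [k..<k + l - 1])) = length ys'" using lens kl ys by simp
    fix i assume "i < length (map f (0 # [k..<k + l - 1]))"
    then show "map f (0 # [k..<k + l - 1]) ! i = ys' ! i"
      using lens kl by (cases i) (auto simp: ys f_def zs_def nth_Cons' nth_append)
  qed
  have "G = graph_union (cycle_of (map f [0..<k])) (cycle_of (map f (0 # [k..<k + l - 1])))"
    using mx my *(6) xs'(1) ys'(1) by simp
  also have "\<dots> = (f ` verts (rose k l), (`) f ` edges (rose k l))"
    unfolding cycle_of_map rose_def graph_union_def by (auto simp: cycle_of_def)
  finally have "G = (f ` verts (rose k l), (`) f ` edges (rose k l))" .
  moreover have "e \<subseteq> verts (rose k l)" if "e \<in> edges (rose k l)" for e
    using simple_graph_rose[OF kl(1,2)] that by (simp add: simple_graph_def)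
  ultimately have "graph_iso (rose k l) G" using graph_iso_image[OF inj] by simp
  then show thesis using that[OF kl(1,3)] graph_iso_sym by blast
qed

text \<open>A longest path from \<open>v\<close> can only be blocked by running back into \<open>v\<close>,
  since all its inner vertices already have both of their neighbours on it.\<close>

lemma cycle_through_vertex:
  assumes H: "simple_graph H" and W: "W \<subseteq> verts H" "v \<in> W"
    and deg2: "\<And>u. u \<in> W \<Longrightarrow> u \<noteq> v \<Longrightarrow> deg H u = 2 \<and> nbrs H u \<subseteq> W"
    and a: "a \<in> nbrs H v" "a \<in> W"
  obtains xs where "distinct xs" "length xs \<ge> 3" "set xs \<subseteq> W" "v \<in> set xs"
    "edges (cycle_of xs) \<subseteq> edges H"
proof -
  define P where "P xs \<longleftrightarrow> distinct xs \<and> set xs \<subseteq> W \<and> xs \<noteq> [] \<and> xs ! 0 = v \<and>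
     (\<forall>i. Suc i < length xs \<longrightarrow> xs ! Suc i \<in> nbrs H (xs ! i))" for xs
  have fin: "finite W" using H W finite_subset by (auto simp: simple_graph_def)
  have bound: "length xs < Suc (card W)" if "P xs" for xs
    using that card_mono[OF fin, of "set xs"] distinct_card[of xs] unfolding P_def by simp
  have "a \<noteq> v" using simple_graph_nbrs(5)[OF H a(1)] .
  then have "P [v, a]" using a W unfolding P_def by (auto simp: less_Suc_eq)
  then obtain xs where xs: "P xs" "\<And>ys. P ys \<Longrightarrow> length ys \<le> length xs"
    using ex_has_greatest_nat[of P "[v, a]" length "Suc (card W)"] bound by (metis less_imp_le)
  have d: "distinct xs" and sub: "set xs \<subseteq> W" and ne: "xs \<noteq> []" and hd: "xs ! 0 = v"
    and path: "\<And>i. Suc i < length xs \<Longrightarrow> xs ! Suc i \<in> nbrs H (xs ! i)"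
    using xs(1) unfolding P_def by auto
  have eq: "xs ! i = xs ! j \<longleftrightarrow> i = j" if "i < length xs" "j < length xs" for i j
    using that d nth_eq_iff_index_eq by blast
  define L where "L = length xs"
  have L2: "L \<ge> 2" using xs(2)[OF \<open>P [v, a]\<close>] by (simp add: L_def)
  define z where "z = xs ! (L - 1)"
  have "z \<in> set xs" unfolding z_def using L2 by (intro nth_mem) (simp add: L_def)
  then have zW: "z \<in> W" using sub by blast
  have zv: "z \<noteq> v" unfolding z_def hd[symmetric] using L2 ne eq[of "L - 1" 0] by (auto simp: L_def)
  have pred: "xs ! (L - 2) \<in> nbrs H z"
  proof -
    have "Suc (L - 2) = L - 1" "L - 1 < length xs" using L2 by (auto simp: L_def)
    then show ?thesis using path[of "L - 2"] nbrs_sym unfolding z_def by metis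
  qed
  obtain y where y: "y \<in> nbrs H z" "y \<noteq> xs ! (L - 2)"
  proof -
    have "card (nbrs H z) = 2" using deg2[OF zW zv] by (simp add: deg_def)
    then show thesis using that pred by (auto simp: card_2_iff)
  qed
  have yW: "y \<in> W" using y deg2[OF zW zv] by blast
  have "y \<in> set xs"
  proof (rule ccontr)
    assume yn: "y \<notin> set xs"
    have "P (xs @ [y])"
      unfolding P_def
    proof (intro conjI allI impI)
      fix i assume i: "Suc i < length (xs @ [y])"
      show "(xs @ [y]) ! Suc i \<in> nbrs H ((xs @ [y]) ! i)"
      proof (cases "Suc i < length xs")
        case True
        then show ?thesis using path by (simp add: nth_append)
      next
        case False
        then have "i = L - 1" "i < length xs" "Suc i = length xs" using i by (auto simp: L_def)
        then show ?thesis using y(1) by (simp add: nth_append z_def)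
      qed
    qed (use d yn sub yW ne hd in \<open>auto simp: nth_append\<close>)
    then show False using xs(2) by fastforce
  qed
  then obtain i where i: "i < L" "xs ! i = y" by (auto simp: in_set_conv_nth L_def)
  have "i \<noteq> L - 1" using y(1) i simple_graph_nbrs(3)[OF H] by (auto simp: z_def)
  moreover have "i \<noteq> L - 2" using y(2) i by auto
  \<comment> \<open>The chord from \<open>z\<close> back to \<open>y\<close> skips at least one
    vertex. This separates the three neighbours of \<open>y\<close> below and, once
    \<open>i = 0\<close>, gives the cycle length at least 3.\<close>
  ultimately have iL: "i + 2 < L" using i by auto
  have "i = 0"
  proof (rule ccontr)
    assume i0: "i \<noteq> 0"
    have "y \<noteq> v" using i i0 ne eq[of i 0] iL hd by (auto simp: L_def)
    then have "deg H y = 2" using deg2[OF yW] by blast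
    moreover have "xs ! (i - 1) \<in> nbrs H y" 
      using path[of "i - 1"] i i0 nbrs_sym[of "xs ! (i - 1)" H y] by (simp add: L_def)
    moreover have "xs ! Suc i \<in> nbrs H y" using path[of i] i iL by (simp add: L_def)
    moreover have "z \<in> nbrs H y" using y(1) nbrs_sym by metis
    moreover have "card {xs ! (i - 1), xs ! Suc i, z} = 3"
    proof -
      have "xs ! (i - 1) \<noteq> xs ! Suc i" "xs ! (i - 1) \<noteq> z" "xs ! Suc i \<noteq> z"
        unfolding z_def using eq[of "i - 1" "Suc i"] eq[of "i - 1" "L - 1"] eq[of "Suc i" "L - 1"] iL
        by (auto simp: L_def)
      then show ?thesis by simp
    qed
    ultimately show False
      using card_mono[of "nbrs H y" "{xs ! (i - 1), xs ! Suc i, z}"] simple_graph_nbrs(2)[OF H, of y]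
      by (simp add: deg_def)
  qed
  then have "z \<in> nbrs H v" using y(1) i hd nbrs_sym by metis
  have "edges (cycle_of xs) \<subseteq> edges H"
  proof
    fix e assume "e \<in> edges (cycle_of xs)"
    then consider j where "Suc j < length xs" "e = {xs ! j, xs ! Suc j}" | "e = {z, v}"
      unfolding edges_cycle_of[OF ne] z_def L_def hd by blast
    then show "e \<in> edges H"
    proof cases
      case (1 j)
      then show ?thesis using path[of j] by (simp add: nbrs_def)
    next
      case 2
      then show ?thesis using \<open>z \<in> nbrs H v\<close> by (simp add: nbrs_def insert_commute)
    qed
  qed
  moreover have "v \<in> set xs" using hd ne by (metis length_greater_0_conv nth_mem)
  moreover have "length xs \<ge> 3" using iL by (simp add: L_def)
  ultimately show thesis using that d sub by blast
qed

text \<open>The cycle lemma is applied to the whole graph and again to what remains when the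
  resulting cycle is removed except for \<open>v\<close>. The two cycles use all four edges at
  \<open>v\<close> and both edges at each of their other vertices, so no edge leaves their union and
  connectedness makes it the whole graph.\<close>

lemma two_rose_of_degrees:
  assumes H: "simple_graph H" and conn: "graph_connected H" and v: "v \<in> verts H" "deg H v = 4"
    and deg2: "\<And>u. u \<in> verts H \<Longrightarrow> u \<noteq> v \<Longrightarrow> deg H u = 2"
  shows "two_rose H"
proof -
  note nb = simple_graph_nbrs[OF H]
  have cyc_sub: "nbrs (cycle_of xs) u \<subseteq> nbrs H u" if "edges (cycle_of xs) \<subseteq> edges H" for xs u
    using that by (auto simp: nbrs_def)
  have cyc_eq: "nbrs H u = nbrs (cycle_of xs) u"
    if "edges (cycle_of xs) \<subseteq> edges H" "distinct xs" "length xs \<ge> 3" "u \<in> set xs" "u \<noteq> v" "set xs \<subseteq> verts H" for xs u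
    using nbrs_eqI[OF H cyc_sub[OF that(1)], of u] deg2[of u] deg_cycle_of(1)[OF that(2,3,4)] that
    by (auto simp: deg_def)
  have "nbrs H v \<noteq> {}" using v by (auto simp: deg_def)
  then obtain a where a: "a \<in> nbrs H v" by blast
  obtain xs where xs: "distinct xs" "length xs \<ge> 3" "set xs \<subseteq> verts H" "v \<in> set xs" "edges (cycle_of xs) \<subseteq> edges H"
    using cycle_through_vertex[OF H order_refl v(1) _ a] deg2 nb(1) a by blast
  note eqx = cyc_eq[OF xs(5,1,2) _ _ xs(3)]
  \<comment> \<open>Each removed vertex has both neighbours on the cycle, so an edge from a removed
    vertex into \<open>W\<close> can only end in \<open>v\<close>.\<close>
  define W where "W = verts H - (set xs - {v})"
  have "\<exists>b. b \<in> nbrs H v \<and> b \<notin> set xs"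
  proof (rule ccontr)
    assume "\<not> ?thesis"
    then have sub: "nbrs H v \<subseteq> set xs" by blast
    \<comment> \<open>A vertex of the cycle other than \<open>v\<close> has only its cycle
      neighbours. If it is adjacent to \<open>v\<close>, the joining edge is therefore a cycle edge,
      and the cycle has just two of those at \<open>v\<close>.\<close>
    have "nbrs H v \<subseteq> nbrs (cycle_of xs) v"
    proof
      fix w assume w: "w \<in> nbrs H v"
      then have "w \<in> set xs" "w \<noteq> v" using sub nb(3) by auto
      then have "v \<in> nbrs (cycle_of xs) w" using eqx[of w] w nbrs_sym[of w H v] by simp
      then show "w \<in> nbrs (cycle_of xs) v" using nbrs_sym[of v "cycle_of xs" w] by simp
    qed
    moreover have "finite (nbrs (cycle_of xs) v)"
      using deg_cycle_of(1)[OF xs(1,2,4)] card.infinite by (fastforce simp: deg_def)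
    ultimately have "card (nbrs H v) \<le> card (nbrs (cycle_of xs) v)" by (intro card_mono)
    then show False using v(2) deg_cycle_of(1)[OF xs(1,2,4)] by (simp add: deg_def)
  qed
  then obtain b where b: "b \<in> nbrs H v" "b \<notin> set xs" by blast
  have W: "W \<subseteq> verts H" "v \<in> W" "b \<in> W" using v b nb(1) by (auto simp: W_def)
  have "nbrs H u \<subseteq> W" if u: "u \<in> W" "u \<noteq> v" for u
  proof
    fix w assume w: "w \<in> nbrs H u"
    show "w \<in> W"
    proof (rule ccontr)
      assume "w \<notin> W"
      then have "w \<in> set xs" "w \<noteq> v" using w nb(1) by (auto simp: W_def)
      then have "u \<in> set xs" using eqx[of w] w nbrs_sym[of w H u] deg_cycle_of(2)[OF xs(1,2)] by blast
      then show False using u by (auto simp: W_def)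
    qed
  qed
  then obtain ys where ys: "distinct ys" "length ys \<ge> 3" "set ys \<subseteq> W" "v \<in> set ys" "edges (cycle_of ys) \<subseteq> edges H"
    using cycle_through_vertex[OF H W(1,2) _ b(1) W(3)] deg2 W(1) by blast
  have ysV: "set ys \<subseteq> verts H" using ys W by blast
  note eqy = cyc_eq[OF ys(5,1,2) _ _ ysV]
  have int: "set xs \<inter> set ys = {v}" using xs(4) ys(3,4) by (auto simp: W_def)
  let ?Nx = "nbrs (cycle_of xs) v" and ?Ny = "nbrs (cycle_of ys) v"
  have disj: "?Nx \<inter> ?Ny = {}"
  proof (rule equals0I)
    fix w assume w: "w \<in> ?Nx \<inter> ?Ny"
    then have "w \<in> set xs \<inter> set ys"
      using deg_cycle_of(2)[OF xs(1,2,4)] deg_cycle_of(2)[OF ys(1,2,4)] by blast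
    then have "w = v" using int by simp
    then show False using w deg_cycle_of(3)[OF xs(1,2,4)] by simp
  qed
  have finN: "finite ?Nx" "finite ?Ny"
    using finite_subset[OF cyc_sub[OF xs(5)] nb(2)] finite_subset[OF cyc_sub[OF ys(5)] nb(2)] by auto
  have "card (?Nx \<union> ?Ny) = 4"
    using card_Un_disjoint[OF finN disj] deg_cycle_of(1)[OF xs(1,2,4)] deg_cycle_of(1)[OF ys(1,2,4)]
    by (simp add: deg_def)
  then have eqv: "nbrs H v = ?Nx \<union> ?Ny"
    using nbrs_eqI[OF H, of "?Nx \<union> ?Ny" v] cyc_sub[OF xs(5), of v] cyc_sub[OF ys(5), of v] v(2) by simp
  have nbH: "nbrs H u \<subseteq> {w. {u, w} \<in> edges (cycle_of xs) \<union> edges (cycle_of ys)} \<and> nbrs H u \<subseteq> set xs \<union> set ys"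
    if u: "u \<in> set xs \<union> set ys" for u
  proof -
    have "nbrs H u \<subseteq> nbrs (cycle_of xs) u \<union> nbrs (cycle_of ys) u"
      using u eqx[of u] eqy[of u] eqv by (cases "u = v") auto
    moreover have "nbrs (cycle_of xs) u \<subseteq> set xs" "nbrs (cycle_of ys) u \<subseteq> set ys"
      using simple_graph_nbrs(1)[OF simple_graph_cycle_of[OF xs(1,2)], of u]
        simple_graph_nbrs(1)[OF simple_graph_cycle_of[OF ys(1,2)], of u] by (auto simp: cycle_of_def)
    ultimately show ?thesis by (auto simp: nbrs_def)
  qed
  have V: "set xs \<union> set ys = verts H"
  proof (rule graph_connectedD[OF conn])
    show "set xs \<union> set ys \<subseteq> verts H" using xs(3) ysV by blast
    show "set xs \<union> set ys \<noteq> {}" using xs(4) by auto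
    show "nbrs H u \<subseteq> set xs \<union> set ys" if "u \<in> set xs \<union> set ys" for u using nbH[OF that] by blast
  qed
  have "edges H \<subseteq> edges (cycle_of xs) \<union> edges (cycle_of ys)"
  proof
    fix e assume "e \<in> edges H"
    then obtain u w where "e = {u, w}" "u \<in> verts H" "w \<in> nbrs H u" using simple_graph_edgeE[OF H] by metis
    then show "e \<in> edges (cycle_of xs) \<union> edges (cycle_of ys)" using nbH[of u] V by blast
  qed
  then have "edges H = edges (cycle_of xs) \<union> edges (cycle_of ys)" using xs(5) ys(5) by blast
  then have "H = graph_union (cycle_of xs) (cycle_of ys)"
    using V by (simp add: graph_union_def prod_eq_iff cycle_of_def)
  then show ?thesis unfolding two_rose_def using xs(1,2) ys(1,2) int by blast
qed

section \<open>Degree sequences of cospectral graphs\<close>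

lemma graph_connected_deg_pos:
  assumes H: "simple_graph H" and conn: "graph_connected H" and n: "card (verts H) \<ge> 2" and u: "u \<in> verts H"
  shows "deg H u \<ge> 1"
proof (rule ccontr)
  assume "\<not> deg H u \<ge> 1"
  then have "nbrs H u = {}" using simple_graph_nbrs(2)[OF H, of u] by (auto simp: deg_def not_less_eq_eq)
  then have "{u} = verts H" using graph_connectedD[OF conn, of "{u}"] u by simp
  from arg_cong[OF this, of card] show False using n by simp
qed

text \<open>A value of at least 2 uses up the whole square sum, so all the others vanish. Otherwise
  only -1, 0, 1 occur, and the numbers of 1s and of -1s have difference 2 and sum 4.\<close>

lemma deviation_cases:
  fixes x :: "'a \<Rightarrow> int"
  assumes fin: "finite V" and s1: "(\<Sum>u\<in>V. x u) = 2" and s2: "(\<Sum>u\<in>V. (x u)\<^sup>2) = 4"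
    and ge: "\<And>u. u \<in> V \<Longrightarrow> x u \<ge> - 1"
  obtains v where "v \<in> V" "x v = 2" "\<And>u. u \<in> V \<Longrightarrow> u \<noteq> v \<Longrightarrow> x u = 0"
  | a b c p where "distinct [a, b, c, p]" "{a, b, c, p} \<subseteq> V" "x a = 1" "x b = 1" "x c = 1" "x p = - 1"
    "\<And>u. u \<in> V - {a, b, c, p} \<Longrightarrow> x u = 0"
proof (cases "\<exists>v\<in>V. x v \<ge> 2")
  case True
  then obtain v where v: "v \<in> V" "x v \<ge> 2" by blast
  have sq: "(x v)\<^sup>2 + (\<Sum>u\<in>V - {v}. (x u)\<^sup>2) = 4" using sum.remove[OF fin v(1), of "\<lambda>u. (x u)\<^sup>2"] s2 by simp
  have "(x v)\<^sup>2 \<ge> 4" using v(2) power_mono[of 2 "x v" 2] by simp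
  moreover have nn: "(\<Sum>u\<in>V - {v}. (x u)\<^sup>2) \<ge> 0" by (intro sum_nonneg) simp
  ultimately have 0: "(\<Sum>u\<in>V - {v}. (x u)\<^sup>2) = 0" using sq by linarith
  then have z: "x u = 0" if "u \<in> V" "u \<noteq> v" for u
    using that fin sum_nonneg_eq_0_iff[of "V - {v}" "\<lambda>u. (x u)\<^sup>2"] by simp
  have "x v + (\<Sum>u\<in>V - {v}. x u) = 2" using sum.remove[OF fin v(1), of x] s1 by simp
  moreover have "(\<Sum>u\<in>V - {v}. x u) = 0" using z by (intro sum.neutral) auto
  ultimately have "x v = 2" by simp
  then show thesis using that(1) v(1) z by blast
next
  case False
  have rng: "x u \<in> {-1, 0, 1}" if "u \<in> V" for u
    using False ge[OF that] that by force
  define P where "P = {u \<in> V. x u = 1}"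
  define Q where "Q = {u \<in> V. x u = - 1}"
  have fPQ: "finite P" "finite Q" using fin by (auto simp: P_def Q_def)
  have "(\<Sum>u\<in>V. x u) = (\<Sum>u\<in>V. (if u \<in> P then 1 else 0) - (if u \<in> Q then 1 else 0))"
    using rng by (intro sum.cong) (auto simp: P_def Q_def)
  also have "\<dots> = int (card P) - int (card Q)"
  proof -
    have "V \<inter> P = P" "V \<inter> Q = Q" by (auto simp: P_def Q_def)
    then show ?thesis using fin by (simp add: sum_subtractf sum.If_cases)
  qed
  finally have 1: "int (card P) - int (card Q) = 2" using s1 by simp
  have "(\<Sum>u\<in>V. (x u)\<^sup>2) = (\<Sum>u\<in>V. (if u \<in> P then 1 else 0) + (if u \<in> Q then 1 else 0))"
    using rng by (intro sum.cong) (auto simp: P_def Q_def)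
  also have "\<dots> = int (card P) + int (card Q)"
  proof -
    have "V \<inter> P = P" "V \<inter> Q = Q" by (auto simp: P_def Q_def)
    then show ?thesis using fin by (simp add: sum.distrib sum.If_cases)
  qed
  finally have "card P = 3" "card Q = 1" using s2 1 by linarith+
  then obtain a b c p where abc: "P = {a, b, c}" "a \<noteq> b" "a \<noteq> c" "b \<noteq> c" and p: "Q = {p}"
    by (auto simp: card_3_iff card_1_singleton_iff)
  have 3: "a \<in> P" "b \<in> P" "c \<in> P" "p \<in> Q" using abc p by auto
  show thesis
  proof (rule that(2)[of a b c p])
    show "distinct [a, b, c, p]" using abc(2-4) 3 by (auto simp: P_def Q_def)
    show "{a, b, c, p} \<subseteq> V" "x a = 1" "x b = 1" "x c = 1" "x p = - 1" using 3 by (auto simp: P_def Q_def)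
    fix u assume "u \<in> V - {a, b, c, p}"
    then have "u \<in> V" "u \<notin> P" "u \<notin> Q" using abc p by auto
    then show "x u = 0" using rng[of u] by (auto simp: P_def Q_def)
  qed
qed

definition mate_degrees :: "'a ugraph \<Rightarrow> 'a \<Rightarrow> 'a \<Rightarrow> 'a \<Rightarrow> 'a \<Rightarrow> bool" where
  "mate_degrees H a b c p \<longleftrightarrow> distinct [a, b, c, p] \<and> {a, b, c, p} \<subseteq> verts H \<and>
     deg H a = 3 \<and> deg H b = 3 \<and> deg H c = 3 \<and> deg H p = 1 \<and> (\<forall>u\<in>verts H - {a, b, c, p}. deg H u = 2)"

lemma cospectral_rose_degrees:
  assumes kl: "k \<ge> 3" "l \<ge> 3" and H: "simple_graph H"
    and spec: "laplacian_spectrum H = laplacian_spectrum (rose k l)"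
  obtains v where "v \<in> verts H" "deg H v = 4" "\<And>u. u \<in> verts H \<Longrightarrow> u \<noteq> v \<Longrightarrow> deg H u = 2"
  | a b c p where "mate_degrees H a b c p"
proof -
  note R = simple_graph_rose[OF kl]
  note tr = cospectral_traces[OF H R spec]
  have n: "card (verts H) = k + l - 1" using tr(1) kl by (simp add: verts_rose)
  have fin: "finite (verts H)" using H by (simp add: simple_graph_def)
  let ?x = "\<lambda>u. int (deg H u) - 2"
  have t1: "(\<Sum>u\<in>verts H. int (deg H u)) = 4 + (int k + int l - 2) * 2"
    using tr(2) trace_lap[OF H] trace_lap[OF R] sum_deg_rose[OF kl, of "\<lambda>d. d"] by simp
  have "(\<Sum>u\<in>verts H. int (deg H u) ^ 2 + int (deg H u)) = 20 + (int k + int l - 2) * 6"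
    using tr(3) trace_lap_square[OF H] trace_lap_square[OF R] sum_deg_rose[OF kl, of "\<lambda>d. d ^ 2 + d"] by simp
  then have t2: "(\<Sum>u\<in>verts H. int (deg H u) ^ 2) = 16 + (int k + int l - 2) * 4"
    using t1 by (simp add: sum.distrib)
  have cn: "int (card (verts H)) = int k + int l - 1" using n kl by linarith
  have s1: "(\<Sum>u\<in>verts H. ?x u) = 2" using t1 cn by (simp add: sum_subtractf)
  have "(\<Sum>u\<in>verts H. (?x u)\<^sup>2) = (\<Sum>u\<in>verts H. int (deg H u) ^ 2 - 4 * int (deg H u) + 4)"
    by (intro sum.cong) (auto simp: power2_eq_square algebra_simps)
  then have s2: "(\<Sum>u\<in>verts H. (?x u)\<^sup>2) = 4"
    using t1 t2 cn by (simp add: sum_subtractf sum.distrib sum_distrib_left[symmetric])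
  have ge: "?x u \<ge> - 1" if "u \<in> verts H" for u
    using graph_connected_deg_pos[OF H cospectral_rose_connected[OF kl H spec] _ that] n kl by simp
  show thesis
  proof (rule deviation_cases[OF fin s1 s2 ge])
    fix v assume v: "v \<in> verts H" "?x v = 2" "\<And>u. u \<in> verts H \<Longrightarrow> u \<noteq> v \<Longrightarrow> ?x u = 0"
    show thesis
    proof (rule that(1)[of v])
      show "v \<in> verts H" "deg H v = 4" using v(1,2) by auto
      show "deg H u = 2" if "u \<in> verts H" "u \<noteq> v" for u using v(3)[OF that] by simp
    qed
  next
    fix a b c p assume *: "distinct [a, b, c, p]" "{a, b, c, p} \<subseteq> verts H" "?x a = 1" "?x b = 1" "?x c = 1"
      "?x p = - 1" and **: "\<And>u. u \<in> verts H - {a, b, c, p} \<Longrightarrow> ?x u = 0"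
    have "deg H u = 2" if "u \<in> verts H - {a, b, c, p}" for u using **[OF that] by simp
    then have "mate_degrees H a b c p" using * unfolding mate_degrees_def by auto
    then show thesis by (rule that(2))
  qed
qed

lemma sum_mate:
  fixes g :: "'a \<Rightarrow> int"
  assumes H: "simple_graph H" and m: "mate_degrees H a b c p"
  shows "(\<Sum>u\<in>verts H. g u) = g a + g b + g c + g p + (\<Sum>u\<in>verts H - {a, b, c, p}. g u)"
    and "int (card (verts H - {a, b, c, p})) = int (card (verts H)) - 4"
proof -
  have fin: "finite (verts H)" using H by (simp add: simple_graph_def)
  have d: "distinct [a, b, c, p]" and sub: "{a, b, c, p} \<subseteq> verts H" using m by (auto simp: mate_degrees_def)
  have "(\<Sum>u\<in>verts H. g u) = (\<Sum>u\<in>verts H - {a, b, c, p}. g u) + (\<Sum>u\<in>{a, b, c, p}. g u)"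
    by (rule sum.subset_diff[OF sub fin])
  then show "(\<Sum>u\<in>verts H. g u) = g a + g b + g c + g p + (\<Sum>u\<in>verts H - {a, b, c, p}. g u)"
    using d by simp
  have "card {a, b, c, p} = 4" using d by simp
  moreover have "card {a, b, c, p} \<le> card (verts H)" using card_mono[OF fin sub] .
  ultimately show "int (card (verts H - {a, b, c, p})) = int (card (verts H)) - 4"
    using card_Diff_subset[of "{a, b, c, p}" "verts H"] sub by (simp add: of_nat_diff)
qed

lemma sum_deg_mate:
  assumes H: "simple_graph H" and m: "mate_degrees H a b c p"
  shows "(\<Sum>u\<in>verts H. f (int (deg H u)) :: int) = 3 * f 3 + f 1 + (int (card (verts H)) - 4) * f 2"
proof -
  have "(\<Sum>u\<in>verts H - {a, b, c, p}. f (int (deg H u))) = (\<Sum>u\<in>verts H - {a, b, c, p}. f 2)"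
    using m by (intro sum.cong) (auto simp: mate_degrees_def)
  then show ?thesis
    using sum_mate(1)[OF H m, of "\<lambda>u. f (int (deg H u))"] sum_mate(2)[OF H m] m by (simp add: mate_degrees_def)
qed

text \<open>The degree term \<open>d^3 + 3 d^2\<close> of the third trace is 4, 20, 54, 112 at d =
  1, 2, 3, 4. The two degree sums therefore differ by (112 + 3 * 20) - (3 * 54 + 4) = 6, the number
  of ordered triples of one triangle.\<close>

lemma mate_card_triangles:
  assumes kl: "k \<ge> 3" "l \<ge> 3" and H: "simple_graph H"
    and spec: "laplacian_spectrum H = laplacian_spectrum (rose k l)"
    and m: "mate_degrees H a b c p"
  shows "card (triangles (rose k l)) = card (triangles H) + 6"
proof -
  note R = simple_graph_rose[OF kl]
  note tr = cospectral_traces[OF H R spec]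
  have cn: "int (card (verts H)) = int k + int l - 1" using tr(1) kl by (simp add: verts_rose of_nat_diff)
  have "(\<Sum>u\<in>verts H. int (deg H u) ^ 3 + 3 * int (deg H u) ^ 2) - int (card (triangles H))
     = (\<Sum>u\<in>verts (rose k l). int (deg (rose k l) u) ^ 3 + 3 * int (deg (rose k l) u) ^ 2) - int (card (triangles (rose k l)))"
    using tr(4) trace_lap_cube[OF H] trace_lap_cube[OF R] by simp
  then show ?thesis
    unfolding sum_deg_mate[OF H m, of "\<lambda>d. d ^ 3 + 3 * d ^ 2"] sum_deg_rose[OF kl, of "\<lambda>d. d ^ 3 + 3 * d ^ 2"] cn
    by (simp add: algebra_simps)
qed

text \<open>The quadratic form of the adjacency matrix at the vector of deviations
  \<open>d - 2\<close>. Every edge contributes twice, so under \<open>mate_degrees\<close> the value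
  is 2 s with the s of the overview.\<close>

definition deviation_form :: "'a ugraph \<Rightarrow> int" where
  "deviation_form G = (\<Sum>u\<in>verts G. \<Sum>w\<in>nbrs G u. (int (deg G u) - 2) * (int (deg G w) - 2))"

text \<open>The last sum of \<open>trace_lap_fourth\<close> is expanded with
  \<open>d_u + d_w = x_u + x_w + 4\<close>. All terms in a single deviation depend only on the
  degree sequence; the cross term \<open>2 x_u x_w\<close> alone sees which vertices are
  adjacent.\<close>

lemma trace_lap_fourth_deviation:
  assumes G: "simple_graph G"
  shows "(\<Sum>u\<in>verts G. \<Sum>w\<in>verts G. lap2 G u w * lap2 G w u) =
    (\<Sum>u\<in>verts G. (int (deg G u) ^ 2 + int (deg G u)) ^ 2 + int (deg G u) * (int (deg G u) - 1)
        + int (deg G u) * (2 * (int (deg G u) - 2) ^ 2 + 16 * (int (deg G u) - 2) + 16))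
    + int (card (four_cycles G))
    - 2 * (\<Sum>(u, w, z)\<in>triangles G. int (deg G u) + int (deg G w)) + 2 * deviation_form G"
proof -
  let ?d = "\<lambda>u. int (deg G u)"
  let ?x = "\<lambda>u. ?d u - 2"
  have "(\<Sum>u\<in>verts G. \<Sum>w\<in>nbrs G u. (?d u + ?d w) ^ 2)
     = (\<Sum>u\<in>verts G. \<Sum>w\<in>nbrs G u. ((?x u) ^ 2 + 8 * ?x u) + ((?x w) ^ 2 + 8 * ?x w + 16) + 2 * (?x u * ?x w))"
    by (intro sum.cong refl) (auto simp: power2_eq_square algebra_simps)
  also have "\<dots> = (\<Sum>u\<in>verts G. ?d u * ((?x u) ^ 2 + 8 * ?x u))
      + (\<Sum>u\<in>verts G. \<Sum>w\<in>nbrs G u. (?x w) ^ 2 + 8 * ?x w + 16) + 2 * deviation_form G"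
    unfolding deviation_form_def sum.distrib[of "\<lambda>w. _ w + _ w"] sum_distrib_left
    by (simp add: sum.distrib deg_def sum_distrib_left)
  also have "(\<Sum>u\<in>verts G. \<Sum>w\<in>nbrs G u. (?x w) ^ 2 + 8 * ?x w + 16) = (\<Sum>w\<in>verts G. ?d w * ((?x w) ^ 2 + 8 * ?x w + 16))"
    by (rule sum_nbrs_swap[OF G])
  also have "(\<Sum>u\<in>verts G. ?d u * ((?x u) ^ 2 + 8 * ?x u)) + (\<Sum>w\<in>verts G. ?d w * ((?x w) ^ 2 + 8 * ?x w + 16))
     = (\<Sum>u\<in>verts G. ?d u * (2 * (?x u) ^ 2 + 16 * ?x u + 16))"
    unfolding sum.distrib[symmetric] by (intro sum.cong refl) (simp add: algebra_simps)
  finally show ?thesis unfolding trace_lap_fourth[OF G] by (simp add: sum.distrib)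
qed

lemma mate_four_cycles:
  assumes l: "l \<ge> 4" and H: "simple_graph H"
    and spec: "laplacian_spectrum H = laplacian_spectrum (rose 3 l)"
    and m: "mate_degrees H a b c p"
  shows "triangles H = {}"
    and "int (card (four_cycles H)) + 2 * deviation_form H = int (card (four_cycles (rose 3 l))) + 20"
proof -
  have kl: "3 \<ge> (3::nat)" "l \<ge> 3" using l by auto
  note R = simple_graph_rose[OF kl]
  note tr = cospectral_traces[OF H R spec]
  have cn: "int (card (verts H)) = int l + 2" using tr(1) kl by (simp add: verts_rose of_nat_diff)
  have "card (triangles (rose 3 l)) = 6" by (simp add: triangles_rose_3[OF l])
  then show T: "triangles H = {}"
    using mate_card_triangles[OF kl H spec m] finite_triangles[OF H] by simp
  have "deg (rose 3 l) 0 = 4" "deg (rose 3 l) 1 = 2" "deg (rose 3 l) 2 = 2"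
    using deg_rose[OF kl] l by auto
  \<comment> \<open>Four of the six triples begin with an edge at the centre, of degree sum 4 + 2,
    and two with the opposite edge, of degree sum 2 + 2.\<close>
  then have TR: "(\<Sum>(u, w, z)\<in>triangles (rose 3 l). int (deg (rose 3 l) u) + int (deg (rose 3 l) w)) = 32"
    unfolding triangles_rose_3[OF l] by simp
  have S: "deviation_form (rose 3 l) = 0"
    unfolding deviation_form_def
  proof (intro sum.neutral ballI)
    fix u w assume u: "u \<in> verts (rose 3 l)" and w: "w \<in> nbrs (rose 3 l) u"
    then have "w \<in> verts (rose 3 l)" "w \<noteq> u" using simple_graph_nbrs(1,5)[OF R] by blast+
    then have "deg (rose 3 l) u = 2 \<or> deg (rose 3 l) w = 2"
      using u deg_rose(2)[OF kl, of u] deg_rose(2)[OF kl, of w] by (cases "u = 0") (auto simp: verts_rose[OF kl])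
    then show "(int (deg (rose 3 l) u) - 2) * (int (deg (rose 3 l) w) - 2) = 0" by auto
  qed
  \<comment> \<open>\<open>?F\<close> takes the values 6, 70, 252, 636 at 1, 2, 3, 4. The degree
    terms thus leave (636 + 3 * 70) - (3 * 252 + 6) = 84, and subtracting 64 for the triangle of the
    rose gives the constant 20.\<close>
  let ?F = "\<lambda>d::int. (d ^ 2 + d) ^ 2 + d * (d - 1) + d * (2 * (d - 2) ^ 2 + 16 * (d - 2) + 16)"
  have "(\<Sum>u\<in>verts H. ?F (int (deg H u))) + int (card (four_cycles H)) + 2 * deviation_form H
     = (\<Sum>u\<in>verts (rose 3 l). ?F (int (deg (rose 3 l) u))) + int (card (four_cycles (rose 3 l))) - 64"
    using tr(5) trace_lap_fourth_deviation[OF H] trace_lap_fourth_deviation[OF R] T TR S by simp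
  then show "int (card (four_cycles H)) + 2 * deviation_form H = int (card (four_cycles (rose 3 l))) + 20"
    unfolding sum_deg_mate[OF H m, of ?F] sum_deg_rose[OF kl, of ?F] cn by (simp add: algebra_simps)
qed

lemma deviation_form_mate:
  assumes H: "simple_graph H" and m: "mate_degrees H a b c p"
  shows "deviation_form H = 2 * ((if b \<in> nbrs H a then 1 else 0) + (if c \<in> nbrs H b then 1 else 0)
     + (if a \<in> nbrs H c then 1 else 0) - (if p \<in> nbrs H a then 1 else 0) - (if p \<in> nbrs H b then 1 else 0)
     - (if p \<in> nbrs H c then 1 else 0))"
proof -
  let ?x = "\<lambda>u. int (deg H u) - 2" and ?e = "\<lambda>u w. if w \<in> nbrs H u then 1 else 0 :: int"
  have x: "?x a = 1" "?x b = 1" "?x c = 1" "?x p = - 1" "\<And>u. u \<in> verts H - {a, b, c, p} \<Longrightarrow> ?x u = 0"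
    using m by (auto simp: mate_degrees_def)
  have sx: "(\<Sum>u\<in>verts H. ?x u * g u) = g a + g b + g c - g p" for g
    using sum_mate(1)[OF H m, of "\<lambda>u. ?x u * g u"] x by simp
  have in_sum: "(\<Sum>w\<in>nbrs H u. ?x u * ?x w) = ?x u * (?e u a + ?e u b + ?e u c - ?e u p)" for u
  proof -
    have "(\<Sum>w\<in>nbrs H u. ?x u * ?x w) = (\<Sum>w\<in>verts H. if w \<in> nbrs H u then ?x u * ?x w else 0)"
      by (rule sum_nbrs[OF H, symmetric])
    also have "\<dots> = (\<Sum>w\<in>verts H. ?x w * (?x u * ?e u w))" by (intro sum.cong) auto
    finally show ?thesis unfolding sx by (simp add: algebra_simps)
  qed
  have irr: "?e u u = 0" for u using simple_graph_nbrs(3)[OF H] by simp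
  have sy: "?e u w = ?e w u" for u w using nbrs_sym by metis
  have "deviation_form H = (?e a a + ?e a b + ?e a c - ?e a p) + (?e b a + ?e b b + ?e b c - ?e b p)
    + (?e c a + ?e c b + ?e c c - ?e c p) - (?e p a + ?e p b + ?e p c - ?e p p)"
    unfolding deviation_form_def in_sum sx ..
  then show ?thesis using irr sy[of a b] sy[of a c] sy[of b c] sy[of a p] sy[of b p] sy[of c p] by simp
qed

section \<open>Harmonic functions modulo 3\<close>

text \<open>The field with three elements given by its tables; every nonzero element is its own
  inverse. The field instance turns a vanishing determinant into a kernel vector, and identities in
  a few variables are settled by cases.\<close>

datatype gf3 = G0 | G1 | G2

instantiation gf3 :: field
begin
fun plus_gf3 :: "gf3 \<Rightarrow> gf3 \<Rightarrow> gf3" where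
  "G0 + y = y" | "x + G0 = x" | "G1 + G1 = G2" | "G1 + G2 = G0" | "G2 + G1 = G0" | "G2 + G2 = G1"
fun times_gf3 :: "gf3 \<Rightarrow> gf3 \<Rightarrow> gf3" where
  "G0 * y = G0" | "x * G0 = G0" | "G1 * y = y" | "x * G1 = x" | "G2 * G2 = G1"
fun uminus_gf3 :: "gf3 \<Rightarrow> gf3" where
  "- G0 = G0" | "- G1 = G2" | "- G2 = G1"
definition minus_gf3 :: "gf3 \<Rightarrow> gf3 \<Rightarrow> gf3" where "x - y = x + (- y :: gf3)"
definition inverse_gf3 :: "gf3 \<Rightarrow> gf3" where "inverse x = (x :: gf3)"
definition divide_gf3 :: "gf3 \<Rightarrow> gf3 \<Rightarrow> gf3" where "divide_gf3 x y = x * y"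
definition zero_gf3 :: gf3 where "0 = G0"
definition one_gf3 :: gf3 where "1 = G1"
instance
proof
  fix x y z :: gf3
  show "x + y + z = x + (y + z)" "x * y * z = x * (y * z)" "(x + y) * z = x * z + y * z"
    by (cases x; cases y; cases z; simp)+
  show "x + y = y + x" "x * y = y * x" by (cases x; cases y; simp)+
  show "0 + x = x" "- x + x = 0" "1 * x = x" "x \<noteq> 0 \<Longrightarrow> inverse x * x = 1"
    by (cases x; simp add: zero_gf3_def one_gf3_def inverse_gf3_def)+
qed (simp_all add: minus_gf3_def divide_gf3_def inverse_gf3_def zero_gf3_def one_gf3_def)
end

lemma of_int_gf3_eq_0:
  assumes "3 dvd i"
  shows "(of_int i :: gf3) = 0"
proof -
  have "(3 :: gf3) = 1 + 1 + 1" by simp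
  also have "\<dots> = 0" by (simp only: one_gf3_def zero_gf3_def plus_gf3.simps)
  finally show ?thesis using assms by (auto elim!: dvdE)
qed

text \<open>Modulo 3 the reduced matrix has a kernel vector. Extended by 0 to the deleted vertex, it
  is harmonic at every other vertex; harmonicity at \<open>v\<close> follows because the columns of
  the Laplacian sum to zero.\<close>

lemma harmonic_mod_3:
  assumes H: "simple_graph H" and vs: "distinct (v # us)" "set (v # us) = verts H"
    and 3: "3 dvd det (mat_on us (lap H) :: int mat)"
  obtains X :: "'a \<Rightarrow> gf3" where "X v = 0" "\<exists>u\<in>verts H. X u \<noteq> 0"
    "\<And>u. u \<in> verts H \<Longrightarrow> (\<Sum>w\<in>nbrs H u. X w - X u) = 0"
proof -
  note nb = simple_graph_nbrs[OF H]
  have fin: "finite (verts H)" using H by (simp add: simple_graph_def)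
  let ?A = "mat_on us (lap H) :: gf3 mat"
  have "det ?A = 0" using det_mat_on_of_int[of us "lap H", where ?'r = gf3] of_int_gf3_eq_0[OF 3] by simp
  then obtain x where x: "x \<in> carrier_vec (length us)" "x \<noteq> 0\<^sub>v (length us)" "?A *\<^sub>v x = 0\<^sub>v (length us)"
    using det_0_iff_vec_prod_zero_field[of ?A "length us"] by auto
  define X where "X u = (if u \<in> set us then x $ (the_inv_into {..<length us} ((!) us) u) else 0)" for u
  have inj: "inj_on ((!) us) {..<length us}" using vs(1) by (auto simp: inj_on_def nth_eq_iff_index_eq)
  have X: "X (us ! i) = x $ i" if "i < length us" for i
    using that the_inv_into_f_f[OF inj, of i] by (simp add: X_def)
  have Xv: "X v = 0" using vs(1) by (simp add: X_def)
  obtain i where i: "i < length us" "x $ i \<noteq> 0"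
    using x(1,2) by (metis carrier_vecD eq_vecI index_zero_vec(1) index_zero_vec(2))
  have "us ! i \<in> set (v # us)" using i by simp
  then have "us ! i \<in> verts H" by (simp only: vs(2))
  then have ex: "\<exists>u\<in>verts H. X u \<noteq> 0" using X[OF i(1)] i(2) by metis
  have lapX: "(\<Sum>w\<in>verts H. of_int (lap H u w) * X w) = - (\<Sum>w\<in>nbrs H u. X w - X u)" if u: "u \<in> verts H" for u
  proof -
    have "(\<Sum>w\<in>verts H. of_int (lap H u w) * X w)
      = (\<Sum>w\<in>verts H. (if w = u then of_nat (deg H u) * X w else 0) - (if w \<in> nbrs H u then X w else 0))"
      by (intro sum.cong) (auto simp: lap_def algebra_simps)
    also have "\<dots> = of_nat (deg H u) * X u - (\<Sum>w\<in>nbrs H u. X w)"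
      using fin u nb(1)[of u] by (simp add: sum_subtractf sum.If_cases Int_absorb1)
    also have "\<dots> = - (\<Sum>w\<in>nbrs H u. X w - X u)" by (simp add: sum_subtractf deg_def)
    finally show ?thesis .
  qed
  have harm: "(\<Sum>w\<in>nbrs H u. X w - X u) = 0" if u: "u \<in> set us" for u
  proof -
    obtain i where i: "i < length us" "us ! i = u" using u by (auto simp: in_set_conv_nth)
    have uV: "u \<in> verts H" using u unfolding vs(2)[symmetric] by simp
    have "0 = (?A *\<^sub>v x) $ i" using x(3) i by simp
    also have "\<dots> = (\<Sum>j<length us. of_int (lap H u (us ! j)) * X (us ! j))"
      using i x(1) X by (simp add: mat_on_def scalar_prod_def lessThan_atLeast0)
    also have "\<dots> = (\<Sum>w\<in>set us. of_int (lap H u w) * X w)"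
      using vs(1) sum_nth_distinct[of us "\<lambda>w. of_int (lap H u w) * X w"] by simp
    also have "\<dots> = (\<Sum>w\<in>verts H. of_int (lap H u w) * X w)"
      unfolding vs(2)[symmetric] using Xv by (intro sum.mono_neutral_left) auto
    finally show ?thesis using lapX[OF uV] by simp
  qed
  have vV: "v \<in> verts H" unfolding vs(2)[symmetric] by simp
  have "(\<Sum>u\<in>verts H. \<Sum>w\<in>verts H. of_int (lap H u w) * X w) = 0"
  proof -
    have "(\<Sum>u\<in>verts H. \<Sum>w\<in>verts H. of_int (lap H u w) * X w) = (\<Sum>w\<in>verts H. \<Sum>u\<in>verts H. of_int (lap H u w) * X w)"
      by (rule sum.swap)
    also have "\<dots> = (\<Sum>w\<in>verts H. of_int (\<Sum>u\<in>verts H. lap H u w) * X w)"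
      by (simp add: sum_distrib_right)
    also have "\<dots> = 0" using sum_lap(2)[OF H] by (intro sum.neutral) simp
    finally show ?thesis .
  qed
  then have "(\<Sum>u\<in>verts H. \<Sum>w\<in>nbrs H u. X w - X u) = 0" by (simp add: lapX sum_negf)
  moreover have "(\<Sum>u\<in>verts H. \<Sum>w\<in>nbrs H u. X w - X u)
     = (\<Sum>w\<in>nbrs H v. X w - X v) + (\<Sum>u\<in>verts H - {v}. \<Sum>w\<in>nbrs H u. X w - X u)"
    by (rule sum.remove[OF fin vV])
  moreover have "(\<Sum>u\<in>verts H - {v}. \<Sum>w\<in>nbrs H u. X w - X u) = 0"
    using harm unfolding vs(2)[symmetric] by (intro sum.neutral) auto
  ultimately have "(\<Sum>w\<in>nbrs H v. X w - X v) = 0" by simp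
  then have "(\<Sum>w\<in>nbrs H u. X w - X u) = 0" if "u \<in> verts H" for u
    using harm that unfolding vs(2)[symmetric] by auto
  then show thesis using that Xv ex by blast
qed

text \<open>When the conditions are added over \<open>S\<close>, each edge inside \<open>S\<close>
  occurs once in either direction and cancels. What remains is the net flow across the cut.\<close>

lemma cut_flow:
  fixes X :: "'a \<Rightarrow> 'r :: comm_ring_1"
  assumes H: "simple_graph H" and S: "S \<subseteq> verts H"
    and harm: "\<And>u. u \<in> S \<Longrightarrow> (\<Sum>w\<in>nbrs H u. X w - X u) = 0"
  shows "(\<Sum>u\<in>S. \<Sum>w\<in>nbrs H u - S. X w - X u) = 0"
proof -
  note nb = simple_graph_nbrs[OF H]
  have fin: "finite S" using H S finite_subset by (auto simp: simple_graph_def)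
  have split: "(\<Sum>w\<in>nbrs H u. X w - X u) = (\<Sum>w\<in>nbrs H u - S. X w - X u) + (\<Sum>w\<in>nbrs H u \<inter> S. X w - X u)" for u
    using sum.Int_Diff[OF nb(2), of "\<lambda>w. X w - X u" u S] by (simp add: add.commute)
  have ind: "(\<Sum>w\<in>nbrs H u \<inter> S. f w) = (\<Sum>w\<in>S. if w \<in> nbrs H u then f w else 0)" for u and f :: "'a \<Rightarrow> 'r"
    using fin by (simp add: sum.If_cases Int_commute)
  have "(\<Sum>u\<in>S. \<Sum>w\<in>nbrs H u \<inter> S. X w) = (\<Sum>u\<in>S. \<Sum>w\<in>S. if w \<in> nbrs H u then X w else 0)"
    by (simp add: ind)
  also have "\<dots> = (\<Sum>w\<in>S. \<Sum>u\<in>S. if u \<in> nbrs H w then X w else 0)"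
    by (subst sum.swap) (simp add: nbrs_sym)
  also have "\<dots> = (\<Sum>u\<in>S. \<Sum>w\<in>nbrs H u \<inter> S. X u)" by (simp only: ind)
  finally have "(\<Sum>u\<in>S. \<Sum>w\<in>nbrs H u \<inter> S. X w - X u) = 0" by (simp add: sum_subtractf)
  moreover have "(\<Sum>u\<in>S. \<Sum>w\<in>nbrs H u. X w - X u) = 0" using harm by (intro sum.neutral) auto
  ultimately show ?thesis by (simp add: split sum.distrib)
qed

text \<open>A vertex set is grown one crossing edge at a time. The invariant is that
  \<open>k + 1\<close> vertices span at least \<open>k\<close> edges: the crossing edge lies inside
  the larger set but not inside the old one.\<close>

lemma card_edges_ge:
  fixes V :: "'a set"
  assumes fin: "finite V" "finite E" and ne: "V \<noteq> {}"
    and conn: "\<And>S. S \<subseteq> V \<Longrightarrow> S \<noteq> {} \<Longrightarrow> S \<noteq> V \<Longrightarrow> \<exists>u\<in>S. \<exists>w\<in>V - S. {u, w} \<in> E"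
  shows "card V \<le> card E + 1"
proof -
  have "\<exists>S\<subseteq>V. card S = Suc k \<and> k \<le> card {e \<in> E. e \<subseteq> S}" if "Suc k \<le> card V" for k
    using that
  proof (induction k)
    case 0
    obtain v where "v \<in> V" using ne by blast
    then show ?case by (intro exI[of _ "{v}"]) simp
  next
    case (Suc k)
    then obtain S where S: "S \<subseteq> V" "card S = Suc k" "k \<le> card {e \<in> E. e \<subseteq> S}" by auto
    have fS: "finite S" using S fin finite_subset by blast
    have "S \<noteq> {}" "S \<noteq> V" using S Suc.prems by auto
    then obtain u w where uw: "u \<in> S" "w \<in> V - S" "{u, w} \<in> E" using conn S(1) by blast
    have "insert {u, w} {e \<in> E. e \<subseteq> S} \<subseteq> {e \<in> E. e \<subseteq> insert w S}" using uw by auto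
    then have "card (insert {u, w} {e \<in> E. e \<subseteq> S}) \<le> card {e \<in> E. e \<subseteq> insert w S}"
      using fin by (intro card_mono) auto
    moreover have "card (insert {u, w} {e \<in> E. e \<subseteq> S}) = Suc (card {e \<in> E. e \<subseteq> S})"
      using uw fin by (intro card_insert_disjoint) auto
    ultimately show ?case using S uw fS by (intro exI[of _ "insert w S"]) auto
  qed
  from this[of "card V - 1"] obtain S where "S \<subseteq> V" "card V - 1 \<le> card {e \<in> E. e \<subseteq> S}"
    using ne fin by (auto simp: card_gt_0_iff Suc_le_eq)
  moreover have "card {e \<in> E. e \<subseteq> S} \<le> card E" using fin by (intro card_mono) auto
  ultimately show ?thesis by linarith
qed


lemma four_cycles_rotate:
  assumes "(u, x, w, y) \<in> four_cycles G"
  shows "(x, w, y, u) \<in> four_cycles G" "(u, y, w, x) \<in> four_cycles G"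
  using assms nbrs_sym[of _ G] by (auto simp: four_cycles_def)

lemma four_cycles_distinct:
  assumes "simple_graph G" "(u, x, w, y) \<in> four_cycles G"
  shows "distinct [u, x, w, y]" "{u, x, w, y} \<subseteq> verts G"
    "x \<in> nbrs G u" "w \<in> nbrs G x" "y \<in> nbrs G w" "u \<in> nbrs G y"
proof -
  show *: "x \<in> nbrs G u" "w \<in> nbrs G x" "y \<in> nbrs G w" "u \<in> nbrs G y"
    using assms(2) nbrs_sym[of _ G] by (auto simp: four_cycles_def)
  show "distinct [u, x, w, y]"
    using * simple_graph_nbrs(5)[OF assms(1)] assms(2) by (auto simp: four_cycles_def)
  show "{u, x, w, y} \<subseteq> verts G"
    using * simple_graph_nbrs(4)[OF assms(1)] by blast
qed

text \<open>An edge \<open>e\<close> off both cycles carries no flow of \<open>X\<close>: otherwise it is not the only edge across any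
  cut, so that removing \<open>e\<close> and one edge of each cycle would leave a connected graph with
  only \<open>card (verts H) - 2\<close> edges.\<close>

lemma no_disjoint_four_cycles:
  assumes H: "simple_graph H" and conn: "graph_connected H" and m: "card (edges H) = card (verts H) + 1"
    and C: "(u, x, w, y) \<in> four_cycles H" and C': "(u', x', w', y') \<in> four_cycles H"
    and disj: "{u, x, w, y} \<inter> {u', x', w', y'} = {}"
    and vs: "distinct (v # us)" "set (v # us) = verts H"
  shows "\<not> 3 dvd det (mat_on us (lap H) :: int mat)"
proof
  assume "3 dvd det (mat_on us (lap H) :: int mat)"
  then obtain X :: "'a \<Rightarrow> gf3" where X: "X v = 0" "\<exists>u\<in>verts H. X u \<noteq> 0"
    and harm: "\<And>u. u \<in> verts H \<Longrightarrow> (\<Sum>w\<in>nbrs H u. X w - X u) = 0"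
    using harmonic_mod_3[OF H vs] by blast
  note nb = simple_graph_nbrs[OF H]
  note c = four_cycles_distinct[OF H C] and c' = four_cycles_distinct[OF H C']
  define CE where "CE = {{u, x}, {x, w}, {w, y}, {y, u}}"
  define CE' where "CE' = {{u', x'}, {x', w'}, {w', y'}, {y', u'}}"
  have sub: "CE \<subseteq> edges H" "CE' \<subseteq> edges H"
    using c(3-6) c'(3-6) by (auto simp: CE_def CE'_def nbrs_def)
  have flow0: "X s = X t" if st: "t \<in> nbrs H s" "{s, t} \<notin> CE" "{s, t} \<notin> CE'" for s t
  proof (rule ccontr)
    assume ne: "X s \<noteq> X t"
    define E where "E = edges H - {{s, t}, {u, x}, {u', x'}}"
    have finE: "finite (edges H)" by (rule finite_edges[OF H])
    have "card {{s, t}, {u, x}, {u', x'}} = 3"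
    proof -
      have "{u, x} \<noteq> {u', x'}" using disj by (auto simp: doubleton_eq_iff)
      moreover have "{s, t} \<noteq> {u, x}" "{s, t} \<noteq> {u', x'}" using st by (auto simp: CE_def CE'_def)
      ultimately show ?thesis by simp
    qed
    moreover have "{{s, t}, {u, x}, {u', x'}} \<subseteq> edges H"
      using st(1) sub by (auto simp: nbrs_def CE_def CE'_def)
    ultimately have cE: "card E + 3 = card (edges H)"
      unfolding E_def using finE by (metis (no_types, lifting) card_Diff_subset card_mono finite_subset le_add_diff_inverse2)
    have "card (verts H) \<le> card E + 1"
    proof (rule card_edges_ge)
      show "finite (verts H)" using H by (simp add: simple_graph_def)
      show "finite E" unfolding E_def using finE by simp
      show "verts H \<noteq> {}" using c(2) by auto
      fix S assume S: "S \<subseteq> verts H" "S \<noteq> {}" "S \<noteq> verts H"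
      show "\<exists>a\<in>S. \<exists>b\<in>verts H - S. {a, b} \<in> E"
      proof (rule ccontr)
        assume no: "\<not> ?thesis"
        have iff: "a \<in> S \<longleftrightarrow> b \<in> S" if "{a, b} \<in> E" for a b
        proof -
          have "{a, b} \<in> edges H" using that by (simp add: E_def)
          then have "a \<in> verts H" "b \<in> verts H" using H by (auto simp: simple_graph_def)
          moreover have "{b, a} \<in> E" using that by (simp add: insert_commute)
          ultimately show ?thesis using no that by blast
        qed
        have ne1: "{s, t} \<noteq> e" if "e \<in> CE \<union> CE'" for e using st that by auto
        have inE: "e \<in> E" if "e \<in> CE \<union> CE'" "e \<noteq> {u, x}" "e \<noteq> {u', x'}" for e
          using that ne1[of e] sub by (auto simp: E_def)
        \<comment> \<open>Three edges of each cycle survive in \<open>E\<close> and still join the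
          ends of the removed one. So no removed cycle edge crosses the cut, and
          \<open>{s, t}\<close> is the only edge that can.\<close>
        have "{x, w} \<in> E" "{w, y} \<in> E" "{y, u} \<in> E"
          using inE[of "{x, w}"] inE[of "{w, y}"] inE[of "{y, u}"] c(1) disj by (auto simp: CE_def doubleton_eq_iff)
        then have ux: "u \<in> S \<longleftrightarrow> x \<in> S" using iff by blast
        have "{x', w'} \<in> E" "{w', y'} \<in> E" "{y', u'} \<in> E"
          using inE[of "{x', w'}"] inE[of "{w', y'}"] inE[of "{y', u'}"] c'(1) disj by (auto simp: CE'_def doubleton_eq_iff)
        then have ux': "u' \<in> S \<longleftrightarrow> x' \<in> S" using iff by blast
        have cross: "{a, b} = {s, t}" if "b \<in> nbrs H a" "a \<in> S" "b \<notin> S" for a b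
        proof (rule ccontr)
          assume "{a, b} \<noteq> {s, t}"
          moreover have "{a, b} \<noteq> {u, x}" "{a, b} \<noteq> {u', x'}" using that ux ux' by (auto simp: doubleton_eq_iff)
          ultimately have "{a, b} \<in> E" using that(1) by (simp add: E_def nbrs_def)
          then show False using iff that by blast
        qed
        have "\<exists>a\<in>S. \<not> nbrs H a \<subseteq> S" using conn S unfolding graph_connected_def by blast
        then obtain a b where ab: "a \<in> S" "b \<in> nbrs H a" "b \<notin> S" by blast
        have out: "nbrs H d - S = (if d = a then {b} else {})" if "d \<in> S" for d
        proof -
          have *: "d = a \<and> e = b" if "e \<in> nbrs H d - S" for e
          proof -
            have "{d, e} = {a, b}" using cross[of e d] cross[OF ab(2,1,3)] that \<open>d \<in> S\<close> by auto
            then show ?thesis using ab that \<open>d \<in> S\<close> by (auto simp: doubleton_eq_iff)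
          qed
          show ?thesis
          proof (cases "d = a")
            case True
            have "nbrs H d - S \<subseteq> {b}" using * by blast
            moreover have "b \<in> nbrs H d - S" using ab True by blast
            ultimately show ?thesis using True by (simp add: subset_singleton_iff) blast
          next
            case False
            then show ?thesis using * by simp blast
          qed
        qed
        have finS: "finite S" using S(1) H finite_subset by (auto simp: simple_graph_def)
        have "(\<Sum>d\<in>S. \<Sum>e\<in>nbrs H d - S. X e - X d) = 0"
          using cut_flow[OF H S(1), of X] harm S(1) by blast
        moreover have "(\<Sum>d\<in>S. \<Sum>e\<in>nbrs H d - S. X e - X d) = (\<Sum>d\<in>S. if d = a then X b - X a else 0)"
          using out by (intro sum.cong) auto
        ultimately have "X b = X a" using finS ab(1) by simp
        then show False using ne cross[OF ab(2,1,3)] by (auto simp: doubleton_eq_iff)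
      qed
    qed
    then show False using cE m by simp
  qed
  \<comment> \<open>At a corner \<open>a\<close> of a cycle only the two cycle edges, to
    \<open>b\<close> and \<open>d\<close>, can carry flow, so harmonicity reduces to these two
    terms.\<close>
  have corner: "X b + X d = X a + X a"
    if "a \<in> verts H" "b \<in> nbrs H a" "d \<in> nbrs H a" "b \<noteq> d"
      "\<And>t. t \<in> nbrs H a \<Longrightarrow> t \<noteq> b \<Longrightarrow> t \<noteq> d \<Longrightarrow> X a = X t" for a b d
  proof -
    have "0 = (\<Sum>t\<in>nbrs H a. X t - X a)" using harm[OF that(1)] by simp
    also have "\<dots> = (\<Sum>t\<in>{b, d}. X t - X a)"
      using that by (intro sum.mono_neutral_right nb(2)) force+
    finally show ?thesis using that(4) by (simp add: algebra_simps)
  qed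
  \<comment> \<open>As 2 is invertible modulo 3, the two outer equations give \<open>r = p\<close>,
    the middle one then \<open>q = p\<close>, and finally \<open>s = p\<close>. Three corners of a
    cycle therefore suffice.\<close>
  have all_eq: "q = p \<and> r = p \<and> s = p" if "q + s = p + p" "p + r = q + q" "q + s = r + r" for p q r s :: gf3
    using that by (cases p; cases q; cases r; cases s; simp)
  have const: "X x = X u \<and> X w = X u \<and> X y = X u"
  proof -
    have "X x + X y = X u + X u" by (rule corner[of u x y])
      (use c nbrs_sym[of y H u] disj in \<open>auto intro!: flow0 simp: CE_def CE'_def doubleton_eq_iff\<close>)
    moreover have "X u + X w = X x + X x" by (rule corner[of x u w])
      (use c nbrs_sym[of u H x] disj in \<open>auto intro!: flow0 simp: CE_def CE'_def doubleton_eq_iff\<close>)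
    moreover have "X x + X y = X w + X w" by (rule corner[of w x y])
      (use c nbrs_sym[of x H w] disj in \<open>auto intro!: flow0 simp: CE_def CE'_def doubleton_eq_iff\<close>)
    ultimately show ?thesis using all_eq by blast
  qed
  have const': "X x' = X u' \<and> X w' = X u' \<and> X y' = X u'"
  proof -
    have "X x' + X y' = X u' + X u'" by (rule corner[of u' x' y'])
      (use c' nbrs_sym[of y' H u'] disj in \<open>auto intro!: flow0 simp: CE_def CE'_def doubleton_eq_iff\<close>)
    moreover have "X u' + X w' = X x' + X x'" by (rule corner[of x' u' w'])
      (use c' nbrs_sym[of u' H x'] disj in \<open>auto intro!: flow0 simp: CE_def CE'_def doubleton_eq_iff\<close>)
    moreover have "X x' + X y' = X w' + X w'" by (rule corner[of w' x' y'])
      (use c' nbrs_sym[of x' H w'] disj in \<open>auto intro!: flow0 simp: CE_def CE'_def doubleton_eq_iff\<close>)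
    ultimately show ?thesis using all_eq by blast
  qed
  have eq: "X t = X s" if "t \<in> nbrs H s" for s t
  proof (cases "{s, t} \<in> CE \<or> {s, t} \<in> CE'")
    case True
    then show ?thesis using const const' by (auto simp: CE_def CE'_def doubleton_eq_iff)
  next
    case False
    then show ?thesis using flow0[OF that] by simp
  qed
  have vV: "v \<in> verts H" unfolding vs(2)[symmetric] by simp
  have "{d \<in> verts H. X d = 0} = verts H"
  proof (rule graph_connectedD[OF conn])
    show "{d \<in> verts H. X d = 0} \<noteq> {}" using vV X(1) by auto
    show "nbrs H d \<subseteq> {d \<in> verts H. X d = 0}" if "d \<in> {d \<in> verts H. X d = 0}" for d
      using that eq[of _ d] nb(1)[of d] by auto
  qed auto
  then show False using X(2) by blast
qed

section \<open>Graphs with degrees 3, 3, 3, 1, 2, ..., 2\<close>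

text \<open>The two pairs of opposite corners identify a 4-cycle up to starting point and direction;
  the tuples with the same diagonals are the eight images under the dihedral group.\<close>

definition diagonals :: "'a \<times> 'a \<times> 'a \<times> 'a \<Rightarrow> 'a set set" where
  "diagonals = (\<lambda>(u, x, w, y). {{u, w}, {x, y}})"

lemma card_diagonals_fibre:
  assumes G: "simple_graph G" and C: "(u, x, w, y) \<in> four_cycles G"
  shows "card {t \<in> four_cycles G. diagonals t = diagonals (u, x, w, y)} = 8"
proof -
  define R where "R = {(u, x, w, y), (u, y, w, x), (w, x, u, y), (w, y, u, x),
    (x, u, y, w), (x, w, y, u), (y, u, x, w), (y, w, x, u)}"
  have sub: "R \<subseteq> four_cycles G"
    unfolding R_def using C nbrs_sym[of _ G] by (auto simp: four_cycles_def)
  have diag: "diagonals t = diagonals (u, x, w, y)" if "t \<in> R" for t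
    using that unfolding R_def by (auto simp: diagonals_def insert_commute)
  have "{t \<in> four_cycles G. diagonals t = diagonals (u, x, w, y)} = R"
  proof (intro equalityI subsetI)
    fix t assume "t \<in> {t \<in> four_cycles G. diagonals t = diagonals (u, x, w, y)}"
    moreover obtain p q r s where "t = (p, q, r, s)" by (cases t)
    ultimately show "t \<in> R" unfolding R_def by (auto simp: diagonals_def doubleton_eq_iff)
  next
    fix t assume "t \<in> R"
    then show "t \<in> {t \<in> four_cycles G. diagonals t = diagonals (u, x, w, y)}" using sub diag by auto
  qed
  then show ?thesis using four_cycles_distinct(1)[OF G C] by (simp add: R_def)
qed

lemma card_four_cycles_dvd:
  assumes G: "simple_graph G"
  shows "8 dvd card (four_cycles G)"
proof -
  note fin = finite_four_cycles[OF G]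
  have "card (four_cycles G) = (\<Sum>D\<in>diagonals ` four_cycles G. card {t \<in> four_cycles G. diagonals t = D})"
    using sum.image_gen[OF fin, of "\<lambda>_. 1::nat" diagonals] by simp
  also have "\<dots> = (\<Sum>D\<in>diagonals ` four_cycles G. 8)"
    using card_diagonals_fibre[OF G] by (intro sum.cong refl) auto
  finally show ?thesis by simp
qed

lemma four_cycles_start_at:
  assumes "(u, x, w, y) \<in> four_cycles G" "a \<in> {u, x, w, y}"
  obtains x1 w1 y1 where "(a, x1, w1, y1) \<in> four_cycles G"
    "diagonals (a, x1, w1, y1) = diagonals (u, x, w, y)"
proof -
  note r = four_cycles_rotate(1)
  have *: "diagonals (x, w, y, u) = diagonals (u, x, w, y)" "diagonals (w, y, u, x) = diagonals (u, x, w, y)"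
    "diagonals (y, u, x, w) = diagonals (u, x, w, y)"
    by (auto simp: diagonals_def insert_commute)
  consider "a = u" | "a = x" | "a = w" | "a = y" using assms(2) by auto
  then show thesis
  proof cases
    case 1
    then show thesis using that assms(1) by simp
  next
    case 2
    then show thesis using that r[OF assms(1)] *(1) by simp
  next
    case 3
    then show thesis using that r[OF r[OF assms(1)]] *(2) by simp
  next
    case 4
    then show thesis using that r[OF r[OF r[OF assms(1)]]] *(3) by simp
  qed
qed

text \<open>More than eight tuples means two cycles with different diagonals. If they share a vertex
  \<open>a\<close>, the degree bound makes them share a neighbour \<open>b\<close> of
  \<open>a\<close> as well, since otherwise \<open>a\<close> would have four. With both written as
  starting with \<open>a\<close>, \<open>b\<close>, the other two corners decide: exactly one in
  common gives \<open>K\<^sub>2\<^sub>,\<^sub>3\<close>, none gives the ladder.\<close>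

lemma two_four_cycles:
  assumes H: "simple_graph H" and deg3: "\<And>u. u \<in> verts H \<Longrightarrow> deg H u \<le> 3" and tri: "triangles H = {}"
    and card8: "card (four_cycles H) > 8"
  obtains (disjoint) u x w y u' x' w' y' where "(u, x, w, y) \<in> four_cycles H" "(u', x', w', y') \<in> four_cycles H"
    "{u, x, w, y} \<inter> {u', x', w', y'} = {}"
  | (k23) u w x y z where "u \<noteq> w" "distinct [x, y, z]" "{x, y, z} \<subseteq> nbrs H u" "{x, y, z} \<subseteq> nbrs H w"
  | (ladder) u x w y w' y' where "(u, x, w, y) \<in> four_cycles H" "(u, x, w', y') \<in> four_cycles H"
    "distinct [u, x, w, y, w', y']"
proof -
  note nb = simple_graph_nbrs[OF H]
  have noT: "z \<notin> nbrs H u \<or> z \<notin> nbrs H w" if "w \<in> nbrs H u" for u w z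
  proof -
    have "(u, w, z) \<notin> triangles H" using tri by simp
    then show ?thesis using that by (simp add: triangles_def)
  qed
  have "four_cycles H \<noteq> {}" using card8 by auto
  then obtain u x w y where t1: "(u, x, w, y) \<in> four_cycles H" by (metis prod_cases4 equals0I)
  have "\<not> four_cycles H \<subseteq> {t \<in> four_cycles H. diagonals t = diagonals (u, x, w, y)}"
  proof
    assume "four_cycles H \<subseteq> {t \<in> four_cycles H. diagonals t = diagonals (u, x, w, y)}"
    then have "four_cycles H = {t \<in> four_cycles H. diagonals t = diagonals (u, x, w, y)}" by blast
    then show False using card_diagonals_fibre[OF H t1] card8 by simp
  qed
  then obtain t where t: "t \<in> four_cycles H" "diagonals t \<noteq> diagonals (u, x, w, y)" by blast
  obtain u' x' w' y' where t_eq: "t = (u', x', w', y')" by (cases t)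
  have t2: "(u', x', w', y') \<in> four_cycles H" "diagonals (u', x', w', y') \<noteq> diagonals (u, x, w, y)"
    using t unfolding t_eq by auto
  show thesis
  proof (cases "{u, x, w, y} \<inter> {u', x', w', y'} = {}")
    case True
    then show thesis by (rule disjoint[OF t1 t2(1)])
  next
    case False
    then obtain a where a: "a \<in> {u, x, w, y}" "a \<in> {u', x', w', y'}" by (meson disjoint_iff)
    obtain x1 w1 y1 where 1: "(a, x1, w1, y1) \<in> four_cycles H" "diagonals (a, x1, w1, y1) = diagonals (u, x, w, y)"
      using four_cycles_start_at[OF t1 a(1)] .
    obtain x2 w2 y2 where 2: "(a, x2, w2, y2) \<in> four_cycles H" "diagonals (a, x2, w2, y2) = diagonals (u', x', w', y')"
      using four_cycles_start_at[OF t2(1) a(2)] .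
    have dg: "diagonals (a, x1, w1, y1) \<noteq> diagonals (a, x2, w2, y2)" using 1 2 t2 by simp
    have aV: "a \<in> verts H" using four_cycles_distinct(2)[OF H 1(1)] by simp
    have "{x1, y1} \<inter> {x2, y2} \<noteq> {}"
    proof
      assume e: "{x1, y1} \<inter> {x2, y2} = {}"
      have "card {x1, y1, x2, y2} = 4" using e 1(1) 2(1) by (auto simp: four_cycles_def)
      moreover have "{x1, y1, x2, y2} \<subseteq> nbrs H a" using 1(1) 2(1) by (auto simp: four_cycles_def)
      ultimately have "4 \<le> deg H a" using card_mono[OF nb(2), of "{x1, y1, x2, y2}" a] by (simp add: deg_def)
      then show False using deg3[OF aV] by simp
    qed
    then obtain b where b: "b \<in> {x1, y1}" "b \<in> {x2, y2}" by blast
    obtain y3 where 3: "(a, b, w1, y3) \<in> four_cycles H" "diagonals (a, b, w1, y3) = diagonals (a, x1, w1, y1)"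
      using b(1) 1(1) four_cycles_rotate(2)[OF 1(1)] by (auto simp: diagonals_def insert_commute)
    obtain y4 where 4: "(a, b, w2, y4) \<in> four_cycles H" "diagonals (a, b, w2, y4) = diagonals (a, x2, w2, y2)"
      using b(2) 2(1) four_cycles_rotate(2)[OF 2(1)] by (auto simp: diagonals_def insert_commute)
    have ne: "w1 \<noteq> w2 \<or> y3 \<noteq> y4" using dg 3(2) 4(2) by auto
    note d3 = four_cycles_distinct[OF H 3(1)] and d4 = four_cycles_distinct[OF H 4(1)]
    consider "y3 = y4" "w1 \<noteq> w2" | "y3 \<noteq> y4" "w1 = w2" | "y3 \<noteq> y4" "w1 \<noteq> w2" using ne by blast
    then show thesis
    proof cases
      case 1
      show thesis
        by (rule k23[of b y3 a w1 w2]) (use 1 3(1) 4(1) nbrs_sym[of _ H] d3(1) d4(1) in \<open>auto simp: four_cycles_def\<close>)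
    next
      case 2
      show thesis
        by (rule k23[of a w1 b y3 y4]) (use 2 3(1) 4(1) nbrs_sym[of _ H] d3(1) d4(1) in \<open>auto simp: four_cycles_def\<close>)
    next
      case 3
      \<comment> \<open>If \<open>w1 = y4\<close>, then \<open>a\<close>, \<open>b\<close>,
        \<open>w1\<close> form a triangle; likewise \<open>a\<close>, \<open>b\<close>,
        \<open>w2\<close> if \<open>w2 = y3\<close>.\<close>
      have "w1 \<noteq> y4" using noT[of a y4 b] d3 d4 nbrs_sym[of _ H] by metis
      moreover have "w2 \<noteq> y3" using noT[of a y3 b] d3 d4 nbrs_sym[of _ H] by metis
      ultimately have "distinct [a, b, w1, y3, w2, y4]" using 3 d3(1) d4(1) by auto
      then show thesis by (rule ladder[OF \<open>(a, b, w1, y3) \<in> four_cycles H\<close> \<open>(a, b, w2, y4) \<in> four_cycles H\<close>])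
    qed
  qed
qed

text \<open>The complete bipartite graph \<open>K\<^sub>2\<^sub>,\<^sub>3\<close> and the ladder with two squares, each with a pendant vertex.\<close>

definition mate4 :: "nat ugraph" where
  "mate4 = ({0..<6}, {{0, 2}, {0, 3}, {0, 4}, {1, 2}, {1, 3}, {1, 4}, {2, 5}})"

definition mate5 :: "nat ugraph" where
  "mate5 = ({0..<7}, {{0, 1}, {1, 2}, {2, 3}, {3, 0}, {1, 4}, {4, 5}, {5, 0}, {2, 6}})"

lemma graph_iso_enumeration:
  assumes zs: "distinct zs" "set zs = verts H" and V: "verts K = {0..<length zs}"
    and sub: "\<And>e. e \<in> edges K \<Longrightarrow> e \<subseteq> verts K" and E: "edges H = (\<lambda>e. (!) zs ` e) ` edges K"
  shows "graph_iso H K"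
proof -
  have "inj_on ((!) zs) (verts K)" using zs(1) by (auto simp: V inj_on_def nth_eq_iff_index_eq)
  from graph_iso_image[OF this sub]
  have "graph_iso K ((!) zs ` verts K, (\<lambda>e. (!) zs ` e) ` edges K)" .
  moreover have "(!) zs ` verts K = verts H"
    unfolding zs(2)[symmetric] V by (auto simp: set_conv_nth)
  ultimately have "graph_iso K H" unfolding E[symmetric] by simp
  then show ?thesis by (rule graph_iso_sym)
qed

text \<open>Collects what the reconstruction uses. \<open>Q\<close> stands for the number of 4-cycle
  tuples of \<open>rose 3 l\<close>; it enters through its residue modulo 8, and \<open>l\<close> is
  recovered at the end from the number of vertices.\<close>

locale cospectral_mate =
  fixes H :: "'a ugraph" and a b c p :: 'a and Q :: nat
  assumes simple: "simple_graph H" and conn: "graph_connected H"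
    and degrees: "mate_degrees H a b c p" and no_triangle: "triangles H = {}"
    and four: "int (card (four_cycles H)) + 2 * deviation_form H = int Q + 20" and Q: "8 dvd Q"
begin

lemmas nb = simple_graph_nbrs[OF simple]

lemma deg_le_3: "u \<in> verts H \<Longrightarrow> deg H u \<le> 3"
  using degrees unfolding mate_degrees_def by (cases "u \<in> {a, b, c, p}") auto

lemma nbrs_3:
  assumes "distinct [x, y, z]" "{x, y, z} \<subseteq> nbrs H u"
  shows "nbrs H u = {x, y, z}" "deg H u = 3"
proof -
  have "u \<in> verts H" using assms nb(4) by auto
  then show 1: "nbrs H u = {x, y, z}" using nbrs_eqI[OF simple assms(2)] deg_le_3[of u] assms(1) by simp
  show "deg H u = 3" unfolding deg_def 1 using assms(1) by simp
qed

text \<open>Exactly three vertices have degree 3, so the hubs may be renamed after their position in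
  the subgraph that has been found.\<close>

lemma relabel:
  assumes "distinct [u, w, x]" "deg H u = 3" "deg H w = 3" "deg H x = 3"
  shows "mate_degrees H u w x p"
proof -
  have "v \<in> {a, b, c}" if "deg H v = 3" for v
  proof -
    have "nbrs H v \<noteq> {}" using that by (auto simp: deg_def)
    then have "v \<in> verts H" using nb(4) by blast
    then show ?thesis using degrees that unfolding mate_degrees_def by (cases "v \<in> {a, b, c, p}") auto
  qed
  then have "{u, w, x} \<subseteq> {a, b, c}" using assms by blast
  moreover have "card {u, w, x} = 3" "card {a, b, c} = 3" using assms degrees by (auto simp: mate_degrees_def)
  ultimately have eq: "{u, w, x} = {a, b, c}" using card_subset_eq[of "{a, b, c}" "{u, w, x}"] by simp
  then have eq4: "{u, w, x, p} = {a, b, c, p}" by blast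
  have "p \<notin> {u, w, x}" using degrees unfolding eq by (auto simp: mate_degrees_def)
  then have "distinct [u, w, x, p]" using assms(1) by auto
  moreover have "deg H p = 1" "{u, w, x, p} \<subseteq> verts H" "\<forall>v\<in>verts H - {u, w, x, p}. deg H v = 2"
    using degrees unfolding eq4 mate_degrees_def by blast+
  ultimately show ?thesis using assms(2-4) unfolding mate_degrees_def by blast
qed

lemma two_nbrs_not_p:
  assumes "r \<noteq> s" "r \<in> nbrs H v" "s \<in> nbrs H v"
  shows "v \<noteq> p"
proof
  assume "v = p"
  then have "card (nbrs H v) = 1" using degrees by (simp add: mate_degrees_def deg_def)
  then show False using assms by (auto simp: card_1_singleton_iff)
qed

lemma nbrs_2:
  assumes "mate_degrees H u w x p" "v \<notin> {u, w, x}" "r \<noteq> s" "r \<in> nbrs H v" "s \<in> nbrs H v"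
  shows "nbrs H v = {r, s}"
proof -
  have "v \<in> verts H" "v \<noteq> p" using assms nb(4) two_nbrs_not_p by blast+
  then have "deg H v = 2" using assms(1,2) by (auto simp: mate_degrees_def)
  then show ?thesis using nbrs_eqI[OF simple, of "{r, s}" v] assms by simp
qed

text \<open>Otherwise the fourth trace would make the number of 4-cycle tuples congruent to 4 modulo 8.\<close>

lemma pendant_at:
  assumes hubs: "mate_degrees H u w x p" and uw: "w \<notin> nbrs H u" and wx: "x \<in> nbrs H w" and xu: "u \<in> nbrs H x"
    and "p \<notin> nbrs H u" "p \<notin> nbrs H w"
  shows "p \<in> nbrs H x"
proof (rule ccontr)
  assume "p \<notin> nbrs H x"
  then have "deviation_form H = 4" using deviation_form_mate[OF simple hubs] assms by simp
  then have "card (four_cycles H) = Q + 12" using four by linarith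
  moreover have "8 dvd card (four_cycles H)" by (rule card_four_cycles_dvd[OF simple])
  ultimately have "8 dvd (12 :: nat)" using Q by (metis dvd_add_right_iff)
  then show False by simp
qed

lemma nbrs_p: "p \<in> nbrs H x \<Longrightarrow> nbrs H p = {x}"
  using nbrs_eqI[OF simple, of "{x}" p] nbrs_sym[of p H x] degrees by (simp add: mate_degrees_def)

lemma p_in_verts: "p \<in> verts H"
  using degrees by (simp add: mate_degrees_def)

text \<open>The exit \<open>q\<close> makes \<open>x\<close> the third vertex of degree 3, so
  \<open>y\<close> and \<open>z\<close> have no further neighbours. The hubs span just the two edges
  at \<open>x\<close>, and by parity the pendant vertex must be adjacent to \<open>x\<close>; hence
  \<open>q = p\<close> and the graph ends there.\<close>

lemma k23_pendant:
  assumes uw: "u \<noteq> w" and d: "distinct [x, y, z]" and nu: "{x, y, z} \<subseteq> nbrs H u" and nw: "{x, y, z} \<subseteq> nbrs H w"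
    and q: "q \<in> nbrs H x" "q \<notin> {u, w, x, y, z}"
  shows "card (verts H) = 6" "graph_iso H mate4"
proof -
  have Nu: "nbrs H u = {x, y, z}" and du: "deg H u = 3" using nbrs_3[OF d nu] .
  have Nw: "nbrs H w = {x, y, z}" and dw: "deg H w = 3" using nbrs_3[OF d nw] .
  have irr: "u \<notin> {x, y, z}" "w \<notin> {x, y, z}" using nu nw nb(3) by auto
  have sy: "u \<in> nbrs H v" "w \<in> nbrs H v" if "v \<in> {x, y, z}" for v
    using that nu nw nbrs_sym[of v H u] nbrs_sym[of v H w] by auto
  have "distinct [u, w, q]" "{u, w, q} \<subseteq> nbrs H x" using uw q sy[of x] by auto
  then have Nx: "nbrs H x = {u, w, q}" and dx: "deg H x = 3" using nbrs_3 by auto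
  have m: "mate_degrees H u w x p" by (rule relabel) (use uw irr du dw dx in auto)
  have Ny: "nbrs H y = {u, w}" by (rule nbrs_2[OF m]) (use uw irr d sy[of y] in auto)
  have Nz: "nbrs H z = {u, w}" by (rule nbrs_2[OF m]) (use uw irr d sy[of z] in auto)
  have "p \<noteq> x" "p \<noteq> y" "p \<noteq> z" using two_nbrs_not_p[OF uw] sy by auto
  then have "p \<notin> nbrs H u" "p \<notin> nbrs H w" using Nu Nw by auto
  then have "p \<in> nbrs H x" using pendant_at[OF m] Nu Nw Nx irr by auto
  then have pq: "q = p" using Nx m by (auto simp: mate_degrees_def)
  have Np: "nbrs H p = {x}" using nbrs_p \<open>p \<in> nbrs H x\<close> by simp
  have V: "{u, w, x, y, z, p} = verts H"
  proof (rule graph_connectedD[OF conn])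
    show "{u, w, x, y, z, p} \<subseteq> verts H" using p_in_verts nb(4)[of x u] nb(4)[of x w] nb(1)[of u] nu nw by auto
  qed (use Nu Nw Nx Ny Nz Np pq in auto)
  have dis: "distinct [u, w, x, y, z, p]" using uw d irr q pq by auto
  then show "card (verts H) = 6" unfolding V[symmetric] by simp
  have "edges H = {{u, x}, {u, y}, {u, z}, {w, x}, {w, y}, {w, z}, {x, p}}"
  proof (intro equalityI subsetI)
    fix e assume "e \<in> edges H"
    then obtain s t where st: "e = {s, t}" "s \<in> verts H" "t \<in> nbrs H s" using simple_graph_edgeE[OF simple] by metis
    have "s \<in> {u, w, x, y, z, p}" using V st(2) by simp
    then consider "s = u" | "s = w" | "s = x" | "s = y" | "s = z" | "s = p" by blast
    then show "e \<in> {{u, x}, {u, y}, {u, z}, {w, x}, {w, y}, {w, z}, {x, p}}"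
    proof cases
      case 1
      then have "t \<in> nbrs H u" using st(3) by simp
      then show ?thesis unfolding Nu st(1) 1 using pq by (auto simp: doubleton_eq_iff)
    next
      case 2
      then have "t \<in> nbrs H w" using st(3) by simp
      then show ?thesis unfolding Nw st(1) 2 using pq by (auto simp: doubleton_eq_iff)
    next
      case 3
      then have "t \<in> nbrs H x" using st(3) by simp
      then show ?thesis unfolding Nx st(1) 3 using pq by (auto simp: doubleton_eq_iff)
    next
      case 4
      then have "t \<in> nbrs H y" using st(3) by simp
      then show ?thesis unfolding Ny st(1) 4 using pq by (auto simp: doubleton_eq_iff)
    next
      case 5
      then have "t \<in> nbrs H z" using st(3) by simp
      then show ?thesis unfolding Nz st(1) 5 using pq by (auto simp: doubleton_eq_iff)
    next
      case 6
      then have "t \<in> nbrs H p" using st(3) by simp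
      then show ?thesis unfolding Np st(1) 6 using pq by (auto simp: doubleton_eq_iff)
    qed
  next
    fix e assume "e \<in> {{u, x}, {u, y}, {u, z}, {w, x}, {w, y}, {w, z}, {x, p}}"
    then show "e \<in> edges H" using nu nw \<open>p \<in> nbrs H x\<close> by (auto simp: nbrs_def)
  qed
  then have E: "edges H = (\<lambda>e. (!) [u, w, x, y, z, p] ` e) ` edges mate4" by (simp add: mate4_def)
  show "graph_iso H mate4"
  proof (rule graph_iso_enumeration[OF dis _ _ _ E])
    show "set [u, w, x, y, z, p] = verts H" using V by simp
    show "verts mate4 = {0..<length [u, w, x, y, z, p]}" by (simp add: mate4_def eval_nat_numeral)
    show "e \<subseteq> verts mate4" if "e \<in> edges mate4" for e using that by (auto simp: mate4_def)
  qed
qed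

text \<open>If no edge left the five vertices, they would be all of \<open>H\<close>; but each of
  them has two neighbours, so \<open>p\<close> is not among them. The three vertices
  \<open>x\<close>, \<open>y\<close>, \<open>z\<close> are interchangeable, so the exit may be taken
  at \<open>x\<close>.\<close>

lemma k23_case:
  assumes uw: "u \<noteq> w" and d: "distinct [x, y, z]" and nu: "{x, y, z} \<subseteq> nbrs H u" and nw: "{x, y, z} \<subseteq> nbrs H w"
  shows "card (verts H) = 6 \<and> graph_iso H mate4"
proof -
  have "\<exists>r\<in>{x, y, z}. \<exists>q\<in>nbrs H r. q \<notin> {u, w, x, y, z}"
  proof (rule ccontr)
    assume no: "\<not> ?thesis"
    have "{u, w, x, y, z} = verts H"
    proof (rule graph_connectedD[OF conn])
      show "{u, w, x, y, z} \<subseteq> verts H" using nb(4)[of x u] nb(4)[of x w] nb(1)[of u] nu nw by auto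
      fix r assume "r \<in> {u, w, x, y, z}"
      then show "nbrs H r \<subseteq> {u, w, x, y, z}" using no nbrs_3(1)[OF d nu] nbrs_3(1)[OF d nw] by blast
    qed simp
    then have "p \<in> {u, w, x, y, z}" using p_in_verts by simp
    moreover have "v \<noteq> p" if "v \<in> {x, y, z}" for v
      using that nu nw nbrs_sym[of v H u] nbrs_sym[of v H w] by (intro two_nbrs_not_p[OF uw]) auto
    moreover have "u \<noteq> p" "w \<noteq> p" using two_nbrs_not_p[of x y u] two_nbrs_not_p[of x y w] d nu nw by auto
    ultimately show False by auto
  qed
  then obtain r q where r: "r \<in> {x, y, z}" "q \<in> nbrs H r" "q \<notin> {u, w, x, y, z}" by blast
  then consider "r = x" | "r = y" | "r = z" by blast
  then show ?thesis
  proof cases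
    case 1
    then show ?thesis using k23_pendant[OF uw d nu nw] r by auto
  next
    case 2
    then show ?thesis using k23_pendant[of u w y x z q] uw d nu nw r by auto
  next
    case 3
    then show ?thesis using k23_pendant[of u w z x y q] uw d nu nw r by auto
  qed
qed

text \<open>The ends \<open>u\<close>, \<open>x\<close> of the shared edge and the corner
  \<open>w\<close> with its exit are the vertices of degree 3, forming a path centred at
  \<open>x\<close>. Parity puts the pendant vertex next to a hub, and only \<open>w\<close> has a
  place left for it.\<close>

lemma ladder_pendant:
  assumes d: "distinct [u, x, w, y, w', y']"
    and e: "x \<in> nbrs H u" "w \<in> nbrs H x" "y \<in> nbrs H w" "u \<in> nbrs H y"
      "w' \<in> nbrs H x" "y' \<in> nbrs H w'" "u \<in> nbrs H y'"
    and q: "q \<in> nbrs H w" "q \<notin> {u, x, w, y, w', y'}"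
  shows "card (verts H) = 7" "graph_iso H mate5"
proof -
  have e': "u \<in> nbrs H x" "x \<in> nbrs H w" "w \<in> nbrs H y" "y \<in> nbrs H u" "x \<in> nbrs H w'" "w' \<in> nbrs H y'" "y' \<in> nbrs H u"
    using e nbrs_sym by metis+
  have Nu: "nbrs H u = {x, y, y'}" and du: "deg H u = 3"
    using nbrs_3[of x y y' u] d e e' by auto
  have Nx: "nbrs H x = {u, w, w'}" and dx: "deg H x = 3"
    using nbrs_3[of u w w' x] d e e' by auto
  have Nw: "nbrs H w = {x, y, q}" and dw: "deg H w = 3"
    using nbrs_3[of x y q w] d e e' q by auto
  have m: "mate_degrees H u w x p" by (rule relabel) (use d du dw dx in auto)
  have Ny: "nbrs H y = {u, w}" by (rule nbrs_2[OF m]) (use d e e' in auto)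
  have Nw': "nbrs H w' = {x, y'}" by (rule nbrs_2[OF m]) (use d e e' in auto)
  have Ny': "nbrs H y' = {w', u}" by (rule nbrs_2[OF m]) (use d e e' in auto)
  have np: "p \<noteq> u" "p \<noteq> x" "p \<noteq> w" "p \<noteq> y" "p \<noteq> w'" "p \<noteq> y'"
    using two_nbrs_not_p[of x y u] two_nbrs_not_p[of u w x] two_nbrs_not_p[of x y w] two_nbrs_not_p[of u w y]
      two_nbrs_not_p[of x y' w'] two_nbrs_not_p[of w' u y'] d e e' by auto
  have "p \<in> nbrs H w"
  proof (rule ccontr)
    assume n: "p \<notin> nbrs H w"
    have "p \<in> nbrs H x" using pendant_at[OF m] Nu Nw Nx np n d by auto
    then show False using Nx np by auto
  qed
  then have pq: "q = p" using Nw np by auto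
  have Np: "nbrs H p = {w}" using nbrs_p \<open>p \<in> nbrs H w\<close> by simp
  have V: "{u, x, w, y, w', y', p} = verts H"
  proof (rule graph_connectedD[OF conn])
    show "{u, x, w, y, w', y', p} \<subseteq> verts H"
      using p_in_verts nb(4)[OF e(1)] nb(4)[OF e(2)] nb(4)[OF e(3)] nb(4)[OF e(4)] nb(4)[OF e(6)] nb(4)[OF e(7)] by blast
  qed (use Nu Nw Nx Ny Nw' Ny' Np pq in auto)
  have dis: "distinct [u, x, w, y, w', y', p]" using d np by auto
  then show "card (verts H) = 7" unfolding V[symmetric] by simp
  have "edges H = {{u, x}, {x, w}, {w, y}, {y, u}, {x, w'}, {w', y'}, {y', u}, {w, p}}"
  proof (intro equalityI subsetI)
    fix f assume "f \<in> edges H"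
    then obtain s t where st: "f = {s, t}" "s \<in> verts H" "t \<in> nbrs H s" using simple_graph_edgeE[OF simple] by metis
    have "s \<in> {u, x, w, y, w', y', p}" using V st(2) by simp
    then consider "s = u" | "s = x" | "s = w" | "s = y" | "s = w'" | "s = y'" | "s = p" by blast
    then show "f \<in> {{u, x}, {x, w}, {w, y}, {y, u}, {x, w'}, {w', y'}, {y', u}, {w, p}}"
    proof cases
      case 1
      then have "t \<in> nbrs H u" using st(3) by simp
      then show ?thesis unfolding Nu st(1) 1 using pq by (auto simp: doubleton_eq_iff)
    next
      case 2
      then have "t \<in> nbrs H x" using st(3) by simp
      then show ?thesis unfolding Nx st(1) 2 using pq by (auto simp: doubleton_eq_iff)
    next
      case 3
      then have "t \<in> nbrs H w" using st(3) by simp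
      then show ?thesis unfolding Nw st(1) 3 using pq by (auto simp: doubleton_eq_iff)
    next
      case 4
      then have "t \<in> nbrs H y" using st(3) by simp
      then show ?thesis unfolding Ny st(1) 4 using pq by (auto simp: doubleton_eq_iff)
    next
      case 5
      then have "t \<in> nbrs H w'" using st(3) by simp
      then show ?thesis unfolding Nw' st(1) 5 using pq by (auto simp: doubleton_eq_iff)
    next
      case 6
      then have "t \<in> nbrs H y'" using st(3) by simp
      then show ?thesis unfolding Ny' st(1) 6 using pq by (auto simp: doubleton_eq_iff)
    next
      case 7
      then have "t \<in> nbrs H p" using st(3) by simp
      then show ?thesis unfolding Np st(1) 7 using pq by (auto simp: doubleton_eq_iff)
    qed
  next
    fix f assume "f \<in> {{u, x}, {x, w}, {w, y}, {y, u}, {x, w'}, {w', y'}, {y', u}, {w, p}}"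
    then show "f \<in> edges H" using e \<open>p \<in> nbrs H w\<close> by (auto simp: nbrs_def)
  qed
  then have E: "edges H = (\<lambda>e. (!) [u, x, w, y, w', y', p] ` e) ` edges mate5" by (simp add: mate5_def)
  show "graph_iso H mate5"
  proof (rule graph_iso_enumeration[OF dis _ _ _ E])
    show "set [u, x, w, y, w', y', p] = verts H" using V by simp
    show "verts mate5 = {0..<length [u, x, w, y, w', y', p]}" by (simp add: mate5_def eval_nat_numeral)
    show "e \<subseteq> verts mate5" if "e \<in> edges mate5" for e using that by (auto simp: mate5_def)
  qed
qed

lemma ladder_case:
  assumes C: "(u, x, w, y) \<in> four_cycles H" "(u, x, w', y') \<in> four_cycles H" and d: "distinct [u, x, w, y, w', y']"
  shows "card (verts H) = 7 \<and> graph_iso H mate5"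
proof -
  note e = four_cycles_distinct(3-6)[OF simple C(1)] four_cycles_distinct(4-6)[OF simple C(2)]
  have e': "u \<in> nbrs H x" "x \<in> nbrs H w" "w \<in> nbrs H y" "y \<in> nbrs H u" "x \<in> nbrs H w'" "w' \<in> nbrs H y'" "y' \<in> nbrs H u"
    using e nbrs_sym by metis+
  have Nu: "nbrs H u = {x, y, y'}" using nbrs_3(1)[of x y y' u] d e e' by auto
  have Nx: "nbrs H x = {u, w, w'}" using nbrs_3(1)[of u w w' x] d e e' by auto
  have np: "p \<noteq> u" "p \<noteq> x" "p \<noteq> w" "p \<noteq> y" "p \<noteq> w'" "p \<noteq> y'"
    using two_nbrs_not_p[of x y u] two_nbrs_not_p[of u w x] two_nbrs_not_p[of x y w] two_nbrs_not_p[of u w y]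
      two_nbrs_not_p[of x y' w'] two_nbrs_not_p[of w' u y'] d e e' by auto
  have "\<exists>r\<in>{w, y, w', y'}. \<exists>q\<in>nbrs H r. q \<notin> {u, x, w, y, w', y'}"
  proof (rule ccontr)
    assume no: "\<not> ?thesis"
    have "{u, x, w, y, w', y'} = verts H"
    proof (rule graph_connectedD[OF conn])
      show "{u, x, w, y, w', y'} \<subseteq> verts H"
        using nb(4)[OF e(1)] nb(4)[OF e(2)] nb(4)[OF e(3)] nb(4)[OF e(4)] nb(4)[OF e(6)] nb(4)[OF e(7)] by blast
      fix r assume "r \<in> {u, x, w, y, w', y'}"
      then show "nbrs H r \<subseteq> {u, x, w, y, w', y'}" using no Nu Nx by blast
    qed simp
    then show False using p_in_verts np by blast
  qed
  then obtain r q where r: "r \<in> {w, y, w', y'}" "q \<in> nbrs H r" "q \<notin> {u, x, w, y, w', y'}" by blast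
  \<comment> \<open>Exchanging the two squares and exchanging the ends of the shared edge are
    symmetries of the ladder, and together they move any of the four outer corners to
    \<open>w\<close>.\<close>
  then consider "r = w" | "r = y" | "r = w'" | "r = y'" by blast
  then show ?thesis
  proof cases
    case 1
    then show ?thesis using ladder_pendant[of u x w y w' y' q] d e r by auto
  next
    case 2
    then show ?thesis using ladder_pendant[of x u y w y' w' q] d e' r by auto
  next
    case 3
    then show ?thesis using ladder_pendant[of u x w' y' w y q] d e r by auto
  next
    case 4
    then show ?thesis using ladder_pendant[of x u y' w' y w q] d e' r by auto
  qed
qed

end

section \<open>Classification of the cospectral graphs\<close>

text \<open>Here \<open>H\<close> has five vertices and exactly one triangle. A hub not adjacent to
  \<open>p\<close> is adjacent to the other two hubs and to the fifth vertex \<open>e\<close>. If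
  \<open>p\<close> hangs on \<open>e\<close>, all three hubs are adjacent to \<open>e\<close>,
  against its degree 2; if \<open>p\<close> hangs on a hub, the other two hubs lie in two
  triangles.\<close>

lemma mate_not_cospectral_rose_3_3:
  assumes H: "simple_graph H" and spec: "laplacian_spectrum H = laplacian_spectrum (rose 3 3)"
  shows "\<not> mate_degrees H a b c p"
proof
  assume m: "mate_degrees H a b c p"
  note nb = simple_graph_nbrs[OF H]
  have R: "simple_graph (rose 3 3)" by (rule simple_graph_rose) auto
  have T: "card (triangles H) = 6"
    using mate_card_triangles[of 3 3, OF _ _ H spec m] triangles_rose_3_3 by simp
  have n: "card (verts H) = 5" using cospectral_traces(1)[OF H R spec] by (simp add: verts_rose)
  have "card (verts H - {a, b, c, p}) = 1" using sum_mate(2)[OF H m] n by simp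
  then obtain e where e: "verts H - {a, b, c, p} = {e}" by (auto simp: card_1_singleton_iff)
  have V: "verts H = {a, b, c, p, e}" using e m by (auto simp: mate_degrees_def)
  have d: "distinct [a, b, c, p, e]" using e m by (auto simp: mate_degrees_def)
  have dg: "deg H a = 3" "deg H b = 3" "deg H c = 3" "deg H p = 1" "deg H e = 2"
    using m e by (auto simp: mate_degrees_def)
  obtain r where r: "nbrs H p = {r}" using dg(4) by (auto simp: deg_def card_1_singleton_iff)
  have rV: "r \<in> {a, b, c, p, e}" "r \<noteq> p" using nb(1)[of p] nb(3)[of p] r V by auto
  have full: "nbrs H x = {y, z, e}"
    if "deg H x = 3" "x \<noteq> r" "{x, y, z} = {a, b, c}" "distinct [x, y, z]" for x y z
  proof -
    have "p \<notin> nbrs H x" using r that(2) nbrs_sym[of p H x] by auto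
    moreover have "verts H = {x, y, z} \<union> {p, e}" unfolding V that(3) by auto
    ultimately have "nbrs H x \<subseteq> {y, z, e}" using nb(1)[of x] nb(3)[of x] by auto
    moreover have "card {y, z, e} = 3" using that(3,4) d by auto
    ultimately show ?thesis using that(1) card_subset_eq[of "{y, z, e}" "nbrs H x"] by (simp add: deg_def)
  qed
  show False
  proof (cases "r = e")
    case True
    then have "nbrs H a = {b, c, e}" "nbrs H b = {a, c, e}" "nbrs H c = {a, b, e}"
      using full[of a b c] full[of b a c] full[of c a b] dg d by auto
    then have "{a, b, c} \<subseteq> nbrs H e" using nbrs_sym[of e H] by auto
    then have "card {a, b, c} \<le> deg H e" unfolding deg_def by (intro card_mono nb(2))
    then show False using dg(5) d by simp
  next
    case False
    have key: False if "nbrs H x = {y, z, e}" "nbrs H y = {x, z, e}" "distinct [x, y, z, e]" for x y z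
    proof -
      have s: "x \<in> nbrs H z" "y \<in> nbrs H z" "x \<in> nbrs H e" "y \<in> nbrs H e"
        using that nbrs_sym[of z H] nbrs_sym[of e H] by auto
      \<comment> \<open>All six orders of one triangle and a single order of a second one already
        exceed the count 6.\<close>
      let ?T = "{(x, y, z), (x, z, y), (y, x, z), (y, z, x), (z, x, y), (z, y, x), (x, y, e)}"
      have "?T \<subseteq> triangles H" using s that by (simp add: triangles_def)
      then have "card ?T \<le> card (triangles H)" by (rule card_mono[OF finite_triangles[OF H]])
      moreover have "card ?T = 7" using that(3) by simp
      ultimately show False using T by simp
    qed
    from rV False consider "r = a" | "r = b" | "r = c" by auto
    then show False
    proof cases
      case 1
      then show False using key[of b c a] full[of b c a] full[of c b a] dg d by auto
    next
      case 2
      then show False using key[of a c b] full[of a c b] full[of c a b] dg d by auto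
    next
      case 3
      then show False using key[of a b c] full[of a b c] full[of b a c] dg d by auto
    qed
  qed
qed

lemma cospectral_mate_classification:
  assumes kl: "3 \<le> k" "k \<le> l" and H: "simple_graph H"
    and spec: "laplacian_spectrum H = laplacian_spectrum (rose k l)" and m: "mate_degrees H a b c p"
  shows "k = 3 \<and> (l = 4 \<and> graph_iso H mate4 \<or> l = 5 \<and> graph_iso H mate5)"
proof -
  have l3: "l \<ge> 3" using kl by simp
  have "card (triangles (rose k l)) > 0" using mate_card_triangles[OF kl(1) l3 H spec m] by simp
  then have "triangles (rose k l) \<noteq> {}" by auto
  then have k: "k = 3" by (rule triangles_rose_nonempty[OF kl])
  note spec = spec[unfolded k]
  have "l \<noteq> 3" using mate_not_cospectral_rose_3_3[OF H] spec m by blast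
  then have l: "l \<ge> 4" using l3 by simp
  have R: "simple_graph (rose 3 l)" using l3 by (intro simple_graph_rose) auto
  have n: "card (verts H) = l + 2" using cospectral_traces(1)[OF H R spec] l3 by (simp add: verts_rose)
  have conn: "graph_connected H" using cospectral_rose_connected[OF _ l3 H spec] by simp
  note fc = mate_four_cycles[OF l H spec m]
  interpret cospectral_mate H a b c p "card (four_cycles (rose 3 l))"
    by unfold_locales (use H conn m fc card_four_cycles_dvd[OF R] in auto)
  \<comment> \<open>Without a triangle the three hubs span at most two edges, each counted twice,
    and edges to \<open>p\<close> only lower the value. The 4-cycle identity then leaves at least 12
    tuples, more than the 8 of a single cycle.\<close>
  have "deviation_form H \<le> 4"
  proof -
    have "(a, b, c) \<notin> triangles H" using fc(1) by simp
    then have "\<not> (b \<in> nbrs H a \<and> c \<in> nbrs H b \<and> a \<in> nbrs H c)"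
      using nbrs_sym[of a H c] by (auto simp: triangles_def)
    then show ?thesis unfolding deviation_form_mate[OF H m] by auto
  qed
  then have "card (four_cycles H) > 8" using fc(2) by linarith
  show ?thesis
  proof (rule two_four_cycles[OF H deg_le_3 fc(1) \<open>card (four_cycles H) > 8\<close>])
    fix u x w y u' x' w' y'
    assume disjoint: "(u, x, w, y) \<in> four_cycles H" "(u', x', w', y') \<in> four_cycles H"
      "{u, x, w, y} \<inter> {u', x', w', y'} = {}"
    have "(\<Sum>v\<in>verts H. int (deg H v)) = 2 * int (card (verts H)) + 2"
      using sum_deg_mate[OF H m, of "\<lambda>d. d"] by simp
    then have "card (edges H) = card (verts H) + 1"
      using sum_deg[OF H] by (simp flip: of_nat_sum)
    moreover have uV: "u \<in> verts H" using four_cycles_distinct(2)[OF H disjoint(1)] by simp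
    obtain us where us: "distinct us" "set us = verts H - {u}"
      using finite_distinct_list[of "verts H - {u}"] H by (auto simp: simple_graph_def)
    have vs: "distinct (u # us)" "set (u # us) = verts H" using us uV by auto
    have "det (mat_on us (lap H) :: int mat) = int (3 * l)"
      using cospectral_rose_reduced_det[OF _ l3 H spec vs] by simp
    then have "3 dvd det (mat_on us (lap H) :: int mat)" by simp
    ultimately show ?thesis using no_disjoint_four_cycles[OF H conn _ disjoint vs] by blast
  next
    fix u w x y z
    assume "u \<noteq> w" "distinct [x, y, z]" "{x, y, z} \<subseteq> nbrs H u" "{x, y, z} \<subseteq> nbrs H w"
    then show ?thesis using k23_case[of u w x y z] n k by simp
  next
    fix u x w y w' y'
    assume "(u, x, w, y) \<in> four_cycles H" "(u, x, w', y') \<in> four_cycles H" "distinct [u, x, w, y, w', y']"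
    then show ?thesis using ladder_case[of u x w y w' y'] n k by simp
  qed
qed

lemma sum_prod_eq_imp_eq:
  fixes k l k' l' :: nat
  assumes "k + l = k' + l'" "k * l = k' * l'" "k \<le> l" "k' \<le> l'"
  shows "k = k'" "l = l'"
proof -
  have "int l = int k' + int l' - int k" using assms(1) by linarith
  moreover have "int k * int l = int k' * int l'" using assms(2) by (metis of_nat_mult)
  ultimately have "int k * (int k' + int l' - int k) = int k' * int l'" by simp
  \<comment> \<open>Equal sums and products make both pairs the roots of one monic quadratic; this
    is its factorisation evaluated at \<open>k\<close>.\<close>
  then have "(int k - int k') * (int k - int l') = 0" by (simp add: algebra_simps)
  then have "k = k' \<or> k = l'" by auto
  then show "k = k'" using assms by auto
  then show "l = l'" using assms(1) by simp
qed

lemma cospectral_rose_classification: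
  assumes kl: "3 \<le> k" "k \<le> l" and H: "simple_graph H"
    and spec: "laplacian_spectrum H = laplacian_spectrum (rose k l)"
  shows "graph_iso H (rose k l) \<or> k = 3 \<and> (l = 4 \<and> graph_iso H mate4 \<or> l = 5 \<and> graph_iso H mate5)"
proof -
  have l3: "l \<ge> 3" using kl by simp
  show ?thesis
  proof (cases rule: cospectral_rose_degrees[OF kl(1) l3 H spec])
    case (1 v)
    have "two_rose H"
      using two_rose_of_degrees[OF H cospectral_rose_connected[OF kl(1) l3 H spec] 1(1,2)] 1(3) by blast
    then obtain k' l' where kl': "3 \<le> k'" "k' \<le> l'" "graph_iso H (rose k' l')"
      by (rule two_rose_iso_rose)
    have l3': "l' \<ge> 3" using kl' by simp
    note R = simple_graph_rose[OF kl(1) l3] and R' = simple_graph_rose[OF kl'(1) l3']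
    have spec': "laplacian_spectrum (rose k' l') = laplacian_spectrum (rose k l)"
      using graph_iso_laplacian_spectrum[OF kl'(3) H R'] spec by simp
    have "distinct (0 # [1..<k' + l' - 1])" "set (0 # [1..<k' + l' - 1]) = verts (rose k' l')"
      using kl' l3' by (auto simp: verts_rose[OF kl'(1) l3'])
    from cospectral_rose_reduced_det[OF kl(1) l3 R' spec' this]
    have "int (k' * l') = int (k * l)" unfolding det_lap_rose[OF kl'(1) l3'] .
    then have prod: "k * l = k' * l'" by (metis of_nat_eq_iff)
    have "k' + l' - 1 = k + l - 1"
      using cospectral_traces(1)[OF R' R spec'] by (simp add: verts_rose kl(1) l3 kl'(1) l3')
    then have "k + l = k' + l'" using kl kl' by linarith
    then have "k = k'" "l = l'" using sum_prod_eq_imp_eq[of k l k' l'] prod kl(2) kl'(2) by auto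
    then show ?thesis using kl'(3) by simp
  next
    case (2 a b c p)
    then show ?thesis using cospectral_mate_classification[OF kl H spec] by blast
  qed
qed

section \<open>Cospectrality of the two mates by explicit similarity matrices\<close>

lemma similar_mat_on:
  fixes f g p q :: "'a \<Rightarrow> 'a \<Rightarrow> int" and d :: int
  assumes vs: "distinct vs" and d: "d \<noteq> 0"
    and fp: "\<forall>u\<in>set vs. \<forall>w\<in>set vs. (\<Sum>z\<in>set vs. f u z * p z w) = (\<Sum>z\<in>set vs. p u z * g z w)"
    and pq: "\<forall>u\<in>set vs. \<forall>w\<in>set vs. (\<Sum>z\<in>set vs. p u z * q z w) = (if u = w then d else 0)"
  shows "similar_mat (mat_on vs f :: complex mat) (mat_on vs g)"
proof -
  let ?n = "length vs"
  define P :: "complex mat" where "P = mat_on vs p"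
  \<comment> \<open>The common denominator \<open>d\<close> is divided out only here, so the witness
    \<open>q\<close> for the inverse stays integral.\<close>
  define Q :: "complex mat" where "Q = (1 / of_int d) \<cdot>\<^sub>m mat_on vs q"
  let ?F = "mat_on vs f :: complex mat" and ?G = "mat_on vs g :: complex mat"
  have car: "P \<in> carrier_mat ?n ?n" "Q \<in> carrier_mat ?n ?n" "?F \<in> carrier_mat ?n ?n" "?G \<in> carrier_mat ?n ?n"
    by (auto simp: P_def Q_def)
  have cong: "mat_on vs h = (mat_on vs h' :: complex mat)" if "\<forall>u\<in>set vs. \<forall>w\<in>set vs. h u w = h' u w" for h h'
    using that by (intro eq_matI) (auto simp: mat_on_def)
  have FP: "?F * P = P * ?G"
    unfolding P_def mat_on_mult[OF vs] using fp by (intro cong)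
  have "P * mat_on vs q = mat_on vs (\<lambda>u w. if u = w then d else 0)"
    unfolding P_def mat_on_mult[OF vs] using pq by (intro cong)
  also have "\<dots> = of_int d \<cdot>\<^sub>m 1\<^sub>m ?n"
    using vs by (intro eq_matI) (auto simp: mat_on_def nth_eq_iff_index_eq)
  finally have PQ: "P * Q = 1\<^sub>m ?n"
    unfolding Q_def using d car(1) by (subst mult_smult_distrib[of _ ?n ?n _ ?n]) (auto intro!: eq_matI)
  have QP: "Q * P = 1\<^sub>m ?n" by (rule mat_mult_left_right_inverse[OF car(1,2) PQ])
  have "?F = ?F * (P * Q)" using PQ car(3) by simp
  also have "\<dots> = P * ?G * Q" unfolding FP[symmetric] using assoc_mult_mat[OF car(3,1,2)] by simp
  finally have F: "?F = P * ?G * Q" .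
  show ?thesis by (rule similar_matI[OF _ PQ QP F]) (use car in auto)
qed

text \<open>The entries of the two Laplacians enter through separate functions \<open>f\<close> and
  \<open>g\<close>, to be given by formulas or tables, so that the matrix identities become finite
  statements decided by evaluation.\<close>

lemma cospectral_of_similarity:
  assumes "simple_graph G" "simple_graph H" "verts G = set [0..<n]" "verts H = set [0..<n]"
    and "d \<noteq> 0"
    and lap: "\<forall>u\<in>set [0..<n]. \<forall>w\<in>set [0..<n]. lap G u w = f u w" "\<forall>u\<in>set [0..<n]. \<forall>w\<in>set [0..<n]. lap H u w = g u w"
    and fp: "\<forall>u\<in>set [0..<n]. \<forall>w\<in>set [0..<n]. (\<Sum>z\<in>set [0..<n]. f u z * p z w) = (\<Sum>z\<in>set [0..<n]. p u z * g z w)"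
    and pq: "\<forall>u\<in>set [0..<n]. \<forall>w\<in>set [0..<n]. (\<Sum>z\<in>set [0..<n]. p u z * q z w) = (if u = w then d else 0)"
  shows "laplacian_spectrum G = laplacian_spectrum H"
proof -
  have "(\<Sum>z\<in>set [0..<n]. lap G u z * p z w) = (\<Sum>z\<in>set [0..<n]. p u z * lap H z w)"
    if "u \<in> set [0..<n]" "w \<in> set [0..<n]" for u w
  proof -
    have "(\<Sum>z\<in>set [0..<n]. lap G u z * p z w) = (\<Sum>z\<in>set [0..<n]. f u z * p z w)"
      using lap(1) that by (intro sum.cong) auto
    also have "\<dots> = (\<Sum>z\<in>set [0..<n]. p u z * g z w)" using fp that by blast
    also have "\<dots> = (\<Sum>z\<in>set [0..<n]. p u z * lap H z w)" using lap(2) that by (intro sum.cong) auto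
    finally show ?thesis .
  qed
  then have "similar_mat (mat_on [0..<n] (lap G) :: complex mat) (mat_on [0..<n] (lap H))"
    by (intro similar_mat_on[OF _ \<open>d \<noteq> 0\<close> _ pq]) auto
  then have "char_poly (mat_on [0..<n] (lap G) :: complex mat) = char_poly (mat_on [0..<n] (lap H))"
    by (rule char_poly_similar)
  moreover have "laplacian_spectrum G = proots (char_poly (mat_on [0..<n] (lap G)))"
    using laplacian_spectrum_eq[of "[0..<n]" G] laplacian_mat_eq_mat_on[of G "[0..<n]"] assms by simp
  moreover have "laplacian_spectrum H = proots (char_poly (mat_on [0..<n] (lap H)))"
    using laplacian_spectrum_eq[of "[0..<n]" H] laplacian_mat_eq_mat_on[of H "[0..<n]"] assms by simp
  ultimately show ?thesis by simp
qed


lemma lap_rose_3: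
  assumes "l \<ge> 3"
  shows "\<forall>u\<in>set [0..<l + 2]. \<forall>w\<in>set [0..<l + 2]. lap (rose 3 l) u w =
    (if u = w then if u = 0 then 4 else 2 else 0) -
    (if w = Suc u \<and> w \<noteq> 3 \<or> u = Suc w \<and> u \<noteq> 3 \<or> u = 0 \<and> (w = 2 \<or> w = 3 \<or> w = l + 1) \<or>
       w = 0 \<and> (u = 2 \<or> u = 3 \<or> u = l + 1) then 1 else 0)"
proof (intro ballI)
  fix u w assume "u \<in> set [0..<l + 2]" "w \<in> set [0..<l + 2]"
  then have uw: "u < l + 2" "w < l + 2" by auto
  have kl: "3 \<le> (3::nat)" "3 \<le> l" using assms by auto
  have "w \<in> nbrs (rose 3 l) u \<longleftrightarrow> w = Suc u \<and> w \<noteq> 3 \<or> u = Suc w \<and> u \<noteq> 3 \<or>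
      u = 0 \<and> (w = 2 \<or> w = 3 \<or> w = l + 1) \<or> w = 0 \<and> (u = 2 \<or> u = 3 \<or> u = l + 1)"
    unfolding nbrs_rose[OF kl] using uw by auto
  moreover have "deg (rose 3 l) u = (if u = 0 then 4 else 2)"
    using deg_rose[OF kl] uw by auto
  ultimately show "lap (rose 3 l) u w =
    (if u = w then if u = 0 then 4 else 2 else 0) -
    (if w = Suc u \<and> w \<noteq> 3 \<or> u = Suc w \<and> u \<noteq> 3 \<or> u = 0 \<and> (w = 2 \<or> w = 3 \<or> w = l + 1) \<or>
       w = 0 \<and> (u = 2 \<or> u = 3 \<or> u = l + 1) then 1 else 0)"
    by (auto simp: lap_def)
qed

text \<open>Replaces the cardinality of a set comprehension by the length of a filtered list, which
  can be computed from the table \<open>ps\<close> of adjacent pairs.\<close>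

lemma deg_eq_length_filter:
  assumes "simple_graph G" "verts G = set [0..<n]" and "\<And>u w. w \<in> nbrs G u \<longleftrightarrow> (u, w) \<in> set ps"
  shows "deg G u = length (filter (\<lambda>w. (u, w) \<in> set ps) [0..<n])"
proof -
  have "nbrs G u = set (filter (\<lambda>w. (u, w) \<in> set ps) [0..<n])"
    using simple_graph_nbrs(1)[OF assms(1), of u] assms(2,3) by auto
  then show ?thesis unfolding deg_def by (simp only: distinct_card distinct_filter distinct_upt)
qed

lemma lap_eq_length_filter:
  assumes "simple_graph G" "verts G = set [0..<n]" and "\<And>u w. w \<in> nbrs G u \<longleftrightarrow> (u, w) \<in> set ps"
  shows "lap G u w = (if u = w then int (length (filter (\<lambda>w. (u, w) \<in> set ps) [0..<n])) else 0) -
    (if (u, w) \<in> set ps then 1 else 0)"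
  unfolding lap_def deg_eq_length_filter[OF assms] assms(3) ..

lemma simple_graph_mates: "simple_graph mate4" "simple_graph mate5"
  by (auto simp: simple_graph_def mate4_def mate5_def)

definition lap4 :: "int list list" where
  "lap4 = [[3, 0, - 1, - 1, - 1, 0], [0, 3, - 1, - 1, - 1, 0], [- 1, - 1, 3, 0, 0, - 1],
    [- 1, - 1, 0, 2, 0, 0], [- 1, - 1, 0, 0, 2, 0], [0, 0, - 1, 0, 0, 1]]"

text \<open>An integer solution \<open>P\<close> of \<open>L(R(3, 4)) P = P L(mate4)\<close> with \<open>P P\<^sup>T = 4\<close>.\<close>

definition sim4 :: "int list list" where
  "sim4 = [[- 1, 0, 1, 1, 1, 0], [1, 1, 1, 0, 0, - 1], [1, 0, - 1, 1, 1, 0],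
    [0, 1, 0, 1, - 1, 1], [1, - 1, 1, 0, 0, 1], [0, 1, 0, - 1, 1, 1]]"

definition lap5 :: "int list list" where
  "lap5 = [[3, - 1, 0, - 1, 0, - 1, 0], [- 1, 3, - 1, 0, - 1, 0, 0], [0, - 1, 3, - 1, 0, 0, - 1],
    [- 1, 0, - 1, 2, 0, 0, 0], [0, - 1, 0, 0, 2, - 1, 0], [- 1, 0, 0, 0, - 1, 2, 0], [0, 0, - 1, 0, 0, 0, 1]]"

text \<open>An integer solution \<open>P\<close> of \<open>L(R(3, 5)) P = P L(mate5)\<close>; \<open>sim5_inv\<close> is \<open>2 P\<^sup>-\<^sup>1\<close>.\<close>

definition sim5 :: "int list list" where
  "sim5 = [[- 2, 2, - 2, 1, - 1, 1, 0], [0, - 1, 0, 0, 1, 0, - 1], [1, 0, 0, - 1, 0, 0, - 1],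
    [1, - 1, 0, 0, 0, - 1, 0], [- 1, 0, 1, 0, - 1, 0, 0], [0, 0, - 1, 0, 0, - 1, 1], [0, - 1, 1, - 1, 0, 0, 0]]"

definition sim5_inv :: "int list list" where
  "sim5_inv = [[0, - 1, 0, 1, - 1, - 1, 0], [- 1, 0, 1, - 2, 1, 1, - 2], [- 1, 0, 0, - 1, 1, 0, - 1],
    [0, 0, - 1, 1, 0, - 1, - 1], [- 1, 1, 0, - 2, 0, 1, - 1], [1, - 1, - 1, 1, - 2, - 2, 2], [0, - 1, - 1, 0, - 1, 0, 1]]"

lemma verts_mates: "verts mate4 = set [0..<6]" "verts mate5 = set [0..<7]"
  by (auto simp: mate4_def mate5_def)

lemma nbrs_mate4: "w \<in> nbrs mate4 u \<longleftrightarrow> (u, w) \<in> set [(0, 2), (0, 3), (0, 4), (1, 2), (1, 3), (1, 4), (2, 5), (2, 0), (3, 0), (4, 0), (2, 1), (3, 1), (4, 1), (5, 2)]"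
  by (auto simp: nbrs_def mate4_def doubleton_eq_iff)

lemma nbrs_mate5: "w \<in> nbrs mate5 u \<longleftrightarrow> (u, w) \<in> set [(0, 1), (1, 2), (2, 3), (3, 0), (1, 4), (4, 5), (5, 0), (2, 6), (1, 0), (2, 1), (3, 2), (0, 3), (4, 1), (5, 4), (0, 5), (6, 2)]"
  by (auto simp: nbrs_def mate5_def doubleton_eq_iff)

lemma lap_mate4: "\<forall>u\<in>set [0..<6]. \<forall>w\<in>set [0..<6]. lap mate4 u w = lap4 ! u ! w"
  unfolding lap_eq_length_filter[OF simple_graph_mates(1) verts_mates(1) nbrs_mate4] by code_simp

lemma lap_mate5: "\<forall>u\<in>set [0..<7]. \<forall>w\<in>set [0..<7]. lap mate5 u w = lap5 ! u ! w"
  unfolding lap_eq_length_filter[OF simple_graph_mates(2) verts_mates(2) nbrs_mate5] by code_simp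

lemma laplacian_spectrum_mate4: "laplacian_spectrum (rose 3 4) = laplacian_spectrum mate4"
proof (rule cospectral_of_similarity[where d = 4 and n = 6])
  show "\<forall>u\<in>set [0..<6]. \<forall>w\<in>set [0..<6]. lap mate4 u w = lap4 ! u ! w" by (rule lap_mate4)
  show "\<forall>u\<in>set [0..<6]. \<forall>w\<in>set [0..<6]. lap (rose 3 4) u w =
    (if u = w then if u = 0 then 4 else 2 else 0) -
    (if w = Suc u \<and> w \<noteq> 3 \<or> u = Suc w \<and> u \<noteq> 3 \<or> u = 0 \<and> (w = 2 \<or> w = 3 \<or> w = 4 + 1) \<or>
       w = 0 \<and> (u = 2 \<or> u = 3 \<or> u = 4 + 1) then 1 else 0)"
    using lap_rose_3[of 4] by simp
  show "\<forall>u\<in>set [0..<6]. \<forall>w\<in>set [0..<6]. (\<Sum>z\<in>set [0..<6].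
    ((if u = z then if u = 0 then 4 else 2 else 0) -
    (if z = Suc u \<and> z \<noteq> 3 \<or> u = Suc z \<and> u \<noteq> 3 \<or> u = 0 \<and> (z = 2 \<or> z = 3 \<or> z = 4 + 1) \<or>
       z = 0 \<and> (u = 2 \<or> u = 3 \<or> u = 4 + 1) then 1 else 0)) * (sim4 ! z ! w)) = (\<Sum>z\<in>set [0..<6]. (sim4 ! u ! z) * (lap4 ! z ! w))"
    by code_simp
  show "\<forall>u\<in>set [0..<6]. \<forall>w\<in>set [0..<6]. (\<Sum>z\<in>set [0..<6]. (sim4 ! u ! z) * (sim4 ! w ! z)) = (if u = w then 4 else 0)"
    by code_simp
  show "simple_graph (rose 3 4)" by (rule simple_graph_rose) auto
  show "verts (rose 3 4) = set [0..<6]" by (auto simp: verts_rose)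
  show "verts mate4 = set [0..<6]" by (rule verts_mates)
qed (simp_all add: simple_graph_mates)

lemma laplacian_spectrum_mate5: "laplacian_spectrum (rose 3 5) = laplacian_spectrum mate5"
proof (rule cospectral_of_similarity[where d = 2 and n = 7])
  show "\<forall>u\<in>set [0..<7]. \<forall>w\<in>set [0..<7]. lap mate5 u w = lap5 ! u ! w" by (rule lap_mate5)
  show "\<forall>u\<in>set [0..<7]. \<forall>w\<in>set [0..<7]. lap (rose 3 5) u w =
    (if u = w then if u = 0 then 4 else 2 else 0) -
    (if w = Suc u \<and> w \<noteq> 3 \<or> u = Suc w \<and> u \<noteq> 3 \<or> u = 0 \<and> (w = 2 \<or> w = 3 \<or> w = 5 + 1) \<or>
       w = 0 \<and> (u = 2 \<or> u = 3 \<or> u = 5 + 1) then 1 else 0)"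
    using lap_rose_3[of 5] by simp
  show "\<forall>u\<in>set [0..<7]. \<forall>w\<in>set [0..<7]. (\<Sum>z\<in>set [0..<7].
    ((if u = z then if u = 0 then 4 else 2 else 0) -
    (if z = Suc u \<and> z \<noteq> 3 \<or> u = Suc z \<and> u \<noteq> 3 \<or> u = 0 \<and> (z = 2 \<or> z = 3 \<or> z = 5 + 1) \<or>
       z = 0 \<and> (u = 2 \<or> u = 3 \<or> u = 5 + 1) then 1 else 0)) * (sim5 ! z ! w)) = (\<Sum>z\<in>set [0..<7]. (sim5 ! u ! z) * (lap5 ! z ! w))"
    by code_simp
  show "\<forall>u\<in>set [0..<7]. \<forall>w\<in>set [0..<7]. (\<Sum>z\<in>set [0..<7]. (sim5 ! u ! z) * (sim5_inv ! z ! w)) = (if u = w then 2 else 0)"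
    by code_simp
  show "simple_graph (rose 3 5)" by (rule simple_graph_rose) auto
  show "verts (rose 3 5) = set [0..<7]" by (auto simp: verts_rose)
  show "verts mate5 = set [0..<7]" by (rule verts_mates)
qed (simp_all add: simple_graph_mates)

lemma not_graph_iso_rose:
  assumes K: "simple_graph K" "\<And>u. u \<in> verts K \<Longrightarrow> deg K u \<le> 3" and kl: "k \<ge> 3" "l \<ge> 3"
  shows "\<not> graph_iso K (rose k l)"
proof
  assume "graph_iso K (rose k l)"
  then have "graph_iso (rose k l) K" by (rule graph_iso_sym)
  then obtain f where f: "bij_betw f (verts (rose k l)) (verts K)" "\<forall>u\<in>verts (rose k l). deg K (f u) = deg (rose k l) u"
    using graph_iso_degE[OF _ simple_graph_rose[OF kl] K(1)] by metis
  have 0: "0 \<in> verts (rose k l)" using kl by (simp add: verts_rose)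
  then have "f 0 \<in> verts K" "deg K (f 0) = 4" using f deg_rose(1)[OF kl] by (auto simp: bij_betw_def)
  then show False using K(2)[of "f 0"] by simp
qed

lemma deg_mates:
  "u \<in> verts mate4 \<Longrightarrow> deg mate4 u \<le> 3" "u \<in> verts mate5 \<Longrightarrow> deg mate5 u \<le> 3"
proof -
  have "\<forall>u\<in>set [0..<6]. deg mate4 u \<le> 3"
    unfolding deg_eq_length_filter[OF simple_graph_mates(1) verts_mates(1) nbrs_mate4] by code_simp
  moreover have "\<forall>u\<in>set [0..<7]. deg mate5 u \<le> 3"
    unfolding deg_eq_length_filter[OF simple_graph_mates(2) verts_mates(2) nbrs_mate5] by code_simp
  ultimately show "u \<in> verts mate4 \<Longrightarrow> deg mate4 u \<le> 3" "u \<in> verts mate5 \<Longrightarrow> deg mate5 u \<le> 3"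
    unfolding verts_mates by blast+
qed

lemma laplacian_cospectral_mates:
  "laplacian_cospectral_mate (rose 3 4) mate4" "laplacian_cospectral_mate (rose 3 5) mate5"
  unfolding laplacian_cospectral_mate_def
  using simple_graph_mates laplacian_spectrum_mate4 laplacian_spectrum_mate5
    not_graph_iso_rose[OF simple_graph_mates(1) deg_mates(1), of 3 4]
    not_graph_iso_rose[OF simple_graph_mates(2) deg_mates(2), of 3 5] by auto

theorem theorem6p1:
  shows "(\<forall>G :: 'a ugraph. two_rose G \<and> \<not> graph_iso G (rose 3 4) \<and> \<not> graph_iso G (rose 3 5) \<longrightarrow>
            determined_by_laplacian_spectrum TYPE('b) G) \<and>
         (\<forall>l\<in>{4, 5}. \<exists>H :: nat ugraph. laplacian_cospectral_mate (rose 3 l) H \<and>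
            (\<forall>H' :: 'b ugraph. laplacian_cospectral_mate (rose 3 l) H' \<longrightarrow> graph_iso H' H))"
proof (intro conjI allI impI)
  fix G :: "'a ugraph"
  assume G: "two_rose G \<and> \<not> graph_iso G (rose 3 4) \<and> \<not> graph_iso G (rose 3 5)"
  show "determined_by_laplacian_spectrum TYPE('b) G"
    unfolding determined_by_laplacian_spectrum_def
  proof (intro allI impI, elim conjE)
    fix H :: "'b ugraph"
    assume H: "simple_graph H" and spec: "laplacian_spectrum H = laplacian_spectrum G"
    obtain k l where kl: "3 \<le> k" "k \<le> l" "graph_iso G (rose k l)"
      using G two_rose_iso_rose by blast
    have l3: "3 \<le> l" using kl by simp
    have "laplacian_spectrum G = laplacian_spectrum (rose k l)"
      using G by (intro graph_iso_laplacian_spectrum[OF kl(3)] two_rose_simple_graph simple_graph_rose kl(1) l3) blast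
    then have "graph_iso H (rose k l) \<or> k = 3 \<and> (l = 4 \<or> l = 5)"
      using cospectral_rose_classification[OF kl(1,2) H] spec by auto
    moreover have "\<not> (k = 3 \<and> (l = 4 \<or> l = 5))" using G kl(3) by auto
    ultimately have "graph_iso H (rose k l)" by blast
    then show "graph_iso H G" using graph_iso_trans graph_iso_sym[OF kl(3)] by blast
  qed
next
  \<comment> \<open>A mate is by definition not isomorphic to the rose, which leaves only the
    exceptional alternative of the classification.\<close>
  have uniq4: "graph_iso H' mate4" if "laplacian_cospectral_mate (rose 3 4) H'" for H' :: "'b ugraph"
    using cospectral_rose_classification[of 3 4 H'] that by (auto simp: laplacian_cospectral_mate_def)
  have uniq5: "graph_iso H' mate5" if "laplacian_cospectral_mate (rose 3 5) H'" for H' :: "'b ugraph"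
    using cospectral_rose_classification[of 3 5 H'] that by (auto simp: laplacian_cospectral_mate_def)
  show "\<forall>l\<in>{4, 5}. \<exists>H :: nat ugraph. laplacian_cospectral_mate (rose 3 l) H \<and>
            (\<forall>H' :: 'b ugraph. laplacian_cospectral_mate (rose 3 l) H' \<longrightarrow> graph_iso H' H)"
    using uniq4 uniq5 laplacian_cospectral_mates by blast
qed

end
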